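(* Let $n\ge2$, $m\in\mathbb{Z}$, and \[ F^{(1)}_{m,n}(x):=\prod_{\substack{i,j=1\\ i\ne j}}^n\frac{(x_ix_j^{-1};q)_\infty}{(x_ix_j^{-1}z;q)_\infty}\prod_{i=1}^n\frac{(q^{1/2}x_iy;q)_\infty}{(q^{1/2}x_iyz;q)_\infty}\sum_{i=1}^nx_i^m. \] Let $C^{(1)}_m(y,z)$ be the coefficient of $x_1^0\cdots x_{n-1}^0$ in $F^{(1)}_{m,n}(x_1,\dots,x_{n-1},(x_1\cdots x_{n-1})^{-1})$. Then \[ C^{(1)}_0(y,z)=\frac{n\,n!\,(z;q)_\infty^n}{(q;q)_\infty^{n-1}(z^n;q)_\infty(z;z)_{n-1}}\sum_{k=0}^\infty(yq^{1/2})^{nk}\prod_{t=1}^k\prod_{r=1}^n\frac{z^r-q^{t-1}}{1-q^tz^{r-1}}, \] \[ C^{(1)}_1(y,z)=\frac{n!\,(1-z^n)(z;q)_\infty^n}{(q;q)_\infty^{n-1}(1-z)(z^n;q)_\infty(z;z)_{n-1}}\sum_{k=1}^\infty\frac{(yq^{1/2})^{nk-1}(1-q^k)}{z^n-q^{k-1}}\prod_{t=1}^k\prod_{r=1}^n\frac{z^r-q^{t-1}}{1-q^tz^{r-1}}. \]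
   Context: $q,z,y$ are indeterminates (with $|q|<1$, $|z|<1$); $(a;q)_\infty=\prod_{k\ge0}(1-aq^k)$, $(a;q)_n=\prod_{k=0}^{n-1}(1-aq^k)$. The products are expanded as formal power series in $z$ and $q^{1/2}$ whose coefficients are Laurent polynomials in $x_1,\dots,x_n$ (and polynomials in $y$), and coefficients are extracted coefficientwise. *)

theory Defs
  imports Complex_Main "HOL-Library.Poly_Mapping"
    "HOL-Computational_Algebra.Formal_Power_Series"
begin

text \<open>Coefficient ring: Laurent polynomials over the complex numbers in the variables
  V_0, V_1, V_2, ...  (exponent vectors are finitely supported functions nat to int).
  V_0 plays the role of y (only non-negative powers of it ever occur), and V_i (i >= 1)
  plays the role of x_i.\<close>
type_synonym lpoly = "(nat \<Rightarrow>\<^sub>0 int) \<Rightarrow>\<^sub>0 complex"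

text \<open>Formal power series in s = q^(1/2) (outer variable) whose coefficients are formal
  power series in z (inner variable) with coefficients in lpoly.\<close>
type_synonym ser = "lpoly fps fps"

definition mon :: "(nat \<Rightarrow>\<^sub>0 int) \<Rightarrow> lpoly" where
  "mon e = Poly_Mapping.single e 1"

definition mon_pow :: "(nat \<Rightarrow>\<^sub>0 int) \<Rightarrow> int \<Rightarrow> lpoly" where
  "mon_pow e m = (if 0 \<le> m then mon e ^ nat m else mon (- e) ^ nat (- m))"

definition cst :: "lpoly \<Rightarrow> ser" where
  "cst p = fps_const (fps_const p)"

definition zS :: ser where "zS = fps_const fps_X"
definition sS :: ser where "sS = fps_X"
definition qS :: ser where "qS = sS ^ 2"
definition yS :: ser where "yS = cst (mon (Poly_Mapping.single 0 1))"

text \<open>Quotient a/b in the series ring (an integral domain): the unique c with a = b*c.\<close>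
definition sdiv :: "ser \<Rightarrow> ser \<Rightarrow> ser" where
  "sdiv a b = (THE c. a = b * c)"

text \<open>Infinite q-Pochhammer symbol (a;q)_inf, as the limit (in the s-adic topology)
  of the finite products.\<close>
definition qpoch_inf :: "ser \<Rightarrow> ser" where
  "qpoch_inf a = lim (\<lambda>N. \<Prod>k<N. (1 - a * qS ^ k))"

definition qpoch :: "ser \<Rightarrow> ser \<Rightarrow> nat \<Rightarrow> ser" where
  "qpoch a b n = (\<Prod>k<n. (1 - a * b ^ k))"

text \<open>F^(1)_{m,n}(x) where x_i is the Laurent monomial with exponent vector al i.\<close>
definition F1 :: "int \<Rightarrow> nat \<Rightarrow> (nat \<Rightarrow> (nat \<Rightarrow>\<^sub>0 int)) \<Rightarrow> ser" where
  "F1 m n al =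
     (\<Prod>(i, j) \<in> {(i, j). i \<in> {1..n} \<and> j \<in> {1..n} \<and> i \<noteq> j}.
         sdiv (qpoch_inf (cst (mon (al i - al j))))
              (qpoch_inf (cst (mon (al i - al j)) * zS)))
   * (\<Prod>i\<in>{1..n}. sdiv (qpoch_inf (sS * cst (mon (al i)) * yS))
                          (qpoch_inf (sS * cst (mon (al i)) * yS * zS)))
   * (\<Sum>i\<in>{1..n}. cst (mon_pow (al i) m))"

definition xsub :: "nat \<Rightarrow> nat \<Rightarrow> (nat \<Rightarrow>\<^sub>0 int)" where
  "xsub n i = (if i < n then Poly_Mapping.single i 1
               else - (\<Sum>j\<in>{1..<n}. Poly_Mapping.single j (1::int)))"

text \<open>Coefficient of V_1^0 ... V_(n-1)^0 (all x-exponents zero; the y-part is kept).\<close>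
definition ct_x :: "nat \<Rightarrow> lpoly \<Rightarrow> lpoly" where
  "ct_x n p = Abs_poly_mapping
     (\<lambda>e::nat \<Rightarrow>\<^sub>0 int. if (\<forall>i\<in>{1..<n}. Poly_Mapping.lookup e i = 0) then Poly_Mapping.lookup p e else 0)"

definition ct_ser :: "nat \<Rightarrow> ser \<Rightarrow> ser" where
  "ct_ser n F = Abs_fps (\<lambda>a. Abs_fps (\<lambda>b. ct_x n (fps_nth (fps_nth F a) b)))"

definition C1 :: "int \<Rightarrow> nat \<Rightarrow> ser" where
  "C1 m n = ct_ser n (F1 m n (xsub n))"

end

theory Submission
  imports Defs "HOL-Computational_Algebra.Polynomial_FPS"
begin

text \<open>A power series in \<open>q\<close> and \<open>z\<close> is determined by its values at \<open>z = q^K\<close>, \<open>K = 1, 2, \<dots>\<close>. At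
  these values the product over \<open>i \<noteq> j\<close> becomes the Laurent polynomial \<open>\<Delta> = \<Prod> (x_i/x_j; q)_K\<close> and the
  product over \<open>i\<close> becomes \<open>w = \<Prod> (u x_i; q)_K\<close> with \<open>u = q^(1/2) y\<close>; moreover \<open>q\<close> may be taken to be a
  number in \<open>(0, 1)\<close>. Extracting the constant term on \<open>x_1 \<cdots> x_n = 1\<close> amounts to summing over all
  integers \<open>k\<close> the constant terms \<open>\<langle>f\<rangle>_k\<close> of \<open>\<Delta> w f (x_1 \<cdots> x_n)^(-k)\<close> in \<open>n\<close> free variables, with
  \<open>f = n\<close> or \<open>f = e_1\<close>.

  Aomoto's method: constant terms are invariant under \<open>x_i \<mapsto> q x_i\<close>. Applied to
  \<open>\<Delta> w\<close> times \<open>(1 - u x_i / q) \<Prod>_(j \<noteq> i) (x_i - z x_j) / (x_i - x_j)\<close> times an elementary symmetric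
  function of the remaining variables, and summed over \<open>i\<close>, this gives
  \<open>\<langle>e_(r-1)\<rangle>_k (1 - z^(n-r+1)) (1 - q^k z^(r-1)) = u \<langle>e_r\<rangle>_k (1 - z^r) (z^(n-r+1) - q^(k-1))\<close>.
  As \<open>\<langle>e_n\<rangle>_k = \<langle>1\<rangle>_(k-1)\<close>, all terms are expressed by \<open>\<langle>1\<rangle>_0\<close>, the constant term of \<open>\<Delta>\<close>. The latter
  follows by induction on \<open>n\<close> from the same recursion with \<open>2K\<close> in place of \<open>K\<close> in \<open>w\<close>.\<close>

text \<open>At z = q^K the quotients of infinite products in F break off, so that only Laurent
  polynomials occur, and a q-shift multiplies the weight by a rational function of the x_i. Its
  denominators are the obstacle: the factors put in front of the weight are chosen so that neither
  the integrand nor its shift has any. A single shift yields no symmetric function; only the sum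
  over i does, by Lagrange interpolation at the points - x_i. For a number q that is no root of
  unity, every scalar factor of the recursion can be cancelled except where it vanishes, and these
  zeros are what confines k to 0, ..., K; the series in the theorem break off at z = q^K for the
  same reason. Since y remains a variable, u is a Laurent polynomial free of the x_i. The length L
  of w is kept apart from K, because the evaluation of the constant term of \<Delta> needs L = 2K
  and a numerical u. The return from numbers is possible because the constant terms at z = q^K are
  polynomials in s = q^(1/2), and an identity of such polynomials holds once it holds for all s in
  (0, 1).\<close>

section \<open>Symmetric function identities\<close>

text \<open>The coefficient of \<open>v^p\<close> is the elementary symmetric function of degree \<open>card A - p\<close>.\<close>

definition vpoly :: "('i \<Rightarrow> 'a) \<Rightarrow> 'i set \<Rightarrow> 'a::comm_ring_1 poly" where
  "vpoly x A = (\<Prod>j\<in>A. [:x j, 1:])"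

lemma degree_prod_linear_le:
  fixes y :: "'i \<Rightarrow> 'a::comm_ring_1"
  shows "finite A \<Longrightarrow> degree (\<Prod>j\<in>A. [:y j, c:]) \<le> card A"
proof -
  assume "finite A"
  then have "degree (\<Prod>j\<in>A. [:y j, c:]) \<le> sum (degree \<circ> (\<lambda>j. [:y j, c:])) A"
    by (rule degree_prod_sum_le)
  also have "\<dots> \<le> (\<Sum>j\<in>A. 1)"
    by (rule sum_mono) auto
  finally show ?thesis by simp
qed

text \<open>Homogeneity: the coefficient of v^p takes \<alpha> v from p factors and \<beta> x_j from
  the remaining ones. In the applications (\<alpha>, \<beta>) is (1, z) or (z, 1).\<close>

lemma coeff_prod_linear:
  fixes x :: "'i \<Rightarrow> 'a::comm_ring_1"
  assumes "finite A" "p \<le> card A"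
  shows "coeff (\<Prod>j\<in>A. [:\<beta> * x j, \<alpha>:]) p = \<alpha> ^ p * \<beta> ^ (card A - p) * coeff (vpoly x A) p"
  using assms
proof (induction A arbitrary: p rule: finite_induct)
  case empty
  then show ?case by (simp add: vpoly_def)
next
  case (insert a A)
  define P where "P = (\<Prod>j\<in>A. [:\<beta> * x j, \<alpha>:])"
  define V where "V = vpoly x A"
  have P: "(\<Prod>j\<in>insert a A. [:\<beta> * x j, \<alpha>:]) = smult (\<beta> * x a) P + pCons 0 (smult \<alpha> P)"
    using insert by (simp add: P_def)
  have V: "vpoly x (insert a A) = smult (x a) V + pCons 0 V"
    using insert by (simp add: V_def vpoly_def)
  have hi: "coeff P (Suc (card A)) = 0" "coeff V (Suc (card A)) = 0"
    unfolding P_def V_def vpoly_def by (intro coeff_eq_0 le_imp_less_Suc degree_prod_linear_le insert.hyps)+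
  have IH: "coeff P p = \<alpha> ^ p * \<beta> ^ (card A - p) * coeff V p" if "p \<le> card A" for p
    using insert.IH[OF that] by (simp add: P_def V_def)
  show ?case
  proof (cases p)
    case 0
    then show ?thesis using insert.hyps IH[of 0] by (simp add: P V algebra_simps)
  next
    case (Suc k)
    with insert have k: "k \<le> card A" by simp
    show ?thesis
    proof (cases "k = card A")
      case True
      then show ?thesis using insert.hyps Suc IH[of k] hi by (simp add: P V algebra_simps)
    next
      case False
      then have "Suc k \<le> card A" "card A - k = Suc (card A - Suc k)" using k by auto
      then show ?thesis using insert.hyps Suc IH[of k] IH[of "Suc k"]
        by (simp add: P V algebra_simps)
    qed
  qed
qed

lemma coeff_vpoly_card: "finite A \<Longrightarrow> coeff (vpoly x A) (card A) = 1"
proof (induction A rule: finite_induct)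
  case (insert a A)
  have "coeff (vpoly x A) (Suc (card A)) = 0"
    unfolding vpoly_def by (intro coeff_eq_0 le_imp_less_Suc degree_prod_linear_le insert.hyps)
  then show ?case using insert by (simp add: vpoly_def)
qed (simp add: vpoly_def)

lemma coeff_vpoly_0: "coeff (vpoly x A) 0 = (\<Prod>j\<in>A. x j)"
  by (induction A rule: infinite_finite_induct) (auto simp: vpoly_def coeff_mult)

lemma coeff_vpoly_pred:
  "finite A \<Longrightarrow> A \<noteq> {} \<Longrightarrow> coeff (vpoly x A) (card A - 1) = (\<Sum>j\<in>A. x j)"
proof (induction A rule: finite_ne_induct)
  case (insert a A)
  then have "card A = Suc (card A - 1)" by (simp add: card_gt_0_iff)
  moreover have "vpoly x (insert a A) = smult (x a) (vpoly x A) + pCons 0 (vpoly x A)"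
    using insert by (simp add: vpoly_def)
  ultimately show ?case using insert coeff_vpoly_card[of A x]
    by (auto simp: coeff_pCons split: nat.splits)
qed (simp add: vpoly_def)

text \<open>Lagrange interpolation: both sides have degree less than \<open>card A\<close> and agree
  at the points \<open>- x i\<close>.\<close>
lemma sum_x_residues:
  fixes x :: "'i \<Rightarrow> 'a::idom"
  assumes A: "finite A" and inj: "inj_on x A"
    and D: "\<And>i. i \<in> A \<Longrightarrow> D i * (\<Prod>j\<in>A-{i}. x i - x j) = \<Delta> * (\<Prod>j\<in>A-{i}. \<alpha> * x i - \<beta> * x j)"
  shows "smult (\<alpha> - \<beta>) (\<Sum>i\<in>A. smult (x i * D i) (vpoly x (A-{i})))
       = smult \<Delta> (smult (\<alpha> ^ card A) (vpoly x A) - (\<Prod>j\<in>A. [:\<beta> * x j, \<alpha>:]))" (is "?L = ?R")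
proof (cases "A = {}")
  case True
  then show ?thesis by (simp add: vpoly_def)
next
  case False
  then have n: "card A > 0" using A by (simp add: card_gt_0_iff)
  have card: "card ((\<lambda>i. - x i) ` A) = card A"
    using inj by (intro card_image) (auto simp: inj_on_def)
  show ?thesis
  proof (rule poly_eqI_degree[where A = "(\<lambda>i. - x i) ` A"])
    fix v assume "v \<in> (\<lambda>i. - x i) ` A"
    then obtain i where i: "i \<in> A" "v = - x i" by auto
    have z: "poly (vpoly x (A-{k})) v = 0" if "k \<in> A" "k \<noteq> i" for k
      unfolding vpoly_def poly_prod using A i that by (intro prod_zero) auto
    have "poly ?L v = (\<alpha> - \<beta>) * (\<Sum>k\<in>A. x k * D k * poly (vpoly x (A-{k})) v)"
      by (simp add: poly_sum)
    also have "(\<Sum>k\<in>A. x k * D k * poly (vpoly x (A-{k})) v) = x i * D i * poly (vpoly x (A-{i})) v"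
      using A i z by (subst sum.remove[of _ i]) auto
    also have "poly (vpoly x (A-{i})) v = (\<Prod>j\<in>A-{i}. (-1) * (x i - x j))"
      using i by (simp add: vpoly_def poly_prod)
    also have "\<dots> = (-1) ^ card (A-{i}) * (\<Prod>j\<in>A-{i}. x i - x j)"
      by (simp only: prod.distrib prod_constant)
    finally have L: "poly ?L v = (-1) ^ card (A-{i}) * (\<alpha> - \<beta>) * x i * (\<Delta> * (\<Prod>j\<in>A-{i}. \<alpha> * x i - \<beta> * x j))"
      by (simp add: D[OF i(1), symmetric] mult_ac)
    have "poly (vpoly x A) v = 0"
      unfolding vpoly_def poly_prod using A i by (intro prod_zero) auto
    then have "poly ?R v = - \<Delta> * (\<Prod>j\<in>A. \<beta> * x j - \<alpha> * x i)"
      using i by (simp add: poly_prod algebra_simps)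
    also have "(\<Prod>j\<in>A. \<beta> * x j - \<alpha> * x i) = (\<beta> - \<alpha>) * x i * (\<Prod>j\<in>A-{i}. (-1) * (\<alpha> * x i - \<beta> * x j))"
      using A i by (subst prod.remove[of _ i]) (auto simp: algebra_simps)
    also have "(\<Prod>j\<in>A-{i}. (-1) * (\<alpha> * x i - \<beta> * x j)) = (-1) ^ card (A-{i}) * (\<Prod>j\<in>A-{i}. \<alpha> * x i - \<beta> * x j)"
      by (simp only: prod.distrib prod_constant)
    finally have R: "poly ?R v = - \<Delta> * ((\<beta> - \<alpha>) * x i *
      ((-1) ^ card (A-{i}) * (\<Prod>j\<in>A-{i}. \<alpha> * x i - \<beta> * x j)))" .
    show "poly ?L v = poly ?R v" unfolding L R by (simp add: algebra_simps)
  next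
    have "degree ?L \<le> card A - 1"
    proof (rule order.trans[OF degree_smult_le], rule degree_sum_le)
      fix i assume "i \<in> A"
      have "degree (vpoly x (A-{i})) \<le> card (A-{i})"
        unfolding vpoly_def by (rule degree_prod_linear_le) (use A in auto)
      then show "degree (smult (x i * D i) (vpoly x (A-{i}))) \<le> card A - 1"
        using \<open>i \<in> A\<close> A by (intro order.trans[OF degree_smult_le]) auto
    qed (use A in auto)
    then show "degree ?L < card ((\<lambda>i. - x i) ` A)" using n card by simp
    have "degree (smult (\<alpha> ^ card A) (vpoly x A) - (\<Prod>j\<in>A. [:\<beta> * x j, \<alpha>:])) \<le> card A"
      unfolding vpoly_def
      by (intro degree_diff_le order.trans[OF degree_smult_le] degree_prod_linear_le A)
    \<comment> \<open>The two leading coefficients are both \<alpha>^(card A); their cancellation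
      brings the degree below the number of nodes.\<close>
    moreover have "coeff (smult (\<alpha> ^ card A) (vpoly x A) - (\<Prod>j\<in>A. [:\<beta> * x j, \<alpha>:])) (card A) = 0"
      using A by (simp add: coeff_prod_linear coeff_vpoly_card)
    ultimately have "degree (smult (\<alpha> ^ card A) (vpoly x A) - (\<Prod>j\<in>A. [:\<beta> * x j, \<alpha>:])) < card A"
      using n by (metis degree_0 le_neq_implies_less leading_coeff_0_iff)
    then show "degree ?R < card ((\<lambda>i. - x i) ` A)"
      using card by (metis degree_smult_le order.strict_trans1)
  qed
qed

text \<open>The premise on \<open>D\<close> expresses D_i = \<Delta> \<Prod> (\<alpha> x_i - \<beta>
  x_j) / (x_i - x_j) in a ring without quotients. Comparing coefficients in the interpolation
  formula gives one such sum for every elementary symmetric function.\<close>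

lemma sum_x_residues_coeff:
  fixes x :: "'i \<Rightarrow> 'a::idom"
  assumes A: "finite A" and inj: "inj_on x A"
    and D: "\<And>i. i \<in> A \<Longrightarrow> D i * (\<Prod>j\<in>A-{i}. x i - x j) = \<Delta> * (\<Prod>j\<in>A-{i}. \<alpha> * x i - \<beta> * x j)"
    and p: "p \<le> card A"
  shows "(\<alpha> - \<beta>) * (\<Sum>i\<in>A. x i * D i * coeff (vpoly x (A-{i})) p)
       = \<Delta> * (\<alpha> ^ card A - \<alpha> ^ p * \<beta> ^ (card A - p)) * coeff (vpoly x A) p"
  using arg_cong[OF sum_x_residues[OF A inj D], of "\<lambda>P. coeff P p"]
  by (simp add: coeff_sum coeff_prod_linear[OF A p] algebra_simps)

text \<open>For p = 0 the coefficient is the product of all x_j with j \<noteq> i, which x_i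
  completes to the full product; this is then cancelled.\<close>

lemma sum_residues:
  fixes x :: "'i \<Rightarrow> 'a::idom"
  assumes A: "finite A" and inj: "inj_on x A"
    and D: "\<And>i. i \<in> A \<Longrightarrow> D i * (\<Prod>j\<in>A-{i}. x i - x j) = \<Delta> * (\<Prod>j\<in>A-{i}. \<alpha> * x i - \<beta> * x j)"
    and nz: "\<And>i. i \<in> A \<Longrightarrow> x i \<noteq> 0"
  shows "(\<alpha> - \<beta>) * (\<Sum>i\<in>A. D i) = \<Delta> * (\<alpha> ^ card A - \<beta> ^ card A)"
proof -
  have "(\<alpha> - \<beta>) * (\<Sum>i\<in>A. x i * D i * coeff (vpoly x (A-{i})) 0)
       = \<Delta> * (\<alpha> ^ card A - \<beta> ^ card A) * coeff (vpoly x A) 0"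
    using sum_x_residues_coeff[OF A inj D, of 0] by simp
  moreover have "(\<Sum>i\<in>A. x i * D i * coeff (vpoly x (A-{i})) 0) = (\<Sum>i\<in>A. D i) * (\<Prod>j\<in>A. x j)"
    unfolding sum_distrib_right
    by (rule sum.cong) (use A in \<open>auto simp: coeff_vpoly_0 prod.remove algebra_simps\<close>)
  ultimately have "((\<alpha> - \<beta>) * (\<Sum>i\<in>A. D i)) * (\<Prod>j\<in>A. x j) = (\<Delta> * (\<alpha> ^ card A - \<beta> ^ card A)) * (\<Prod>j\<in>A. x j)"
    by (simp add: coeff_vpoly_0 algebra_simps)
  moreover have "(\<Prod>j\<in>A. x j) \<noteq> 0" using A nz by auto
  ultimately show ?thesis by simp
qed

text \<open>With r = card A - 1 - p, the rule e_r(A) = x_i e_(r-1)(A - {i}) + e_r(A - {i}) removes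
  the weight x_i: the sum is e_r(A) times the plain sum minus the weighted sum.\<close>

lemma sum_residues_coeff:
  fixes x :: "'i \<Rightarrow> 'a::idom"
  assumes A: "finite A" and inj: "inj_on x A"
    and D: "\<And>i. i \<in> A \<Longrightarrow> D i * (\<Prod>j\<in>A-{i}. x i - x j) = \<Delta> * (\<Prod>j\<in>A-{i}. \<alpha> * x i - \<beta> * x j)"
    and nz: "\<And>i. i \<in> A \<Longrightarrow> x i \<noteq> 0"
    and p: "p < card A"
  shows "(\<alpha> - \<beta>) * (\<Sum>i\<in>A. D i * coeff (vpoly x (A-{i})) p)
       = \<Delta> * (\<alpha> ^ Suc p * \<beta> ^ (card A - Suc p) - \<beta> ^ card A) * coeff (vpoly x A) (Suc p)"
proof -
  have V: "coeff (vpoly x A) (Suc p) = x i * coeff (vpoly x (A-{i})) (Suc p) + coeff (vpoly x (A-{i})) p"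
    if "i \<in> A" for i
    using A that by (simp add: vpoly_def prod.remove)
  have "(\<Sum>i\<in>A. D i) * coeff (vpoly x A) (Suc p) =
     (\<Sum>i\<in>A. x i * D i * coeff (vpoly x (A-{i})) (Suc p)) + (\<Sum>i\<in>A. D i * coeff (vpoly x (A-{i})) p)"
    unfolding sum_distrib_right sum.distrib[symmetric]
    by (rule sum.cong) (auto simp: V algebra_simps)
  then have "(\<alpha> - \<beta>) * (\<Sum>i\<in>A. D i * coeff (vpoly x (A-{i})) p) =
    ((\<alpha> - \<beta>) * (\<Sum>i\<in>A. D i)) * coeff (vpoly x A) (Suc p) -
    (\<alpha> - \<beta>) * (\<Sum>i\<in>A. x i * D i * coeff (vpoly x (A-{i})) (Suc p))"
    by (simp add: algebra_simps)
  also have "(\<alpha> - \<beta>) * (\<Sum>i\<in>A. D i) = \<Delta> * (\<alpha> ^ card A - \<beta> ^ card A)"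
    by (rule sum_residues[OF A inj D nz])
  also have "(\<alpha> - \<beta>) * (\<Sum>i\<in>A. x i * D i * coeff (vpoly x (A-{i})) (Suc p))
    = \<Delta> * (\<alpha> ^ card A - \<alpha> ^ Suc p * \<beta> ^ (card A - Suc p)) * coeff (vpoly x A) (Suc p)"
    by (rule sum_x_residues_coeff[OF A inj D]) (use p in auto)
  finally show ?thesis by (simp add: algebra_simps)
qed

section \<open>Laurent polynomials\<close>

abbreviation lk :: "(nat \<Rightarrow>\<^sub>0 int) \<Rightarrow> nat \<Rightarrow> int" where
  "lk \<equiv> Poly_Mapping.lookup"

definition scal :: "complex \<Rightarrow> lpoly" where
  "scal c = Poly_Mapping.single 0 c"

lemma scal_0 [simp]: "scal 0 = 0"
  and scal_1 [simp]: "scal 1 = 1"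
  and scal_diff: "scal (a - b) = scal a - scal b"
  and scal_uminus: "scal (- a) = - scal a"
  and scal_mult: "scal (a * b) = scal a * scal b"
  by (simp_all add: scal_def single_add single_diff single_uminus mult_single)

lemma scal_of_nat: "scal (of_nat n) = of_nat n"
  by (simp add: scal_def)

lemma scal_power: "scal (a ^ n) = scal a ^ n"
  by (induction n) (simp_all add: scal_mult)

lemma scal_prod: "scal (prod f A) = (\<Prod>i\<in>A. scal (f i))"
  by (induction A rule: infinite_finite_induct) (simp_all add: scal_mult)

lemma scal_eq_iff [simp]: "scal a = scal b \<longleftrightarrow> a = b"
  unfolding scal_def by (metis lookup_single_eq)

lemma scal_eq_0_iff [simp]: "scal a = 0 \<longleftrightarrow> a = 0"
  using scal_eq_iff[of a 0] by simp

lemma mon_0 [simp]: "mon 0 = 1"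
  by (simp add: mon_def)

lemma mon_add: "mon (a + b) = mon a * mon b"
  by (simp add: mon_def mult_single)

lemma mon_sum: "mon (sum f A) = (\<Prod>i\<in>A. mon (f i))"
  by (induction A rule: infinite_finite_induct) (simp_all add: mon_add)

lemma mon_neq_0 [simp]: "mon a \<noteq> 0"
  by (simp add: mon_def flip: keys_eq_empty)

lemma mon_eq_iff [simp]: "mon a = mon b \<longleftrightarrow> a = b"
proof
  assume "mon a = mon b"
  then have "Poly_Mapping.lookup (mon a) a = Poly_Mapping.lookup (mon b) a" by simp
  then show "a = b" by (auto simp: mon_def lookup_single when_def split: if_splits)
qed auto

lemma lpoly_sum_monomials:
  fixes p :: lpoly
  assumes "finite S" "Poly_Mapping.keys p \<subseteq> S"
  shows "p = (\<Sum>e\<in>S. Poly_Mapping.single e (Poly_Mapping.lookup p e))"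
proof (rule poly_mapping_eqI)
  fix k
  have "(\<Sum>e\<in>S. Poly_Mapping.lookup (Poly_Mapping.single e (Poly_Mapping.lookup p e)) k)
      = (\<Sum>e\<in>S. if k = e then Poly_Mapping.lookup p e else 0)"
    by (rule sum.cong) (auto simp: lookup_single when_def)
  also have "\<dots> = Poly_Mapping.lookup p k"
    using assms by (auto simp: not_in_keys_iff_lookup_eq_zero)
  finally show "Poly_Mapping.lookup p k =
    Poly_Mapping.lookup (\<Sum>e\<in>S. Poly_Mapping.single e (Poly_Mapping.lookup p e)) k"
    by (simp add: lookup_sum)
qed

lemma lpoly_induct [case_names zero single add]:
  fixes p :: lpoly
  assumes "P 0" "\<And>e c. P (Poly_Mapping.single e c)" "\<And>p q. P p \<Longrightarrow> P q \<Longrightarrow> P (p + q)"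
  shows "P p"
proof -
  have "P (\<Sum>e\<in>S. Poly_Mapping.single e (Poly_Mapping.lookup p e))" if "finite S" for S
    using that by (induction S rule: finite_induct) (auto intro: assms)
  from this[of "Poly_Mapping.keys p"] show ?thesis
    using lpoly_sum_monomials[of "Poly_Mapping.keys p" p] by simp
qed

text \<open>The linear map x^e \<mapsto> \<chi>(e) x^(\<phi> e). It covers both kinds of
  substitution used here: q-shifts, where \<phi> is the identity and \<chi> a power of q, and
  monomial changes of variables, where \<chi> = 1. Under \<open>mchar\<close> it is a ring
  homomorphism.\<close>

definition msub :: "((nat \<Rightarrow>\<^sub>0 int) \<Rightarrow> (nat \<Rightarrow>\<^sub>0 int)) \<Rightarrow> ((nat \<Rightarrow>\<^sub>0 int) \<Rightarrow> complex) \<Rightarrow> lpoly \<Rightarrow> lpoly"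
  where "msub \<phi> \<chi> p = (\<Sum>e\<in>Poly_Mapping.keys p. Poly_Mapping.single (\<phi> e) (\<chi> e * Poly_Mapping.lookup p e))"

lemma msub_superset:
  assumes "finite S" "Poly_Mapping.keys p \<subseteq> S"
  shows "msub \<phi> \<chi> p = (\<Sum>e\<in>S. Poly_Mapping.single (\<phi> e) (\<chi> e * Poly_Mapping.lookup p e))"
  unfolding msub_def
  by (rule sum.mono_neutral_left) (use assms in \<open>auto simp: not_in_keys_iff_lookup_eq_zero\<close>)

lemma msub_0 [simp]: "msub \<phi> \<chi> 0 = 0"
  by (simp add: msub_def)

lemma msub_single [simp]: "msub \<phi> \<chi> (Poly_Mapping.single e c) = Poly_Mapping.single (\<phi> e) (\<chi> e * c)"
  by (subst msub_superset[of "{e}"]) auto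

lemma msub_add: "msub \<phi> \<chi> (p + q) = msub \<phi> \<chi> p + msub \<phi> \<chi> q"
proof -
  let ?S = "Poly_Mapping.keys p \<union> Poly_Mapping.keys q"
  have "Poly_Mapping.keys (p + q) \<subseteq> ?S" by (rule keys_add)
  then show ?thesis
    by (simp add: msub_superset[of ?S] lookup_add single_add ring_distribs sum.distrib)
qed

lemma msub_uminus: "msub \<phi> \<chi> (- p) = - msub \<phi> \<chi> p"
  using msub_add[of \<phi> \<chi> p "- p"] by (simp add: eq_neg_iff_add_eq_0 add.commute)

lemma msub_diff: "msub \<phi> \<chi> (p - q) = msub \<phi> \<chi> p - msub \<phi> \<chi> q"
  using msub_add[of \<phi> \<chi> p "- q"] by (simp add: msub_uminus)

lemma msub_sum: "msub \<phi> \<chi> (sum f A) = (\<Sum>i\<in>A. msub \<phi> \<chi> (f i))"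
  by (induction A rule: infinite_finite_induct) (simp_all add: msub_add)

definition mchar :: "((nat \<Rightarrow>\<^sub>0 int) \<Rightarrow> (nat \<Rightarrow>\<^sub>0 int)) \<Rightarrow> ((nat \<Rightarrow>\<^sub>0 int) \<Rightarrow> complex) \<Rightarrow> bool" where
  "mchar \<phi> \<chi> \<longleftrightarrow> \<phi> 0 = 0 \<and> \<chi> 0 = 1 \<and> (\<forall>a b. \<phi> (a + b) = \<phi> a + \<phi> b \<and> \<chi> (a + b) = \<chi> a * \<chi> b)"

lemma msub_scal [simp]: "mchar \<phi> \<chi> \<Longrightarrow> msub \<phi> \<chi> (scal c) = scal c"
  by (simp add: scal_def mchar_def)

lemma msub_1 [simp]: "mchar \<phi> \<chi> \<Longrightarrow> msub \<phi> \<chi> 1 = 1"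
  using msub_scal[of \<phi> \<chi> 1] by simp

lemma msub_mon: "msub \<phi> \<chi> (mon e) = scal (\<chi> e) * mon (\<phi> e)"
  by (simp add: mon_def scal_def mult_single)

lemma msub_mult:
  assumes "mchar \<phi> \<chi>"
  shows "msub \<phi> \<chi> (p * q) = msub \<phi> \<chi> p * msub \<phi> \<chi> q"
proof (induction p rule: lpoly_induct)
  case (single e c)
  show ?case
  proof (induction q rule: lpoly_induct)
    case (single f d)
    show ?case using assms by (simp add: mult_single mchar_def mult_ac)
  qed (simp_all add: msub_add ring_distribs)
qed (simp_all add: msub_add ring_distribs)

lemma msub_prod: "mchar \<phi> \<chi> \<Longrightarrow> msub \<phi> \<chi> (prod f A) = (\<Prod>i\<in>A. msub \<phi> \<chi> (f i))"
  by (induction A rule: infinite_finite_induct) (simp_all add: msub_mult)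

section \<open>Constant terms\<close>

definition zero_on :: "nat set \<Rightarrow> (nat \<Rightarrow>\<^sub>0 int) \<Rightarrow> bool" where
  "zero_on A e \<longleftrightarrow> (\<forall>i\<in>A. lk e i = 0)"

lemma zero_on_0 [simp]: "zero_on A 0"
  by (simp add: zero_on_def)

definition ct :: "nat set \<Rightarrow> lpoly \<Rightarrow> lpoly" where
  "ct A p = Abs_poly_mapping (\<lambda>e. if zero_on A e then Poly_Mapping.lookup p e else 0)"

lemma ct_x_eq_ct: "ct_x n = ct {1..<n}"
  by (simp add: ct_x_def ct_def zero_on_def fun_eq_iff)

lemma lookup_ct: "Poly_Mapping.lookup (ct A p) e = (if zero_on A e then Poly_Mapping.lookup p e else 0)"
proof -
  have "finite {e. (if zero_on A e then Poly_Mapping.lookup p e else 0) \<noteq> 0}"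
    by (rule finite_subset[OF _ finite_lookup[of p]]) auto
  then show ?thesis by (simp add: ct_def)
qed

lemma ct_0 [simp]: "ct A 0 = 0"
  by (rule poly_mapping_eqI) (simp add: lookup_ct)

lemma ct_add: "ct A (p + q) = ct A p + ct A q"
  by (rule poly_mapping_eqI) (simp add: lookup_ct lookup_add)

lemma ct_diff: "ct A (p - q) = ct A p - ct A q"
  by (rule poly_mapping_eqI) (simp add: lookup_ct lookup_minus)

lemma ct_sum: "ct A (sum f I) = (\<Sum>i\<in>I. ct A (f i))"
  by (induction I rule: infinite_finite_induct) (simp_all add: ct_add)

lemma ct_single: "ct A (Poly_Mapping.single e c) = (if zero_on A e then Poly_Mapping.single e c else 0)"
  by (rule poly_mapping_eqI) (auto simp: lookup_ct lookup_single when_def)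

lemma ct_single_mult:
  assumes "zero_on A e"
  shows "ct A (Poly_Mapping.single e c * p) = Poly_Mapping.single e c * ct A p"
proof (induction p rule: lpoly_induct)
  case (single f d)
  have "zero_on A (e + f) \<longleftrightarrow> zero_on A f"
    using assms by (simp add: zero_on_def lookup_add)
  then show ?case by (simp add: mult_single ct_single)
qed (simp_all add: ct_add ring_distribs)

lemma ct_scal_mult: "ct A (scal c * p) = scal c * ct A p"
  unfolding scal_def by (rule ct_single_mult) simp

lemma ct_of_nat_mult: "ct A (of_nat c * p) = of_nat c * ct A p"
  using ct_scal_mult[of A "of_nat c" p] by (simp add: scal_of_nat)

lemma ct_ct: "ct A (ct B p) = ct (A \<union> B) p"
  by (rule poly_mapping_eqI) (auto simp: lookup_ct zero_on_def)

text \<open>Only monomials whose exponents vanish on \<open>A\<close> count, so it suffices that the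
  substitution fixes these and creates no new ones. This is the invariance of constant terms, both
  under q-shifts and under the change of variables in \<open>ct_Dl\<close>.\<close>

lemma ct_msub:
  assumes "\<And>e. zero_on A (\<phi> e) \<longleftrightarrow> zero_on A e"
    and "\<And>e. zero_on A e \<Longrightarrow> \<phi> e = e \<and> \<chi> e = 1"
  shows "ct A (msub \<phi> \<chi> p) = ct A p"
  by (induction p rule: lpoly_induct) (simp_all add: msub_add ct_add ct_single assms)

section \<open>Laurent polynomials with restricted exponents\<close>

definition supp_in :: "((nat \<Rightarrow>\<^sub>0 int) \<Rightarrow> bool) \<Rightarrow> lpoly \<Rightarrow> bool" where
  "supp_in P p \<longleftrightarrow> (\<forall>e\<in>Poly_Mapping.keys p. P e)"

lemma supp_in_0 [simp]: "supp_in P 0"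
  by (simp add: supp_in_def)

lemma supp_in_add: "supp_in P p \<Longrightarrow> supp_in P q \<Longrightarrow> supp_in P (p + q)"
  using keys_add[of p q] by (auto simp: supp_in_def)

lemma supp_in_diff: "supp_in P p \<Longrightarrow> supp_in P q \<Longrightarrow> supp_in P (p - q)"
  using keys_diff[of p q] by (auto simp: supp_in_def)

lemma supp_in_mult:
  assumes "supp_in P p" "supp_in Q q" "\<And>a b. P a \<Longrightarrow> Q b \<Longrightarrow> R (a + b)"
  shows "supp_in R (p * q)"
  using keys_mult[of p q] assms by (fastforce simp: supp_in_def)

lemma supp_in_scal: "P 0 \<Longrightarrow> supp_in P (scal c)"
  by (auto simp: supp_in_def scal_def)

lemma supp_in_mon: "P e \<Longrightarrow> supp_in P (mon e)"
  by (auto simp: supp_in_def mon_def)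

lemma supp_in_1: "P 0 \<Longrightarrow> supp_in P 1"
  using supp_in_scal[of P 1] by simp

lemma supp_in_prod:
  assumes "P 0" "\<And>a b. P a \<Longrightarrow> P b \<Longrightarrow> P (a + b)" "\<And>i. i \<in> A \<Longrightarrow> supp_in P (f i)"
  shows "supp_in P (prod f A)"
  using assms(3)
  by (induction A rule: infinite_finite_induct) (auto intro: supp_in_1 supp_in_mult assms(1,2))

lemma ct_eq_self:
  assumes "supp_in (zero_on A) p"
  shows "ct A p = p"
  using assms by (intro poly_mapping_eqI) (auto simp: lookup_ct supp_in_def in_keys_iff)

lemma ct_eq_0:
  assumes "supp_in (\<lambda>e. \<not> zero_on A e) p"
  shows "ct A p = 0"
  using assms by (intro poly_mapping_eqI) (auto simp: lookup_ct supp_in_def in_keys_iff)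

lemma ct_mult_left:
  assumes "supp_in (zero_on A) u"
  shows "ct A (u * p) = u * ct A p"
proof -
  define S where "S = Poly_Mapping.keys u"
  have u: "u = (\<Sum>e\<in>S. Poly_Mapping.single e (Poly_Mapping.lookup u e))"
    unfolding S_def by (rule lpoly_sum_monomials) auto
  have "ct A ((\<Sum>e\<in>S. Poly_Mapping.single e (Poly_Mapping.lookup u e)) * p)
      = (\<Sum>e\<in>S. Poly_Mapping.single e (Poly_Mapping.lookup u e)) * ct A p"
    unfolding sum_distrib_right ct_sum
    by (rule sum.cong) (use assms in \<open>auto simp: S_def supp_in_def intro!: ct_single_mult\<close>)
  then show ?thesis using u by simp
qed

section \<open>The weight function and its q-shifts\<close>

definition xv :: "nat \<Rightarrow> lpoly" where
  "xv i = mon (Poly_Mapping.single i 1)"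

definition rt :: "nat \<Rightarrow> nat \<Rightarrow> lpoly" where
  "rt i j = mon (Poly_Mapping.single i 1 - Poly_Mapping.single j 1)"

lemma xv_rt: "xv j * rt i j = xv i"
  by (simp add: xv_def rt_def flip: mon_add)

lemma inj_xv: "inj_on xv A"
proof (rule inj_onI)
  fix i j assume "xv i = xv j"
  then have "lk (Poly_Mapping.single i 1) i = lk (Poly_Mapping.single j 1) i"
    by (simp add: xv_def)
  then show "i = j" by (auto simp: lookup_single when_def split: if_splits)
qed

lemma xv_neq_0 [simp]: "xv i \<noteq> 0"
  by (simp add: xv_def)

definition fin_qpoch :: "lpoly \<Rightarrow> complex \<Rightarrow> nat \<Rightarrow> lpoly" where
  "fin_qpoch a q m = (\<Prod>k<m. 1 - scal (q ^ k) * a)"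

text \<open>Both sides are the product of 1 - q^k a over k = 0, ..., m.\<close>

lemma fin_qpoch_shift: "(1 - a) * fin_qpoch (scal q * a) q m = fin_qpoch a q m * (1 - scal (q ^ m) * a)"
proof (induction m)
  case (Suc m)
  have "(1 - a) * fin_qpoch (scal q * a) q (Suc m) = ((1 - a) * fin_qpoch (scal q * a) q m) * (1 - scal (q ^ Suc m) * a)"
    by (simp add: fin_qpoch_def scal_mult mult_ac)
  also have "\<dots> = fin_qpoch a q (Suc m) * (1 - scal (q ^ Suc m) * a)"
    unfolding Suc by (simp add: fin_qpoch_def)
  finally show ?case .
qed (simp add: fin_qpoch_def)

lemma msub_fin_qpoch: "mchar \<phi> \<chi> \<Longrightarrow> msub \<phi> \<chi> (fin_qpoch a q m) = fin_qpoch (msub \<phi> \<chi> a) q m"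
  by (simp add: fin_qpoch_def msub_prod msub_diff msub_mult)

definition offd :: "nat set \<Rightarrow> (nat \<times> nat) set" where
  "offd A = {(i, j). i \<in> A \<and> j \<in> A \<and> i \<noteq> j}"

lemma finite_offd [simp]: "finite A \<Longrightarrow> finite (offd A)"
  by (rule finite_subset[of _ "A \<times> A"]) (auto simp: offd_def)

definition Delta :: "nat set \<Rightarrow> complex \<Rightarrow> nat \<Rightarrow> lpoly" where
  "Delta A q K = (\<Prod>(i, j)\<in>offd A. fin_qpoch (rt i j) q K)"

lemma prod_offd_remove:
  fixes f :: "nat \<Rightarrow> nat \<Rightarrow> 'a::comm_monoid_mult"
  assumes "finite A" "i \<in> A"
  shows "(\<Prod>(a, b)\<in>offd A. f a b) = (\<Prod>(a, b)\<in>offd (A-{i}). f a b) * (\<Prod>j\<in>A-{i}. f i j * f j i)"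
proof -
  let ?B = "A - {i}"
  have eq: "offd A = offd ?B \<union> ((\<lambda>j. (i, j)) ` ?B \<union> (\<lambda>j. (j, i)) ` ?B)"
    using assms by (auto simp: offd_def)
  have "(\<Prod>(a, b)\<in>offd A. f a b) = (\<Prod>(a, b)\<in>offd ?B. f a b) *
     ((\<Prod>(a, b)\<in>(\<lambda>j. (i, j)) ` ?B. f a b) * (\<Prod>(a, b)\<in>(\<lambda>j. (j, i)) ` ?B. f a b))"
  proof -
    have "finite (offd ?B)" "finite ((\<lambda>j. (i, j)) ` ?B)" "finite ((\<lambda>j. (j, i)) ` ?B)"
      using assms by auto
    moreover have "offd ?B \<inter> ((\<lambda>j. (i, j)) ` ?B \<union> (\<lambda>j. (j, i)) ` ?B) = {}"
      "(\<lambda>j. (i, j)) ` ?B \<inter> (\<lambda>j. (j, i)) ` ?B = {}"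
      by (auto simp: offd_def)
    ultimately show ?thesis
      unfolding eq by (simp only: prod.union_disjoint finite_Un simp_thms)
  qed
  then show ?thesis
    by (simp add: prod.reindex inj_on_def prod.distrib)
qed

lemma Delta_remove:
  assumes "finite A" "i \<in> A"
  shows "Delta A q K = Delta (A-{i}) q K * (\<Prod>j\<in>A-{i}. fin_qpoch (rt i j) q K * fin_qpoch (rt j i) q K)"
  unfolding Delta_def by (rule prod_offd_remove[OF assms])

text \<open>With \<open>z = q^K\<close>, \<open>Dl A i\<close> is \<open>Delta A\<close> times the product of
  \<open>(x_i - z x_j) / (x_i - x_j)\<close>, written without denominators. Replacing \<open>x_i\<close> by \<open>q x_i\<close> turns it
  into \<open>Dr A i\<close>, which is \<open>Delta A\<close> times the product of \<open>(z x_i - x_j) / (x_i - x_j)\<close>.\<close>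

definition Dl :: "nat set \<Rightarrow> nat \<Rightarrow> complex \<Rightarrow> nat \<Rightarrow> lpoly" where
  "Dl A i q K = Delta (A-{i}) q K * (\<Prod>j\<in>A-{i}. fin_qpoch (rt i j) q K * fin_qpoch (scal q * rt j i) q K)"

definition Dr :: "nat set \<Rightarrow> nat \<Rightarrow> complex \<Rightarrow> nat \<Rightarrow> lpoly" where
  "Dr A i q K = Delta (A-{i}) q K * (\<Prod>j\<in>A-{i}. fin_qpoch (scal q * rt i j) q K * fin_qpoch (rt j i) q K)"

text \<open>\<open>fin_qpoch_shift\<close> with a = x_j/x_i, multiplied by x_i. The result is the
  premise of the interpolation lemmas with (\<alpha>, \<beta>) = (1, z); \<open>Dr_Delta\<close>
  provides it with (z, 1).\<close>

lemma Dl_Delta: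
  assumes "finite A" "i \<in> A"
  shows "Dl A i q K * (\<Prod>j\<in>A-{i}. xv i - xv j) = Delta A q K * (\<Prod>j\<in>A-{i}. 1 * xv i - scal (q ^ K) * xv j)"
proof -
  have "fin_qpoch (scal q * rt j i) q K * (xv i - xv j) = fin_qpoch (rt j i) q K * (xv i - scal (q ^ K) * xv j)" for j
  proof -
    have "xv i - xv j = xv i * (1 - rt j i)" "xv i - scal (q ^ K) * xv j = xv i * (1 - scal (q ^ K) * rt j i)"
      using xv_rt[of i j] by (simp_all add: algebra_simps)
    then show ?thesis using fin_qpoch_shift[of "rt j i" q K] by (simp add: mult_ac)
  qed
  then have "(\<Prod>j\<in>A-{i}. fin_qpoch (rt i j) q K * (fin_qpoch (scal q * rt j i) q K * (xv i - xv j)))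
    = (\<Prod>j\<in>A-{i}. fin_qpoch (rt i j) q K * (fin_qpoch (rt j i) q K * (xv i - scal (q ^ K) * xv j)))"
    by simp
  then show ?thesis
    by (simp add: Dl_def Delta_remove[OF assms] prod.distrib mult_ac)
qed

lemma Dr_Delta:
  assumes "finite A" "i \<in> A"
  shows "Dr A i q K * (\<Prod>j\<in>A-{i}. xv i - xv j) = Delta A q K * (\<Prod>j\<in>A-{i}. scal (q ^ K) * xv i - 1 * xv j)"
proof -
  have "fin_qpoch (scal q * rt i j) q K * (xv i - xv j) = fin_qpoch (rt i j) q K * (scal (q ^ K) * xv i - xv j)" for j
  proof -
    have "xv i - xv j = - xv j * (1 - rt i j)" "scal (q ^ K) * xv i - xv j = - xv j * (1 - scal (q ^ K) * rt i j)"
      using xv_rt[of j i] by (simp_all add: algebra_simps)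
    then show ?thesis using fin_qpoch_shift[of "rt i j" q K] by (simp add: mult_ac)
  qed
  then have "(\<Prod>j\<in>A-{i}. fin_qpoch (rt j i) q K * (fin_qpoch (scal q * rt i j) q K * (xv i - xv j)))
    = (\<Prod>j\<in>A-{i}. fin_qpoch (rt j i) q K * (fin_qpoch (rt i j) q K * (scal (q ^ K) * xv i - xv j)))"
    by simp
  then show ?thesis
    by (simp add: Dr_def Delta_remove[OF assms] prod.distrib mult_ac)
qed

section \<open>The q-shift of a single variable\<close>

definition shft :: "nat \<Rightarrow> complex \<Rightarrow> lpoly \<Rightarrow> lpoly" where
  "shft i q = msub (\<lambda>e. e) (\<lambda>e. q powi lk e i)"

lemma mchar_shft: "q \<noteq> 0 \<Longrightarrow> mchar (\<lambda>e. e) (\<lambda>e. q powi lk e i)"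
  by (simp add: mchar_def lookup_add power_int_add)

lemma ct_shft: "i \<in> A \<Longrightarrow> ct A (shft i q p) = ct A p"
  unfolding shft_def by (rule ct_msub) (auto simp: zero_on_def)

lemma msub_eq_self:
  assumes "supp_in (\<lambda>e. \<phi> e = e \<and> \<chi> e = 1) p"
  shows "msub \<phi> \<chi> p = p"
proof -
  have "msub \<phi> \<chi> p = (\<Sum>e\<in>Poly_Mapping.keys p. Poly_Mapping.single e (Poly_Mapping.lookup p e))"
    unfolding msub_def by (rule sum.cong) (use assms in \<open>auto simp: supp_in_def\<close>)
  also have "\<dots> = p"
    by (rule lpoly_sum_monomials[symmetric]) auto
  finally show ?thesis .
qed

lemma shft_eq_self: "supp_in (\<lambda>e. lk e i = 0) p \<Longrightarrow> shft i q p = p"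
  unfolding shft_def by (rule msub_eq_self) (auto simp: supp_in_def)

lemma shft_rt:
  assumes "q \<noteq> 0"
  shows "i \<noteq> j \<Longrightarrow> shft i q (rt i j) = scal q * rt i j"
    and "i \<noteq> j \<Longrightarrow> shft i q (rt j i) = scal (1 / q) * rt j i"
    and "a \<noteq> i \<Longrightarrow> b \<noteq> i \<Longrightarrow> shft i q (rt a b) = rt a b"
  by (auto simp: shft_def rt_def msub_mon lookup_minus lookup_single when_def power_int_minus field_simps)

lemma shft_xv: "shft i q (xv j) = (if j = i then scal q * xv j else xv j)"
  by (auto simp: shft_def xv_def msub_mon lookup_single when_def)

text \<open>The shift multiplies x_i/x_j by q and x_j/x_i by 1/q, so the extra q passes from one
  Pochhammer symbol to the other and no denominator arises.\<close>

lemma shft_Dl: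
  assumes q: "q \<noteq> 0"
  shows "shft i q (Dl A i q K) = Dr A i q K"
proof -
  note c = mchar_shft[OF q, of i]
  have 1: "shft i q (fin_qpoch (rt a b) q K) = fin_qpoch (rt a b) q K" if "a \<noteq> i" "b \<noteq> i" for a b
    using shft_rt(3)[OF q that] by (simp add: shft_def msub_fin_qpoch[OF c])
  have 2: "shft i q (fin_qpoch (rt i j) q K) = fin_qpoch (scal q * rt i j) q K" if "i \<noteq> j" for j
    using shft_rt(1)[OF q that] by (simp add: shft_def msub_fin_qpoch[OF c])
  have 3: "shft i q (fin_qpoch (scal q * rt j i) q K) = fin_qpoch (rt j i) q K" if "i \<noteq> j" for j
  proof -
    have "shft i q (scal q * rt j i) = scal q * (scal (1 / q) * rt j i)"
      unfolding shft_rt(2)[OF q that, symmetric] by (simp add: shft_def msub_mult[OF c] c)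
    also have "\<dots> = rt j i"
      using q by (simp flip: scal_mult mult.assoc)
    finally show ?thesis by (simp add: shft_def msub_fin_qpoch[OF c])
  qed
  have "shft i q (Dl A i q K) = (\<Prod>x\<in>offd (A-{i}). shft i q (case x of (a, b) \<Rightarrow> fin_qpoch (rt a b) q K)) *
     (\<Prod>j\<in>A-{i}. shft i q (fin_qpoch (rt i j) q K) * shft i q (fin_qpoch (scal q * rt j i) q K))"
    by (simp add: Dl_def Delta_def shft_def msub_mult[OF c] msub_prod[OF c])
  also have "(\<Prod>x\<in>offd (A-{i}). shft i q (case x of (a, b) \<Rightarrow> fin_qpoch (rt a b) q K)) = Delta (A-{i}) q K"
    unfolding Delta_def by (rule prod.cong) (auto simp: offd_def 1)
  also have "(\<Prod>j\<in>A-{i}. shft i q (fin_qpoch (rt i j) q K) * shft i q (fin_qpoch (scal q * rt j i) q K))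
     = (\<Prod>j\<in>A-{i}. fin_qpoch (scal q * rt i j) q K * fin_qpoch (rt j i) q K)"
    by (rule prod.cong) (use 2 3 in auto)
  finally show ?thesis by (simp add: Dr_def)
qed

definition wt :: "nat set \<Rightarrow> lpoly \<Rightarrow> complex \<Rightarrow> nat \<Rightarrow> lpoly" where
  "wt A u q L = (\<Prod>j\<in>A. fin_qpoch (u * xv j) q L)"

definition en :: "nat set \<Rightarrow> int \<Rightarrow> lpoly" where
  "en A k = mon (\<Sum>j\<in>A. Poly_Mapping.single j k)"

lemma lk_sum_single: "finite A \<Longrightarrow> lk (\<Sum>j\<in>A. Poly_Mapping.single j k) i = (if i \<in> A then k else 0)"
  by (simp add: lookup_sum lookup_single when_def)

lemma en_add: "en A (k + l) = en A k * en A l"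
  by (simp add: en_def single_add sum.distrib mon_add)

lemma en_0 [simp]: "en A 0 = 1"
  by (simp add: en_def)

lemma en_1: "en A 1 = (\<Prod>j\<in>A. xv j)"
  by (simp add: en_def mon_sum xv_def)

lemma shft_en: "finite A \<Longrightarrow> i \<in> A \<Longrightarrow> shft i q (en A k) = scal (q powi k) * en A k"
  by (simp add: shft_def en_def msub_mon lk_sum_single)

text \<open>The shift turns (u x_i; q)_L into (q u x_i; q)_L, which lacks the factor 1 - u x_i. The
  shifted factor 1 - u x_i/q supplies it, and in exchange 1 - q^L u x_i remains.\<close>

lemma shft_factor:
  assumes q: "q \<noteq> 0" and A: "finite A" "i \<in> A" and u: "supp_in (zero_on A) u"
  shows "shft i q ((1 - scal (1 / q) * u * xv i) * wt A u q L) = (1 - scal (q ^ L) * u * xv i) * wt A u q L"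
proof -
  note c = mchar_shft[OF q, of i]
  have su: "shft i q u = u"
    by (rule shft_eq_self) (use u A in \<open>auto simp: supp_in_def zero_on_def\<close>)
  have 1: "shft i q (fin_qpoch (u * xv j) q L) = fin_qpoch (u * xv j) q L" if "j \<noteq> i" for j
    using shft_xv[of i q j] su that by (simp add: shft_def msub_fin_qpoch[OF c] msub_mult[OF c])
  have 2: "shft i q (fin_qpoch (u * xv i) q L) = fin_qpoch (scal q * (u * xv i)) q L"
    using shft_xv[of i q i] su by (simp add: shft_def msub_fin_qpoch[OF c] msub_mult[OF c] mult_ac)
  have "shft i q (wt A u q L) = (\<Prod>j\<in>A. shft i q (fin_qpoch (u * xv j) q L))"
    by (simp add: wt_def shft_def msub_prod[OF c])
  also have "\<dots> = fin_qpoch (scal q * (u * xv i)) q L * (\<Prod>j\<in>A-{i}. fin_qpoch (u * xv j) q L)"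
    using A by (simp add: prod.remove[of A i] 1 2)
  finally have w: "shft i q (wt A u q L) = \<dots>" .
  have "shft i q (scal (1 / q) * u * xv i) = scal (1 / q) * u * (scal q * xv i)"
    using shft_xv[of i q i] su by (simp add: shft_def msub_mult[OF c] c)
  also have "\<dots> = (scal (1 / q) * scal q) * (u * xv i)" by (simp add: mult_ac)
  also have "scal (1 / q) * scal q = 1" using q by (simp flip: scal_mult)
  finally have "shft i q (1 - scal (1 / q) * u * xv i) = 1 - u * xv i"
    by (simp add: shft_def msub_diff c)
  then have "shft i q ((1 - scal (1 / q) * u * xv i) * wt A u q L)
    = ((1 - u * xv i) * fin_qpoch (scal q * (u * xv i)) q L) * (\<Prod>j\<in>A-{i}. fin_qpoch (u * xv j) q L)"
    using w by (simp add: shft_def msub_mult[OF c] mult_ac)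
  also have "\<dots> = (1 - scal (q ^ L) * u * xv i) * wt A u q L"
    unfolding fin_qpoch_shift using A by (simp add: wt_def prod.remove[of A i] mult_ac)
  finally show ?thesis .
qed

lemma supp_in_coeff_vpoly:
  assumes "finite B" "i \<notin> B"
  shows "supp_in (\<lambda>e. lk e i = 0) (coeff (vpoly xv B) p)"
  using assms
proof (induction B arbitrary: p rule: finite_induct)
  case empty
  then show ?case by (simp add: vpoly_def coeff_1 supp_in_1)
next
  case (insert a B)
  have "vpoly xv (insert a B) = smult (xv a) (vpoly xv B) + pCons 0 (vpoly xv B)"
    using insert by (simp add: vpoly_def)
  moreover have "supp_in (\<lambda>e. lk e i = 0) (xv a * coeff (vpoly xv B) p)"
  proof (rule supp_in_mult)
    show "supp_in (\<lambda>e. lk e i = 0) (xv a)"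
      unfolding xv_def by (rule supp_in_mon) (use insert in \<open>auto simp: lookup_single when_def\<close>)
    show "supp_in (\<lambda>e. lk e i = 0) (coeff (vpoly xv B) p)" using insert by auto
  qed (simp add: lookup_add)
  ultimately show ?case using insert
    by (auto simp: coeff_pCons intro!: supp_in_add split: nat.splits)
qed

text \<open>Aomoto's relation for one i: invariance under the shift, with q^(-k) contributed by (x_1
  \<cdots> x_n)^(-k).\<close>

lemma ct_shft_identity:
  assumes q: "q \<noteq> 0" and A: "finite A" "i \<in> A" and u: "supp_in (zero_on A) u"
    and f: "shft i q f = f"
  shows "ct A (Dl A i q K * (1 - scal (1 / q) * u * xv i) * f * (wt A u q L * en A (- k)))
    = scal (q powi (- k)) * ct A (Dr A i q K * (1 - scal (q ^ L) * u * xv i) * f * (wt A u q L * en A (- k)))"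
proof -
  note c = mchar_shft[OF q, of i]
  have m: "shft i q (a * b) = shft i q a * shft i q b" for a b
    by (simp add: shft_def msub_mult[OF c])
  have "ct A (Dl A i q K * (1 - scal (1 / q) * u * xv i) * f * (wt A u q L * en A (- k)))
    = ct A (Dl A i q K * ((1 - scal (1 / q) * u * xv i) * wt A u q L) * f * en A (- k))"
    by (simp add: mult_ac)
  also have "\<dots> = ct A (shft i q (Dl A i q K * ((1 - scal (1 / q) * u * xv i) * wt A u q L) * f * en A (- k)))"
    by (rule ct_shft[symmetric]) fact
  also have "\<dots> = ct A (Dr A i q K * ((1 - scal (q ^ L) * u * xv i) * wt A u q L) * f * (scal (q powi (- k)) * en A (- k)))"
    by (simp only: m[of _ "en A (- k)"] m[of _ f] m[of "Dl A i q K"] shft_Dl[OF q]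
        shft_factor[OF q A u] f shft_en[OF A])
  also have "\<dots> = ct A (scal (q powi (- k)) * (Dr A i q K * (1 - scal (q ^ L) * u * xv i) * f * (wt A u q L * en A (- k))))"
    by (simp only: mult_ac)
  finally show ?thesis by (simp only: ct_scal_mult)
qed

section \<open>The recursion for elementary symmetric functions\<close>

definition bracket :: "nat set \<Rightarrow> complex \<Rightarrow> nat \<Rightarrow> nat \<Rightarrow> lpoly \<Rightarrow> int \<Rightarrow> lpoly \<Rightarrow> lpoly" where
  "bracket A q K L u k f = ct A (Delta A q K * f * (wt A u q L * en A (- k)))"

text \<open>The relations for single i are summed with f = e_(n-1-p) of the remaining variables. The
  index p counts the degree down: it belongs to e_(n-p), so that p = 0 is the product of all x_i and
  p = n is 1. \<open>S1\<close> and \<open>S2\<close> are evaluated by interpolation with (\<alpha>,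
  \<beta>) = (1, z), \<open>S3\<close> and \<open>S4\<close> with (z, 1).\<close>

lemma bracket_recursion_aux:
  fixes K :: nat
  assumes q: "q \<noteq> 0" and A: "finite A" and u: "supp_in (zero_on A) u" and p: "p < card A"
  defines "z \<equiv> q ^ K" and "n \<equiv> card A"
  shows "scal (z ^ (n - Suc p) - z ^ n) * bracket A q K L u k (coeff (vpoly xv A) (Suc p))
       - scal (1 / q * (1 - z ^ (n - p))) * (u * bracket A q K L u k (coeff (vpoly xv A) p))
       = scal (q powi (- k)) *
        (scal (1 - z ^ Suc p) * bracket A q K L u k (coeff (vpoly xv A) (Suc p))
       - scal (q ^ L * (z ^ p - z ^ n)) * (u * bracket A q K L u k (coeff (vpoly xv A) p)))"
    (is "?lhs = ?rhs")
proof -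
  define W where "W = wt A u q L * en A (- k)"
  define a where "a = (\<lambda>i. coeff (vpoly xv (A-{i})) p)"
  define a0 where "a0 = coeff (vpoly xv A) p"
  define a1 where "a1 = coeff (vpoly xv A) (Suc p)"
  define D where "D = Delta A q K"
  define Z where "Z = scal z"
  define S1 where "S1 = (\<Sum>i\<in>A. Dl A i q K * a i)"
  define S2 where "S2 = (\<Sum>i\<in>A. xv i * Dl A i q K * a i)"
  define S3 where "S3 = (\<Sum>i\<in>A. Dr A i q K * a i)"
  define S4 where "S4 = (\<Sum>i\<in>A. xv i * Dr A i q K * a i)"
  define r where "r = 1 / q"
  have f: "shft i q (a i) = a i" for i
    unfolding a_def by (intro shft_eq_self supp_in_coeff_vpoly) (use A in auto)
  have ctu: "ct A (u * g) = u * ct A g" for g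
    by (rule ct_mult_left[OF u])
  have "ct A ((S1 - scal r * u * S2) * W) =
     (\<Sum>i\<in>A. ct A (Dl A i q K * (1 - scal r * u * xv i) * a i * W))"
    unfolding S1_def S2_def ct_sum[symmetric] sum_distrib_left sum_distrib_right sum_subtractf[symmetric]
    by (intro arg_cong[where f = "ct A"] sum.cong) (simp_all add: algebra_simps)
  also have "\<dots> = (\<Sum>i\<in>A. scal (q powi (- k)) * ct A (Dr A i q K * (1 - scal (q ^ L) * u * xv i) * a i * W))"
    unfolding W_def r_def by (intro sum.cong refl ct_shft_identity q A u f)
  also have "\<dots> = scal (q powi (- k)) * ct A ((S3 - scal (q ^ L) * u * S4) * W)"
    unfolding S3_def S4_def ct_sum[symmetric] sum_distrib_left[symmetric] 
    unfolding sum_distrib_left sum_distrib_right sum_subtractf[symmetric]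
    by (intro arg_cong[where f = "ct A"] arg_cong2[where f = "(*)"] sum.cong refl) (simp_all add: algebra_simps)
  finally have E: "ct A ((S1 - scal r * u * S2) * W) = \<dots>" .
  have x0: "xv i \<noteq> 0" for i by simp
  have dl: "Dl A i q K * (\<Prod>j\<in>A-{i}. xv i - xv j) = D * (\<Prod>j\<in>A-{i}. 1 * xv i - Z * xv j)"
    and dr: "Dr A i q K * (\<Prod>j\<in>A-{i}. xv i - xv j) = D * (\<Prod>j\<in>A-{i}. Z * xv i - 1 * xv j)"
    if "i \<in> A" for i
    using Dl_Delta[OF A that, of q K] Dr_Delta[OF A that, of q K] by (simp_all only: Z_def z_def D_def)
  have 1: "(1 - Z) * S1 = D * (Z ^ (n - Suc p) - Z ^ n) * a1"
    using sum_residues_coeff[OF A inj_xv, where \<alpha> = 1 and \<beta> = Z, OF dl x0 p]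
    by (simp add: S1_def a_def a1_def n_def)
  have 2: "(1 - Z) * S2 = D * (1 - Z ^ (n - p)) * a0"
    using sum_x_residues_coeff[OF A inj_xv, where \<alpha> = 1 and \<beta> = Z, OF dl less_imp_le[OF p]]
    by (simp add: S2_def a_def a0_def n_def)
  have "(Z - 1) * S3 = D * (Z ^ Suc p - 1) * a1"
    using sum_residues_coeff[OF A inj_xv, where \<alpha> = Z and \<beta> = 1, OF dr x0 p]
    by (simp add: S3_def a_def a1_def n_def)
  then have 3: "(1 - Z) * S3 = D * (1 - Z ^ Suc p) * a1"
    by (simp add: algebra_simps)
  have "(Z - 1) * S4 = D * (Z ^ n - Z ^ p) * a0"
    using sum_x_residues_coeff[OF A inj_xv, where \<alpha> = Z and \<beta> = 1, OF dr less_imp_le[OF p]]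
    by (simp add: S4_def a_def a0_def n_def)
  then have 4: "(1 - Z) * S4 = D * (Z ^ p - Z ^ n) * a0"
    by (simp add: algebra_simps)
  \<comment> \<open>Interpolation determines only the multiples of the four sums by 1 - z, so the
    summed relation is multiplied by 1 - z.\<close>
  have "(1 - Z) * ct A ((S1 - scal r * u * S2) * W)
      = ct A (scal (1 - z) * ((S1 - scal r * u * S2) * W))"
    by (simp only: ct_scal_mult) (simp add: Z_def scal_diff)
  also have "scal (1 - z) * ((S1 - scal r * u * S2) * W)
     = (((1 - Z) * S1) - scal r * u * ((1 - Z) * S2)) * W"
    by (simp add: Z_def scal_diff algebra_simps)
  also have "\<dots> = scal (z ^ (n - Suc p) - z ^ n) * (D * a1 * W) -
      scal (r * (1 - z ^ (n - p))) * (u * (D * a0 * W))"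
    unfolding 1 2 by (simp add: Z_def scal_diff scal_mult scal_power algebra_simps)
  finally have L: "(1 - Z) * ct A ((S1 - scal r * u * S2) * W) = ?lhs"
    by (simp only: r_def ct_diff ct_scal_mult ctu bracket_def W_def D_def a0_def a1_def)
  have "(1 - Z) * ct A ((S3 - scal (q ^ L) * u * S4) * W)
      = ct A (scal (1 - z) * ((S3 - scal (q ^ L) * u * S4) * W))"
    by (simp only: ct_scal_mult) (simp add: Z_def scal_diff)
  also have "scal (1 - z) * ((S3 - scal (q ^ L) * u * S4) * W)
     = (((1 - Z) * S3) - scal (q ^ L) * u * ((1 - Z) * S4)) * W"
    by (simp add: Z_def scal_diff algebra_simps)
  also have "\<dots> = scal (1 - z ^ Suc p) * (D * a1 * W) -
      scal (q ^ L * (z ^ p - z ^ n)) * (u * (D * a0 * W))"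
    unfolding 3 4 by (simp add: Z_def scal_diff scal_mult scal_power algebra_simps)
  finally have R: "scal (q powi (- k)) * ((1 - Z) * ct A ((S3 - scal (q ^ L) * u * S4) * W)) = ?rhs"
    by (simp only: ct_diff ct_scal_mult ctu bracket_def W_def D_def a0_def a1_def)
  have "?lhs = (1 - Z) * ct A ((S1 - scal r * u * S2) * W)"
    by (rule L[symmetric])
  also have "\<dots> = scal (q powi (- k)) * ((1 - Z) * ct A ((S3 - scal (q ^ L) * u * S4) * W))"
    unfolding E by (simp only: mult_ac)
  also note R
  finally show ?thesis .
qed

text \<open>After multiplication by q^k both coefficients factor, because z^(n-p-1) z^(p+1) =
  z^(n-p) z^p = z^n.\<close>

lemma bracket_recursion:
  fixes K :: nat
  assumes q: "q \<noteq> 0" and A: "finite A" and u: "supp_in (zero_on A) u" and p: "p < card A"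
  defines "z \<equiv> q ^ K" and "n \<equiv> card A"
  shows "scal ((1 - z ^ Suc p) * (1 - q powi k * z ^ (n - Suc p))) * bracket A q K L u k (coeff (vpoly xv A) (Suc p))
       = scal ((1 - z ^ (n - p)) * (q ^ L * z ^ p - q powi (k - 1))) * (u * bracket A q K L u k (coeff (vpoly xv A) p))"
proof -
  define b0 where "b0 = u * bracket A q K L u k (coeff (vpoly xv A) p)"
  define b1 where "b1 = bracket A q K L u k (coeff (vpoly xv A) (Suc p))"
  define g where "g = scal (q ^ L)"
  define r where "r = scal (1 / q)"
  define Q where "Q = scal (q powi k)"
  define Q' where "Q' = scal (q powi (- k))"
  have QQ: "Q * Q' = 1" using q by (simp add: Q_def Q'_def power_int_minus flip: scal_mult)
  have Qr: "scal (q powi (k - 1)) = Q * r" using q by (simp add: Q_def r_def power_int_diff flip: scal_mult)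
  define c where "c = scal (z ^ (n - Suc p))"
  define d where "d = scal (z ^ (n - p))"
  define e where "e = scal (z ^ n)"
  define h where "h = scal (z ^ p)"
  define h' where "h' = scal (z ^ Suc p)"
  have n1: "c * h' = e" and n2: "d * h = e"
    using p by (simp_all add: n_def c_def d_def h_def h'_def e_def flip: power_add scal_mult del: power_Suc)
  have "(c - e) * b1 - (r * (1 - d)) * b0 = Q' * ((1 - h') * b1 - (g * (h - e)) * b0)"
    using bracket_recursion_aux[OF q A u p, of K L k]
    by (simp only: scal_mult scal_diff scal_1 b0_def b1_def Q'_def z_def n_def
        c_def d_def e_def h_def h'_def g_def r_def)
  then have "Q * ((c - e) * b1 - (r * (1 - d)) * b0) = (Q * Q') * ((1 - h') * b1 - (g * (h - e)) * b0)"
    by (simp only: mult.assoc)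
  then have "Q * ((c - e) * b1 - (r * (1 - d)) * b0) = (1 - h') * b1 - (g * (h - e)) * b0"
    unfolding QQ by simp
  then have "((1 - h') * (1 - Q * c)) * b1 = ((1 - d) * (g * h - Q * r)) * b0"
    unfolding n1[symmetric] using n1 n2 by algebra
  then show ?thesis
    by (simp only: scal_mult scal_diff scal_1 b0_def b1_def Q_def Qr c_def d_def h_def h'_def g_def)
qed

section \<open>Solving the recursion when q is no root of unity\<close>

definition nonroot :: "complex \<Rightarrow> bool" where
  "nonroot q \<longleftrightarrow> q \<noteq> 0 \<and> (\<forall>m\<ge>1. q ^ m \<noteq> 1)"

lemma nonroot_neq_0: "nonroot q \<Longrightarrow> q \<noteq> 0"
  by (simp add: nonroot_def)

lemma nonroot_pow: "nonroot q \<Longrightarrow> m \<ge> 1 \<Longrightarrow> q ^ m \<noteq> 1"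
  by (simp add: nonroot_def)

lemma nonroot_pow_pow: "nonroot q \<Longrightarrow> K \<ge> 1 \<Longrightarrow> m \<ge> 1 \<Longrightarrow> (q ^ K) ^ m \<noteq> 1"
  by (simp add: nonroot_pow flip: power_mult)

lemma bracket_top: "finite A \<Longrightarrow> bracket A q K L u k (coeff (vpoly xv A) (card A)) = bracket A q K L u k 1"
  by (simp add: coeff_vpoly_card)

lemma bracket_bot: "bracket A q K L u k (coeff (vpoly xv A) 0) = bracket A q K L u (k - 1) 1"
proof -
  have "en A (- (k - 1)) = en A 1 * en A (- k)"
    using en_add[of A 1 "- k"] by (simp add: algebra_simps)
  then show ?thesis by (simp add: bracket_def coeff_vpoly_0 en_1 mult_ac)
qed

text \<open>The recursion is chained from e_n down to e_0. The factors 1 - z^(p+1) on the left and 1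
  - z^(n-p) on the right run through the same values; their common product \<open>X\<close> is
  cancelled.\<close>

lemma bracket_step:
  assumes q: "nonroot q" and K: "K \<ge> 1" and A: "finite A" and u: "supp_in (zero_on A) u"
  defines "z \<equiv> q ^ K" and "n \<equiv> card A"
  shows "scal (\<Prod>p<n. 1 - q powi k * z ^ p) * bracket A q K L u k 1
    = scal (\<Prod>p<n. q ^ L * z ^ p - q powi (k - 1)) * (u ^ n * bracket A q K L u (k - 1) 1)"
proof -
  define b where "b = (\<lambda>p. bracket A q K L u k (coeff (vpoly xv A) p))"
  define c where "c = (\<lambda>p. (1 - z ^ Suc p) * (1 - q powi k * z ^ (n - Suc p)))"
  define d where "d = (\<lambda>p. (1 - z ^ (n - p)) * (q ^ L * z ^ p - q powi (k - 1)))"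
  have "scal (\<Prod>p<m. c p) * b m = scal (\<Prod>p<m. d p) * (u ^ m * b 0)" if "m \<le> n" for m
    using that
  proof (induction m)
    case (Suc m)
    have s: "scal (c m) * b (Suc m) = scal (d m) * (u * b m)"
      using bracket_recursion[OF nonroot_neq_0[OF q] A u, of m K k L] Suc.prems
      by (simp add: b_def c_def d_def z_def n_def)
    have "scal (\<Prod>p<Suc m. c p) * b (Suc m) = scal (\<Prod>p<m. c p) * (scal (c m) * b (Suc m))"
      by (simp add: scal_mult mult_ac)
    also have "\<dots> = scal (d m) * u * (scal (\<Prod>p<m. c p) * b m)"
      unfolding s by (simp add: mult_ac)
    also have "\<dots> = scal (\<Prod>p<Suc m. d p) * (u ^ Suc m * b 0)"
      using Suc by (simp add: scal_mult mult_ac)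
    finally show ?case .
  qed simp
  from this[of n] have E: "scal (\<Prod>p<n. c p) * b n = scal (\<Prod>p<n. d p) * (u ^ n * b 0)" by simp
  define X where "X = (\<Prod>p<n. 1 - z ^ Suc p)"
  have X: "X \<noteq> 0"
    using nonroot_pow_pow[OF q K] unfolding X_def z_def by (subst prod_zero_iff) (auto simp del: power_Suc)
  have cX: "(\<Prod>p<n. c p) = X * (\<Prod>p<n. 1 - q powi k * z ^ p)"
    unfolding c_def prod.distrib X_def
    by (subst prod.nat_diff_reindex[of "\<lambda>p. 1 - q powi k * z ^ p" n, symmetric]) simp
  have "(\<Prod>p<n. 1 - z ^ (n - p)) = X"
    unfolding X_def
    by (subst prod.nat_diff_reindex[of "\<lambda>p. 1 - z ^ Suc p" n, symmetric], rule prod.cong)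
      (auto simp: Suc_diff_Suc simp flip: power_Suc)
  then have dX: "(\<Prod>p<n. d p) = X * (\<Prod>p<n. q ^ L * z ^ p - q powi (k - 1))"
    unfolding d_def prod.distrib by simp
  have "scal X * (scal (\<Prod>p<n. 1 - q powi k * z ^ p) * b n)
      = scal X * (scal (\<Prod>p<n. q ^ L * z ^ p - q powi (k - 1)) * (u ^ n * b 0))"
    using E unfolding cX dX by (simp add: scal_mult mult_ac)
  then show ?thesis using X bracket_top[OF A] bracket_bot
    by (simp add: b_def n_def)
qed

lemma bracket_iter:
  assumes q: "nonroot q" and K: "K \<ge> 1" and A: "finite A" and u: "supp_in (zero_on A) u"
  defines "z \<equiv> q ^ K" and "n \<equiv> card A"
  shows "scal (\<Prod>t<k. \<Prod>p<n. 1 - q ^ Suc t * z ^ p) * bracket A q K L u (int k) 1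
    = scal (\<Prod>t<k. \<Prod>p<n. q ^ L * z ^ p - q ^ t) * (u ^ (n * k) * bracket A q K L u 0 1)"
proof (induction k)
  case (Suc k)
  have i: "int (Suc k) - 1 = int k" by simp
  have pw: "q powi (int (Suc k)) = q ^ Suc k" "q powi int k = q ^ k"
    by (rule power_int_of_nat)+
  have s: "scal (\<Prod>p<n. 1 - q ^ Suc k * z ^ p) * bracket A q K L u (int (Suc k)) 1
    = scal (\<Prod>p<n. q ^ L * z ^ p - q ^ k) * (u ^ n * bracket A q K L u (int k) 1)"
    using bracket_step[OF q K A u, of "int (Suc k)" L, unfolded i, unfolded pw]
    by (simp add: z_def n_def)
  have "scal (\<Prod>t<Suc k. \<Prod>p<n. 1 - q ^ Suc t * z ^ p) * bracket A q K L u (int (Suc k)) 1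
     = scal (\<Prod>t<k. \<Prod>p<n. 1 - q ^ Suc t * z ^ p) * (scal (\<Prod>p<n. 1 - q ^ Suc k * z ^ p) * bracket A q K L u (int (Suc k)) 1)"
    by (simp add: scal_mult mult_ac)
  also have "\<dots> = scal (\<Prod>p<n. q ^ L * z ^ p - q ^ k) * u ^ n *
      (scal (\<Prod>t<k. \<Prod>p<n. 1 - q ^ Suc t * z ^ p) * bracket A q K L u (int k) 1)"
    unfolding s by (simp add: mult_ac)
  also have "\<dots> = scal (\<Prod>t<Suc k. \<Prod>p<n. q ^ L * z ^ p - q ^ t) * (u ^ (n * Suc k) * bracket A q K L u 0 1)"
    unfolding Suc by (simp add: scal_mult power_add mult_ac)
  finally show ?case .
qed simp

text \<open>For \<open>L = K\<close> one factor of the recursion vanishes at \<open>k = 0\<close> and one at \<open>k = K + 1\<close>,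
  so that \<open>bracket \<dots> k 1\<close> is supported on \<open>0 \<le> k \<le> K\<close>.\<close>

lemma bracket_neg:
  assumes q: "nonroot q" and K: "K \<ge> 1" and A: "finite A" "A \<noteq> {}"
    and u: "supp_in (zero_on A) u" and u0: "u \<noteq> 0"
  shows "p < card A \<Longrightarrow> bracket A q K K u (- int j) (coeff (vpoly xv A) p) = 0"
proof (induction j arbitrary: p)
  have step: "bracket A q K K u (- int j) (coeff (vpoly xv A) p) = 0"
    if "p < card A" and 0: "scal (1 - q powi (- int j) * (q ^ K) ^ (card A - Suc p)) * 
       bracket A q K K u (- int j) (coeff (vpoly xv A) (Suc p)) = 0" for j p
  proof -
    have "q powi (- int j - 1) \<noteq> q ^ K * (q ^ K) ^ p"
    proof
      assume "q powi (- int j - 1) = q ^ K * (q ^ K) ^ p"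
      then have "q powi (- int j - 1) * q powi (int j + 1) = q ^ (K * Suc p) * q ^ Suc j"
        using power_int_of_nat[of q "Suc j"] by (simp add: power_mult power_add add.commute)
      then have "q ^ (K * Suc p + Suc j) = 1"
        using nonroot_neq_0[OF q] by (simp flip: power_int_add add: power_add mult_ac)
      then show False using nonroot_pow[OF q, of "K * Suc p + Suc j"] by simp
    qed
    moreover have "1 - (q ^ K) ^ (card A - p) \<noteq> 0"
      using nonroot_pow_pow[OF q K, of "card A - p"] that by simp
    ultimately have "scal ((1 - (q ^ K) ^ (card A - p)) * (q ^ K * (q ^ K) ^ p - q powi (- int j - 1))) \<noteq> 0"
      by simp
    moreover have "scal ((1 - (q ^ K) ^ (card A - p)) * (q ^ K * (q ^ K) ^ p - q powi (- int j - 1))) *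
       (u * bracket A q K K u (- int j) (coeff (vpoly xv A) p)) = scal (1 - (q ^ K) ^ Suc p) *
       (scal (1 - q powi (- int j) * (q ^ K) ^ (card A - Suc p)) *
       bracket A q K K u (- int j) (coeff (vpoly xv A) (Suc p)))"
      using bracket_recursion[OF nonroot_neq_0[OF q] A(1) u that(1), of K "- int j" K]
      by (simp only: scal_mult mult_ac)
    ultimately show ?thesis using u0 unfolding 0 by simp
  qed
  have down: "bracket A q K K u (- int j) (coeff (vpoly xv A) p) = 0"
    if p: "p < card A" and top: "scal (1 - q powi (- int j)) * 
       bracket A q K K u (- int j) (coeff (vpoly xv A) (card A)) = 0" for j p
    using p
  proof (induction "card A - p" arbitrary: p)
    case (Suc m)
    show ?case
    proof (cases "Suc p = card A")
      case True
      then show ?thesis using top by (intro step) auto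
    next
      case False
      then have "bracket A q K K u (- int j) (coeff (vpoly xv A) (Suc p)) = 0"
        using Suc by (intro Suc) auto
      then show ?thesis using Suc by (intro step) auto
    qed
  qed simp
  {
    case 0
    \<comment> \<open>For k = 0 the factor 1 - q^k in the premise on e_0 is zero, so the chain
      starts without any information on the bracket of 1.\<close>
    then show ?case by (intro down) auto
  next
    case (Suc j)
    \<comment> \<open>The bracket of e_n at -j is the bracket of 1 at -j - 1, which carries the
      vanishing on to the next k.\<close>
    have "bracket A q K K u (- int j) (coeff (vpoly xv A) 0) = 0"
      using Suc.IH[of 0] A by (simp add: card_gt_0_iff)
    then have "bracket A q K K u (- int (Suc j)) (coeff (vpoly xv A) (card A)) = 0"
      unfolding bracket_bot bracket_top[OF A(1)] by (simp only: of_nat_Suc minus_add_distrib uminus_add_conv_diff minus_diff_commute)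
    then show ?case using Suc.prems by (intro down) auto
  }
qed

lemma bracket_neg_1:
  assumes "nonroot q" "K \<ge> 1" "finite A" "A \<noteq> {}" "supp_in (zero_on A) u" "u \<noteq> 0" "k < 0"
  shows "bracket A q K K u k 1 = 0"
proof -
  have "bracket A q K K u (k + 1) (coeff (vpoly xv A) 0) = 0"
    using bracket_neg[OF assms(1-6), of 0 "nat (- (k + 1))"] assms by (simp add: card_gt_0_iff add.commute)
  then show ?thesis by (simp add: bracket_bot)
qed

text \<open>The mirror image of \<open>bracket_neg\<close>: here p increases, and the chain starts
  at k = K + 1 because its first factor q^K - q^(k-1) is zero there. The bracket of 1 at k then
  gives that of e_n at k + 1.\<close>

lemma bracket_big:
  assumes q: "nonroot q" and K: "K \<ge> 1" and A: "finite A" "A \<noteq> {}"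
    and u: "supp_in (zero_on A) u"
  shows "1 \<le> p \<Longrightarrow> p \<le> card A \<Longrightarrow> bracket A q K K u (int (Suc (K + j))) (coeff (vpoly xv A) p) = 0"
proof (induction j arbitrary: p)
  have step: "bracket A q K K u (int (Suc k)) (coeff (vpoly xv A) (Suc p)) = 0"
    if "p < card A" and 0: "scal (q ^ K * (q ^ K) ^ p - q ^ k) * 
       bracket A q K K u (int (Suc k)) (coeff (vpoly xv A) p) = 0" for k p
  proof -
    have pw: "q powi (int (Suc k)) = q ^ Suc k" "q powi (int (Suc k) - 1) = q ^ k"
      using power_int_of_nat[of q "Suc k"] power_int_of_nat[of q k] by simp_all
    have "q ^ Suc k * (q ^ K) ^ (card A - Suc p) \<noteq> 1"
      unfolding power_mult[symmetric] power_add[symmetric] by (rule nonroot_pow[OF q]) simp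
    moreover have "1 - (q ^ K) ^ Suc p \<noteq> 0"
      using nonroot_pow_pow[OF q K, of "Suc p"] by simp
    ultimately have "scal ((1 - (q ^ K) ^ Suc p) * (1 - q ^ Suc k * (q ^ K) ^ (card A - Suc p))) \<noteq> 0"
      by simp
    moreover have "scal ((1 - (q ^ K) ^ Suc p) * (1 - q ^ Suc k * (q ^ K) ^ (card A - Suc p))) *
       bracket A q K K u (int (Suc k)) (coeff (vpoly xv A) (Suc p)) = scal (1 - (q ^ K) ^ (card A - p)) * u *
       (scal (q ^ K * (q ^ K) ^ p - q ^ k) * bracket A q K K u (int (Suc k)) (coeff (vpoly xv A) p))"
      using bracket_recursion[OF nonroot_neq_0[OF q] A(1) u that(1), of K "int (Suc k)" K, unfolded pw]
      by (simp only: scal_mult mult_ac)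
    ultimately show ?thesis unfolding 0 by simp
  qed
  have up: "bracket A q K K u (int (Suc k)) (coeff (vpoly xv A) p) = 0"
    if "1 \<le> p" "p \<le> card A" and bot: "scal (q ^ K - q ^ k) * 
       bracket A q K K u (int (Suc k)) (coeff (vpoly xv A) 0) = 0" for k p
    using that(1,2)
  proof (induction p rule: nat_induct_at_least)
    case base
    show ?case using step[of 0 k] bot base by simp
  next
    case (Suc p)
    then show ?case using step[of p k] by simp
  qed
  {
    case 0
    then show ?case by (intro up) auto
  next
    case (Suc j)
    have "bracket A q K K u (int (Suc (K + j))) (coeff (vpoly xv A) (card A)) = 0"
      using A by (intro Suc.IH) (auto simp: card_gt_0_iff Suc_le_eq)
    then have "bracket A q K K u (int (Suc (K + Suc j))) (coeff (vpoly xv A) 0) = 0"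
      unfolding bracket_bot bracket_top[OF A(1)] by (simp add: algebra_simps)
    then show ?case using Suc.prems by (intro up) auto
  }
qed

section \<open>The constant term of the weight function\<close>

definition xdeg :: "nat set \<Rightarrow> (nat \<Rightarrow>\<^sub>0 int) \<Rightarrow> int" where
  "xdeg A e = (\<Sum>i\<in>A. lk e i)"

lemma xdeg_simps [simp]:
  "xdeg A 0 = 0" "xdeg A (a + b) = xdeg A a + xdeg A b" "xdeg A (a - b) = xdeg A a - xdeg A b"
  by (simp_all add: xdeg_def lookup_add lookup_minus sum.distrib sum_subtractf)

lemma xdeg_single: "finite A \<Longrightarrow> xdeg A (Poly_Mapping.single i k) = (if i \<in> A then k else 0)"
  by (simp add: xdeg_def lookup_single when_def)

lemma zero_on_xdeg: "zero_on A e \<Longrightarrow> xdeg A e = 0"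
  by (simp add: zero_on_def xdeg_def)

lemma supp_in_scal_mult: "supp_in P p \<Longrightarrow> supp_in P (scal c * p)"
  by (rule supp_in_mult[where P = "\<lambda>e. e = 0", OF supp_in_scal]) auto

lemma supp_in_fin_qpoch:
  assumes "P 0" "\<And>a b. P a \<Longrightarrow> P b \<Longrightarrow> P (a + b)" "supp_in P a"
  shows "supp_in P (fin_qpoch a q m)"
  unfolding fin_qpoch_def
  by (rule supp_in_prod[OF assms(1,2)])
     (auto intro!: supp_in_diff supp_in_1 supp_in_scal_mult assms(1,3))

lemma supp_in_Delta:
  assumes "P 0" "\<And>a b. P a \<Longrightarrow> P b \<Longrightarrow> P (a + b)"
    and "\<And>i j. i \<in> A \<Longrightarrow> j \<in> A \<Longrightarrow> i \<noteq> j \<Longrightarrow> P (Poly_Mapping.single i 1 - Poly_Mapping.single j 1)"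
  shows "supp_in P (Delta A q K)"
  unfolding Delta_def
  by (rule supp_in_prod) (auto simp: offd_def rt_def intro!: supp_in_fin_qpoch supp_in_mon assms)

text \<open>Meant for a \<open>P\<close> that excludes the exponent 0, such as positivity of the
  degree; hence the term 1 of the product is split off.\<close>

lemma supp_in_prod_one_minus:
  assumes "finite I" "\<And>a b. P a \<Longrightarrow> P b \<Longrightarrow> P (a + b)" "\<And>i. i \<in> I \<Longrightarrow> supp_in P (f i)"
  shows "supp_in P ((\<Prod>i\<in>I. 1 - f i) - 1)"
  using assms(1,3)
proof (induction I rule: finite_induct)
  case (insert i I)
  define r where "r = (\<Prod>i\<in>I. 1 - f i) - 1"
  have "(\<Prod>i\<in>insert i I. 1 - f i) - 1 = r - (f i + f i * r)"
    using insert by (simp add: r_def algebra_simps)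
  moreover have "supp_in P r" "supp_in P (f i)" using insert by (auto simp: r_def)
  ultimately show ?case by (auto intro!: supp_in_diff supp_in_add supp_in_mult assms(2))
qed simp

text \<open>\<Delta> is homogeneous of degree 0 in the x_i, while all terms of w other than 1 have
  positive degree. So only this 1 contributes.\<close>

lemma bracket_0:
  assumes A: "finite A" and u: "supp_in (zero_on A) u"
  shows "bracket A q K L u 0 1 = ct A (Delta A q K)"
proof -
  let ?P = "\<lambda>e. 0 < xdeg A e"
  have "wt A u q L = (\<Prod>x\<in>A \<times> {..<L}. 1 - scal (q ^ snd x) * (u * xv (fst x)))"
    by (simp add: wt_def fin_qpoch_def prod.cartesian_product case_prod_unfold)
  moreover have "supp_in ?P ((\<Prod>x\<in>A \<times> {..<L}. 1 - scal (q ^ snd x) * (u * xv (fst x))) - 1)"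
  proof (rule supp_in_prod_one_minus)
    fix x assume x: "x \<in> A \<times> {..<L}"
    have "supp_in ?P (xv (fst x))"
      unfolding xv_def using x A by (intro supp_in_mon) (auto simp: xdeg_single)
    then have "supp_in ?P (u * xv (fst x))"
      by (rule supp_in_mult[OF u]) (simp add: xdeg_def zero_on_def lookup_add sum.distrib)
    then show "supp_in ?P (scal (q ^ snd x) * (u * xv (fst x)))"
      by (rule supp_in_scal_mult)
  qed (use A in auto)
  ultimately have w: "supp_in ?P (wt A u q L - 1)" by simp
  have d: "supp_in (\<lambda>e. xdeg A e = 0) (Delta A q K)"
    by (rule supp_in_Delta) (use A in \<open>auto simp: xdeg_single\<close>)
  have "supp_in (\<lambda>e. \<not> zero_on A e) (Delta A q K * (wt A u q L - 1))"
    by (rule supp_in_mult[OF d w]) (auto dest: zero_on_xdeg)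
  then have "ct A (Delta A q K * (wt A u q L - 1)) = 0"
    by (rule ct_eq_0)
  then show ?thesis by (simp add: bracket_def ct_diff algebra_simps)
qed

section \<open>The evaluation for \<Delta>, by induction on the number of variables\<close>

definition qfac :: "complex \<Rightarrow> nat \<Rightarrow> complex" where
  "qfac q m = (\<Prod>t<m. 1 - q ^ Suc t)"

lemma qfac_neq_0: "nonroot q \<Longrightarrow> qfac q m \<noteq> 0"
  using nonroot_pow[of q] unfolding qfac_def by (subst prod_zero_iff) (auto simp del: power_Suc)

lemma qfac_add: "qfac q (m + k) = qfac q m * (\<Prod>t<k. 1 - q ^ (m + Suc t))"
  by (induction k) (simp_all add: qfac_def)

text \<open>The exponents 1, ..., Kn are cut into n consecutive blocks of length K.\<close>

lemma qfac_blocks: "(\<Prod>p<n. \<Prod>t<K. 1 - q ^ (K * p + Suc t)) = qfac q (K * n)"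
proof (induction n)
  case (Suc n)
  have "K * Suc n = K * n + K" by simp
  then show ?case using Suc by (simp only: prod.lessThan_Suc qfac_add)
qed (simp add: qfac_def)

lemma qfac_blocks_Suc: "qfac q K * (\<Prod>p<n. \<Prod>t<K. 1 - q ^ (K * Suc p + Suc t)) = qfac q (K * Suc n)"
proof -
  have "qfac q (K * Suc n) = (\<Prod>p<Suc n. \<Prod>t<K. 1 - q ^ (K * p + Suc t))"
    by (rule qfac_blocks[symmetric])
  also have "\<dots> = (\<Prod>t<K. 1 - q ^ (K * 0 + Suc t)) * (\<Prod>p<n. \<Prod>t<K. 1 - q ^ (K * Suc p + Suc t))"
    by (rule prod.lessThan_Suc_shift)
  finally show ?thesis by (simp add: qfac_def)
qed

text \<open>The first symbol is reversed by 1 - q^k/x = - (q^k/x) (1 - q^(-k) x), which gives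
  (q^(1-K) x; q)_K up to a monomial. Its factors carry the powers q^(1-K), ..., q^0, and those of (q
  x; q)_K continue with q^1, ..., q^K. This is where u = q^(1-K), L = 2K and, from x^(-K), the index
  k = K in \<open>ct_Dl\<close> come from.\<close>

lemma fin_qpoch_two_sided:
  assumes q: "q \<noteq> 0"
  shows "fin_qpoch (mon (- Poly_Mapping.single j 1)) q K * fin_qpoch (scal q * xv j) q K
   = scal (\<Prod>k<K. - (q ^ k)) * mon (- Poly_Mapping.single j (int K)) * fin_qpoch (scal (1 / q ^ (K - 1)) * xv j) q (2 * K)"
proof -
  define y where "y = mon (- Poly_Mapping.single j 1)"
  have yx: "y * xv j = 1" by (simp add: y_def xv_def flip: mon_add)
  have "1 - scal (q ^ k) * y = scal (- (q ^ k)) * y * (1 - scal (1 / q ^ k) * xv j)" for k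
  proof -
    have "scal (q ^ k) * y * (scal (1 / q ^ k) * xv j) = (scal (q ^ k) * scal (1 / q ^ k)) * (y * xv j)"
      by (simp add: mult_ac)
    also have "\<dots> = 1" unfolding yx using q by (simp flip: scal_mult)
    finally show ?thesis by (simp add: scal_uminus algebra_simps)
  qed
  then have "fin_qpoch y q K = (\<Prod>k<K. scal (- (q ^ k)) * y * (1 - scal (1 / q ^ k) * xv j))"
    by (simp add: fin_qpoch_def)
  also have "\<dots> = scal (\<Prod>k<K. - (q ^ k)) * y ^ K * (\<Prod>k<K. 1 - scal (1 / q ^ k) * xv j)"
    by (simp add: prod.distrib scal_prod)
  also have "(\<Prod>k<K. 1 - scal (1 / q ^ k) * xv j) = (\<Prod>k<K. 1 - scal (1 / q ^ (K - Suc k)) * xv j)"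
    by (rule prod.nat_diff_reindex[symmetric])
  also have "\<dots> = (\<Prod>k<K. 1 - scal (q ^ k) * (scal (1 / q ^ (K - 1)) * xv j))"
  proof (rule prod.cong)
    fix k assume "k \<in> {..<K}"
    then have "K - 1 = k + (K - Suc k)" by auto
    then have N: "1 / q ^ (K - Suc k) = q ^ k * (1 / q ^ (K - 1))" using q by (simp add: power_add)
    show "1 - scal (1 / q ^ (K - Suc k)) * xv j = 1 - scal (q ^ k) * (scal (1 / q ^ (K - 1)) * xv j)"
      unfolding N scal_mult by (simp only: mult.assoc)
  qed auto
  finally have 1: "fin_qpoch y q K = scal (\<Prod>k<K. - (q ^ k)) * y ^ K * (\<Prod>k<K. 1 - scal (q ^ k) * (scal (1 / q ^ (K - 1)) * xv j))" .
  have 2: "fin_qpoch (scal q * xv j) q K = (\<Prod>k<K. 1 - scal (q ^ (K + k)) * (scal (1 / q ^ (K - 1)) * xv j))"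
    unfolding fin_qpoch_def
  proof (rule prod.cong)
    fix k assume "k \<in> {..<K}"
    then have "K + k = (K - 1) + (k + 1)" by auto
    then have "q ^ (K + k) = q ^ (K - 1) * (q ^ k * q)"
      by (metis power_add power_one_right)
    then have N: "q ^ (K + k) * (1 / q ^ (K - 1)) = q ^ k * q" using q by simp
    have "scal (q ^ k) * scal q = scal (q ^ (K + k)) * scal (1 / q ^ (K - 1))"
      unfolding scal_mult[symmetric] N ..
    then show "1 - scal (q ^ k) * (scal q * xv j) = 1 - scal (q ^ (K + k)) * (scal (1 / q ^ (K - 1)) * xv j)"
      by (simp flip: mult.assoc)
  qed auto
  have 3: "fin_qpoch a q (2 * K) = (\<Prod>k<K. 1 - scal (q ^ k) * a) * (\<Prod>k<K. 1 - scal (q ^ (K + k)) * a)" for a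
  proof -
    have "{..<2 * K} = {..<K} \<union> (\<lambda>k. K + k) ` {..<K}"
    proof (intro equalityI subsetI)
      fix k assume "k \<in> {..<2 * K}"
      then show "k \<in> {..<K} \<union> (\<lambda>k. K + k) ` {..<K}"
        by (cases "k < K") (auto intro!: image_eqI[of _ _ "k - K"])
    qed auto
    moreover have "{..<K} \<inter> (\<lambda>k. K + k) ` {..<K} = {}" by auto
    ultimately show ?thesis unfolding fin_qpoch_def by (simp add: prod.union_disjoint prod.reindex)
  qed
  have 4: "y ^ K = mon (- Poly_Mapping.single j (int K))"
  proof (induction K)
    case (Suc K)
    have N: "- Poly_Mapping.single j (int (Suc K)) = - Poly_Mapping.single j (1::int) + - Poly_Mapping.single j (int K)"
      by (simp add: single_add)
    show ?case using Suc by (simp only: N mon_add power_Suc y_def)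
  qed simp
  show ?thesis unfolding y_def[symmetric] 1 2 3 4 by (simp only: mult_ac)
qed

text \<open>The substitution \<open>x_j \<mapsto> x_i x_j\<close> for \<open>j \<noteq> i\<close> removes \<open>x_i\<close> from \<open>Dl A i\<close>; what remains
  is the bracket over \<open>A - {i}\<close> with \<open>L = 2K\<close>, \<open>k = K\<close> and \<open>u = q^(1-K)\<close>.\<close>

lemma ct_Dl:
  assumes q: "nonroot q" and K: "K \<ge> 1" and A: "finite A" "i \<in> A"
  shows "scal (qfac q (K * card (A-{i})) * qfac q K) * ct A (Dl A i q K)
    = scal (qfac q (K * card A)) * ct (A-{i}) (Delta (A-{i}) q K)"
proof -
  define B where "B = A - {i}"
  define n where "n = card B"
  have B: "finite B" "i \<notin> B" and AB: "A = insert i B"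
    using A by (auto simp: B_def)
  have cA: "card A = Suc n"
    unfolding n_def B_def by (rule card_Suc_Diff1[symmetric]) (use A in auto)
  have q0: "q \<noteq> 0" using q by (rule nonroot_neq_0)
  \<comment> \<open>Exponent form of the substitution: each x_j with j in \<open>B\<close> brings
    along one x_i.\<close>
  define \<phi> where "\<phi> = (\<lambda>e. e + Poly_Mapping.single i (xdeg B e))"
  define \<chi> :: "(nat \<Rightarrow>\<^sub>0 int) \<Rightarrow> complex" where "\<chi> = (\<lambda>e. 1)"
  have c: "mchar \<phi> \<chi>"
    by (simp add: mchar_def \<phi>_def \<chi>_def single_add)
  define cc where "cc = (\<Prod>k<K. - (q ^ k))"
  define u0 where "u0 = 1 / q ^ (K - 1)"
  have zo: "zero_on A (\<phi> e) = zero_on A e" for e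
  proof -
    have "lk (\<phi> e) i = lk e i + xdeg B e" by (simp add: \<phi>_def lookup_add)
    moreover have "zero_on B (\<phi> e) = zero_on B e"
      using B by (auto simp: zero_on_def \<phi>_def lookup_add lookup_single when_def)
    moreover have "zero_on A f \<longleftrightarrow> lk f i = 0 \<and> zero_on B f" for f
      by (simp add: zero_on_def AB)
    ultimately show ?thesis using zero_on_xdeg[of B e] by (metis add_0_right)
  qed
  have zo2: "\<phi> e = e \<and> \<chi> e = 1" if "zero_on A e" for e
  proof -
    have "zero_on B e" using that by (simp add: zero_on_def B_def)
    then show ?thesis using zero_on_xdeg[of B e] by (simp add: \<phi>_def \<chi>_def)
  qed
  have "ct A (Dl A i q K) = ct A (msub \<phi> \<chi> (Dl A i q K))"
    by (rule ct_msub[OF zo zo2, symmetric])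
  also have "msub \<phi> \<chi> (Dl A i q K) = (\<Prod>x\<in>offd B. msub \<phi> \<chi> (case x of (a, b) \<Rightarrow> fin_qpoch (rt a b) q K)) *
     (\<Prod>j\<in>B. fin_qpoch (msub \<phi> \<chi> (rt i j)) q K * fin_qpoch (scal q * msub \<phi> \<chi> (rt j i)) q K)"
    by (simp add: Dl_def Delta_def msub_mult[OF c] msub_prod[OF c] msub_fin_qpoch[OF c] c B_def)
  also have "(\<Prod>x\<in>offd B. msub \<phi> \<chi> (case x of (a, b) \<Rightarrow> fin_qpoch (rt a b) q K)) = Delta B q K"
    unfolding Delta_def
  proof (rule prod.cong, safe)
    fix a b assume "(a, b) \<in> offd B"
    then have "msub \<phi> \<chi> (rt a b) = rt a b"
      using B by (simp add: rt_def msub_mon \<chi>_def \<phi>_def offd_def xdeg_single)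
    then show "msub \<phi> \<chi> (fin_qpoch (rt a b) q K) = fin_qpoch (rt a b) q K" by (simp add: msub_fin_qpoch[OF c])
  qed
  also have "(\<Prod>j\<in>B. fin_qpoch (msub \<phi> \<chi> (rt i j)) q K * fin_qpoch (scal q * msub \<phi> \<chi> (rt j i)) q K) =
    (\<Prod>j\<in>B. scal cc * mon (- Poly_Mapping.single j (int K)) * fin_qpoch (scal u0 * xv j) q (2 * K))"
  proof (rule prod.cong)
    fix j assume j: "j \<in> B"
    have "msub \<phi> \<chi> (rt i j) = mon (- Poly_Mapping.single j 1)"
      using B j by (simp add: rt_def msub_mon \<chi>_def \<phi>_def xdeg_single single_uminus)
    moreover have "msub \<phi> \<chi> (rt j i) = xv j"
      using B j by (simp add: rt_def xv_def msub_mon \<chi>_def \<phi>_def xdeg_single)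
    ultimately show "fin_qpoch (msub \<phi> \<chi> (rt i j)) q K * fin_qpoch (scal q * msub \<phi> \<chi> (rt j i)) q K =
      scal cc * mon (- Poly_Mapping.single j (int K)) * fin_qpoch (scal u0 * xv j) q (2 * K)"
      using fin_qpoch_two_sided[OF q0, of j K] by (simp add: cc_def u0_def)
  qed auto
  also have "\<dots> = scal (cc ^ n) * (wt B (scal u0) q (2 * K) * en B (- int K))"
    by (simp add: prod.distrib wt_def en_def mon_sum scal_power n_def single_uminus mult_ac)
  finally have E1: "ct A (Dl A i q K) = ct A (scal (cc ^ n) * (Delta B q K * (wt B (scal u0) q (2 * K) * en B (- int K))))"
    by (simp add: mult_ac)
  define G where "G = Delta B q K * (wt B (scal u0) q (2 * K) * en B (- int K))"
  let ?P = "zero_on {i}"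
  have P0: "?P 0" and Padd: "\<And>a b. ?P a \<Longrightarrow> ?P b \<Longrightarrow> ?P (a + b)"
    by (auto simp: zero_on_def lookup_add)
  have "supp_in ?P (Delta B q K)"
    by (rule supp_in_Delta[of ?P, OF P0 Padd]) (use B in \<open>auto simp: zero_on_def lookup_minus lookup_single when_def\<close>)
  moreover have "supp_in ?P (wt B (scal u0) q (2 * K))"
    unfolding wt_def
  proof (intro supp_in_prod supp_in_fin_qpoch P0 Padd)
    fix j assume "j \<in> B"
    then have "supp_in ?P (xv j)"
      unfolding xv_def using B by (intro supp_in_mon) (auto simp: zero_on_def lookup_single when_def)
    then show "supp_in ?P (scal u0 * xv j)"
      by (rule supp_in_scal_mult)
  qed
  moreover have "supp_in ?P (en B (- int K))"
    unfolding en_def using B by (intro supp_in_mon) (simp add: zero_on_def lk_sum_single)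
  ultimately have "supp_in ?P G"
    unfolding G_def by (intro supp_in_mult[of ?P _ ?P _ ?P] Padd)
  then have "ct {i} G = G" by (rule ct_eq_self)
  then have "ct A G = ct B G"
    using ct_ct[of B "{i}" G] by (simp add: AB)
  then have E2: "ct A (Dl A i q K) = scal (cc ^ n) * bracket B q K (2 * K) (scal u0) (int K) 1"
    unfolding E1 G_def[symmetric] ct_scal_mult by (simp add: G_def bracket_def)
  have su: "supp_in (zero_on B) (scal u0)" by (rule supp_in_scal) simp
  \<comment> \<open>\<open>bracket_iter\<close> goes down from k = K to k = 0, where the weight
    drops out by \<open>bracket_0\<close>.\<close>
  have I: "scal (\<Prod>t<K. \<Prod>p<n. 1 - q ^ Suc t * (q ^ K) ^ p) * bracket B q K (2 * K) (scal u0) (int K) 1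
    = scal (\<Prod>t<K. \<Prod>p<n. q ^ (2 * K) * (q ^ K) ^ p - q ^ t) * (scal u0 ^ (n * K) * ct B (Delta B q K))"
    using bracket_iter[OF q K B(1) su, of K "2 * K"] by (simp add: bracket_0[OF B(1) su] n_def)
  have d: "(\<Prod>t<K. \<Prod>p<n. 1 - q ^ Suc t * (q ^ K) ^ p) = qfac q (K * n)"
  proof -
    have "q ^ Suc t * (q ^ K) ^ p = q ^ (K * p + Suc t)" for t p
      by (simp only: power_mult power_add mult.commute)
    then show ?thesis by (subst prod.swap) (simp only: qfac_blocks)
  qed
  \<comment> \<open>Since q^(2K + Kp) - q^t = - q^t (1 - q^(K(p+2) - t)), the numerators for each p
    give a further constant \<open>cc\<close>; together with the \<open>cc\<close> of the reversal
    and with u0^K it multiplies to 1.\<close>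
  have "cc * u0 ^ K * (\<Prod>t<K. q ^ (2 * K) * (q ^ K) ^ p - q ^ t) = (\<Prod>t<K. 1 - q ^ (K * Suc p + Suc t))" for p
  proof -
    have "(\<Prod>t<K. q ^ (2 * K) * (q ^ K) ^ p - q ^ t) = (\<Prod>t<K. - (q ^ t) * (1 - q ^ (K * Suc p + Suc (K - Suc t))))"
    proof (rule prod.cong)
      fix t assume "t \<in> {..<K}"
      then have "q ^ (2 * K) * (q ^ K) ^ p = q ^ t * q ^ (K * Suc p + Suc (K - Suc t))"
        unfolding power_mult[symmetric] power_add[symmetric] by (intro arg_cong[where f = "power q"]) auto
      then show "q ^ (2 * K) * (q ^ K) ^ p - q ^ t = - (q ^ t) * (1 - q ^ (K * Suc p + Suc (K - Suc t)))"
        by (simp add: algebra_simps del: power_Suc)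
    qed auto
    also have "\<dots> = cc * (\<Prod>t<K. 1 - q ^ (K * Suc p + Suc (K - Suc t)))"
      by (simp only: prod.distrib cc_def)
    also have "(\<Prod>t<K. 1 - q ^ (K * Suc p + Suc (K - Suc t))) = (\<Prod>t<K. 1 - q ^ (K * Suc p + Suc t))"
      by (rule prod.nat_diff_reindex[of "\<lambda>t. 1 - q ^ (K * Suc p + Suc t)"])
    finally have 1: "(\<Prod>t<K. q ^ (2 * K) * (q ^ K) ^ p - q ^ t) = cc * (\<Prod>t<K. 1 - q ^ (K * Suc p + Suc t))" .
    \<comment> \<open>Pairing t with K - 1 - t turns the square into q^(K(K-1)), which u0^K
      cancels.\<close>
    have "cc * cc = (\<Prod>t<K. - (q ^ t)) * (\<Prod>t<K. - (q ^ (K - Suc t)))"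
      unfolding cc_def prod.nat_diff_reindex[of "\<lambda>t. - (q ^ t)"] ..
    also have "\<dots> = (\<Prod>t<K. q ^ (K - 1))"
      unfolding prod.distrib[symmetric] by (rule prod.cong) (auto simp flip: power_add)
    finally have cc: "cc * cc * u0 ^ K = 1"
      using q0 by (simp add: u0_def power_divide power_mult[symmetric] mult.commute)
    have "cc * u0 ^ K * (cc * X) = X" for X
    proof -
      have "cc * u0 ^ K * (cc * X) = (cc * cc * u0 ^ K) * X" by (simp only: mult_ac)
      then show ?thesis by (simp only: cc mult_1)
    qed
    then show ?thesis unfolding 1 .
  qed
  then have "(\<Prod>p<n. cc * u0 ^ K * (\<Prod>t<K. q ^ (2 * K) * (q ^ K) ^ p - q ^ t)) = (\<Prod>p<n. \<Prod>t<K. 1 - q ^ (K * Suc p + Suc t))"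
    by simp
  moreover have "u0 ^ (n * K) = (u0 ^ K) ^ n" by (metis mult.commute power_mult)
  ultimately have nn: "cc ^ n * u0 ^ (n * K) * (\<Prod>t<K. \<Prod>p<n. q ^ (2 * K) * (q ^ K) ^ p - q ^ t) = (\<Prod>p<n. \<Prod>t<K. 1 - q ^ (K * Suc p + Suc t))"
    by (subst prod.swap) (simp add: prod.distrib mult_ac)
  have "scal (qfac q (K * n) * qfac q K) * ct A (Dl A i q K)
     = scal (qfac q K * cc ^ n) * (scal (qfac q (K * n)) * bracket B q K (2 * K) (scal u0) (int K) 1)"
    unfolding E2 by (simp add: scal_mult mult_ac)
  also have "\<dots> = scal (qfac q K * (cc ^ n * u0 ^ (n * K) * (\<Prod>t<K. \<Prod>p<n. q ^ (2 * K) * (q ^ K) ^ p - q ^ t))) * ct B (Delta B q K)"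
    unfolding I[unfolded d] by (simp add: scal_mult scal_power mult_ac)
  also have "\<dots> = scal (qfac q (K * Suc n)) * ct B (Delta B q K)"
    unfolding nn qfac_blocks_Suc ..
  finally show ?thesis unfolding cA B_def[symmetric] n_def[symmetric] .
qed

text \<open>Summing \<open>Dl\<close> over i gives \<Delta> (1 - z^n)/(1 - z), and each summand has
  a constant term known from n - 1 variables. It is the same for all i, so each step contributes a
  factor n, which accounts for the factorial. The value is the constant term of Macdonald's weight
  of type A with parameter t = q^K.\<close>

theorem ct_Delta:
  assumes q: "nonroot q" and K: "K \<ge> 1"
  defines "z \<equiv> q ^ K"
  shows "finite A \<Longrightarrow> ct A (Delta A q K) = scal (fact (card A) * (1 - z) ^ card A * qfac q (K * card A) /
     ((\<Prod>p<card A. 1 - z ^ Suc p) * qfac q K ^ card A))"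
proof (induction "card A" arbitrary: A)
  case 0
  then show ?case by (auto simp: Delta_def offd_def qfac_def ct_eq_self supp_in_1)
next
  case (Suc n)
  define D where "D = (\<Prod>p<n. 1 - z ^ Suc p)"
  define c where "c = fact n * (1 - z) ^ n * qfac q (K * n) / (D * qfac q K ^ n)"
  have zp: "1 - z ^ Suc p \<noteq> 0" for p
    using nonroot_pow_pow[OF q K, of "Suc p"] by (simp add: z_def)
  have D: "D \<noteq> 0" unfolding D_def using zp by (subst prod_zero_iff) auto
  note qf = qfac_neq_0[OF q]
  have x0: "xv i \<noteq> 0" for i by simp
  have dl: "Dl A i q K * (\<Prod>j\<in>A-{i}. xv i - xv j) = Delta A q K * (\<Prod>j\<in>A-{i}. 1 * xv i - scal z * xv j)"
    if "i \<in> A" for i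
    using Dl_Delta[OF Suc.prems that] by (simp add: z_def)
  have "(1 - scal z) * (\<Sum>i\<in>A. Dl A i q K) = Delta A q K * (1 - scal z ^ Suc n)"
    using sum_residues[OF Suc.prems inj_xv, where \<alpha> = 1 and \<beta> = "scal z", OF dl x0] Suc.hyps by simp
  then have "scal (1 - z ^ Suc n) * Delta A q K = scal (1 - z) * (\<Sum>i\<in>A. Dl A i q K)"
    by (simp only: scal_diff scal_power scal_1 mult_ac)
  then have E: "scal (1 - z ^ Suc n) * ct A (Delta A q K) = scal (1 - z) * (\<Sum>i\<in>A. ct A (Dl A i q K))"
    by (metis ct_scal_mult ct_sum)
  have "ct A (Dl A i q K) = scal (qfac q (K * Suc n) * c / (qfac q (K * n) * qfac q K))" if i: "i \<in> A" for i
  proof -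
    have cB: "card (A - {i}) = n" using i Suc by simp
    then have "ct (A - {i}) (Delta (A - {i}) q K) = scal c"
      using Suc.hyps(1)[of "A - {i}"] Suc.prems by (simp add: c_def D_def)
    then have "scal (qfac q (K * n) * qfac q K) * ct A (Dl A i q K) = scal (qfac q (K * Suc n) * c)"
      using ct_Dl[OF q K Suc.prems i] Suc.hyps(2) by (simp add: cB scal_mult)
    also have "\<dots> = scal (qfac q (K * n) * qfac q K) * scal (qfac q (K * Suc n) * c / (qfac q (K * n) * qfac q K))"
      using qf by (simp flip: scal_mult)
    finally show ?thesis using qf by simp
  qed
  then have "scal (1 - z ^ Suc n) * ct A (Delta A q K) = scal (1 - z) * (of_nat (Suc n) * scal (qfac q (K * Suc n) * c / (qfac q (K * n) * qfac q K)))"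
    unfolding E using Suc.hyps by simp
  also have "\<dots> = scal ((1 - z) * (of_nat (Suc n) * (qfac q (K * Suc n) * c / (qfac q (K * n) * qfac q K))))"
    by (simp only: scal_mult scal_of_nat)
  also have "(1 - z) * (of_nat (Suc n) * (qfac q (K * Suc n) * c / (qfac q (K * n) * qfac q K)))
    = (1 - z ^ Suc n) * (fact (Suc n) * (1 - z) ^ Suc n * qfac q (K * Suc n) / ((\<Prod>p<Suc n. 1 - z ^ Suc p) * qfac q K ^ Suc n))"
  proof -
    define w where "w = 1 - z ^ Suc n"
    define v where "v = 1 - z"
    have "w \<noteq> 0" using zp[of n] by (simp add: w_def)
    moreover have "(\<Prod>p<Suc n. 1 - z ^ Suc p) = D * w" by (simp add: D_def w_def)
    ultimately show ?thesis
      using D qf[of K] qf[of "K * n"] unfolding c_def w_def[symmetric] v_def[symmetric]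
      by (simp add: divide_simps)
  qed
  finally have "scal (1 - z ^ Suc n) * ct A (Delta A q K) = scal (1 - z ^ Suc n) * 
      scal (fact (Suc n) * (1 - z) ^ Suc n * qfac q (K * Suc n) / ((\<Prod>p<Suc n. 1 - z ^ Suc p) * qfac q K ^ Suc n))"
    by (simp only: scal_mult)
  then show ?case using zp[of n] Suc.hyps(2)
    by (metis mult_left_cancel scal_eq_0_iff)
qed

section \<open>Passing to the hyperplane \<open>x_1 \<cdots> x_n = 1\<close>\<close>

text \<open>Exponents under the substitution of \<open>(x_1 \<cdots> x_(n-1))^(-1)\<close> for \<open>x_n\<close>.\<close>

definition slphi :: "nat \<Rightarrow> (nat \<Rightarrow>\<^sub>0 int) \<Rightarrow> (nat \<Rightarrow>\<^sub>0 int)" where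
  "slphi n e = e + (\<Sum>i\<in>{1..n}. frag_cmul (lk e i) (xsub n i - Poly_Mapping.single i 1))"

abbreviation sl :: "nat \<Rightarrow> lpoly \<Rightarrow> lpoly" where
  "sl n \<equiv> msub (slphi n) (\<lambda>_. 1)"

lemma mchar_slphi: "mchar (slphi n) (\<lambda>_. 1)"
  by (simp add: mchar_def slphi_def lookup_add frag_cmul_distrib sum.distrib)

lemma slphi_single:
  assumes "i \<in> {1..n}"
  shows "slphi n (Poly_Mapping.single i 1) = xsub n i"
proof -
  have "(\<Sum>j\<in>{1..n}. frag_cmul (lk (Poly_Mapping.single i 1) j) (xsub n j - Poly_Mapping.single j 1))
     = (\<Sum>j\<in>{1..n}. if j = i then xsub n i - Poly_Mapping.single i 1 else 0)"
    by (rule sum.cong) (auto simp: lookup_single when_def)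
  then show ?thesis using assms by (simp add: slphi_def)
qed

lemma slphi_diff: "slphi n (a - b) = slphi n a - slphi n b"
  by (simp add: slphi_def lookup_minus frag_cmul_diff_distrib sum_subtractf)

lemma slphi_free: "zero_on {1..n} e \<Longrightarrow> slphi n e = e"
  by (simp add: slphi_def zero_on_def)

lemma lk_xsub: 
  assumes "i \<in> {1..n}" "j \<in> {1..<n}"
  shows "lk (xsub n i) j = (if i = n then -1 else if i = j then 1 else 0)"
  using assms by (auto simp: xsub_def lookup_single when_def lk_sum_single)

lemma lk_xsub_outside: 
  assumes "i \<in> {1..n}" "j \<notin> {1..<n}"
  shows "lk (xsub n i) j = 0"
  using assms by (auto simp: xsub_def lookup_single when_def lk_sum_single)

lemma lk_slphi:
  assumes n: "n \<ge> 1"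
  shows "lk (slphi n e) j = (if j \<in> {1..<n} then lk e j - lk e n else if j = n then 0 else lk e j)"
proof -
  have "lk (slphi n e) j = lk e j + (\<Sum>i\<in>{1..n}. lk e i * (lk (xsub n i) j - (if j = i then 1 else 0)))"
    by (simp add: slphi_def lookup_add lookup_sum lookup_minus lookup_single when_def)
  also have "(\<Sum>i\<in>{1..n}. lk e i * (lk (xsub n i) j - (if j = i then 1 else 0)))
     = (\<Sum>i\<in>{1..n}. (if i = n then if j \<in> {1..<n} then - lk e n else 0 else 0) - (if i = j \<and> j = n then lk e n else 0))"
    by (rule sum.cong) (auto simp: lk_xsub lk_xsub_outside)
  also have "\<dots> = (if j \<in> {1..<n} then - lk e n else if j = n then - lk e n else 0)"
    using n by (auto simp: sum_subtractf)
  finally show ?thesis by auto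
qed

text \<open>A monomial contributes to the constant term after the substitution iff it is a
  power of \<open>x_1 \<cdots> x_n\<close>.\<close>

lemma ct_sl_single:
  assumes n: "n \<ge> 1" and N: "\<bar>lk e n\<bar> \<le> int N"
  shows "ct {1..<n} (sl n (Poly_Mapping.single e c))
    = (\<Sum>k\<in>{- int N..int N}. ct {1..n} (en {1..n} (- k) * Poly_Mapping.single e c))"
proof -
  let ?E = "\<lambda>k. \<Sum>j\<in>{1..n}. Poly_Mapping.single j (k :: int)"
  have zE: "zero_on {1..n} (?E (- k) + e) \<longleftrightarrow> (\<forall>i\<in>{1..n}. lk e i = k)" for k
    by (auto simp: zero_on_def lookup_add lk_sum_single)
  have en: "en {1..n} (- k) * Poly_Mapping.single e c = Poly_Mapping.single (?E (- k) + e) c" for k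
    by (simp add: en_def mon_def mult_single)
  \<comment> \<open>Vanishing of the x_n-exponent forces k = \<open>lk e n\<close>, which the bound
    on \<open>N\<close> places in the range.\<close>
  have "(\<Sum>k\<in>{- int N..int N}. ct {1..n} (en {1..n} (- k) * Poly_Mapping.single e c))
    = (\<Sum>k\<in>{- int N..int N}. if k = lk e n then ct {1..n} (en {1..n} (- k) * Poly_Mapping.single e c) else 0)"
    unfolding en ct_single zE by (rule sum.cong) (use n in auto)
  also have "\<dots> = ct {1..n} (en {1..n} (- lk e n) * Poly_Mapping.single e c)"
    using N by (simp add: abs_le_iff)
  also have "\<dots> = (if \<forall>i\<in>{1..n}. lk e i = lk e n then Poly_Mapping.single (?E (- lk e n) + e) c else 0)"
    by (simp only: en ct_single zE)
  also have "\<dots> = ct {1..<n} (sl n (Poly_Mapping.single e c))"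
  proof -
    have z: "zero_on {1..<n} (slphi n e) \<longleftrightarrow> (\<forall>i\<in>{1..n}. lk e i = lk e n)"
    proof -
      have "{1..n} = insert n {1..<n}" using n by auto
      then show ?thesis by (simp add: zero_on_def lk_slphi[OF n])
    qed
    have E: "slphi n e = ?E (- lk e n) + e" if a: "\<forall>i\<in>{1..n}. lk e i = lk e n"
    proof (rule poly_mapping_eqI)
      fix j show "lk (slphi n e) j = lk (?E (- lk e n) + e) j"
      proof (cases "j \<in> {1..n}")
        case True
        then have "lk e j = lk e n" using a by blast
        then show ?thesis using True by (simp add: lk_slphi[OF n] lookup_add lk_sum_single)
      next
        case False
        then show ?thesis using n by (auto simp: lk_slphi[OF n] lookup_add lk_sum_single)
      qed
    qed
    show ?thesis
    proof (cases "\<forall>i\<in>{1..n}. lk e i = lk e n")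
      case True
      have "zero_on {1..<n} (slphi n e)" using z True by (rule iffD2)
      then show ?thesis
        unfolding if_P[OF True] msub_single ct_single by (simp add: E[OF True])
    next
      case False
      then have "\<not> zero_on {1..<n} (slphi n e)" by (simp only: z not_False_eq_True)
      then show ?thesis
        unfolding if_not_P[OF False] msub_single ct_single by (simp only: if_False)
    qed
  qed
  finally show ?thesis ..
qed

text \<open>Each of the finitely many monomials of \<open>p\<close> requires its own range of k.
  Claiming the identity for all large \<open>N\<close> makes these ranges compatible under
  addition.\<close>

lemma ct_sl:
  assumes n: "n \<ge> 1"
  shows "\<exists>M. \<forall>N\<ge>M. ct {1..<n} (sl n p) = (\<Sum>k\<in>{- int N..int N}. ct {1..n} (en {1..n} (- k) * p))"
proof (induction p rule: lpoly_induct)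
  case (single e c)
  show ?case
    by (rule exI[of _ "nat \<bar>lk e n\<bar>"]) (use ct_sl_single[OF n, of e _ c] in auto)
next
  case (add p q)
  then obtain M M' where MM':
    "\<forall>N\<ge>M. ct {1..<n} (sl n p) = (\<Sum>k\<in>{- int N..int N}. ct {1..n} (en {1..n} (- k) * p))"
    "\<forall>N\<ge>M'. ct {1..<n} (sl n q) = (\<Sum>k\<in>{- int N..int N}. ct {1..n} (en {1..n} (- k) * q))"
    by blast
  then show ?case
  proof (intro exI[of _ "max M M'"] allI impI)
    fix N assume "max M M' \<le> N"
    then have "ct {1..<n} (sl n p) = (\<Sum>k\<in>{- int N..int N}. ct {1..n} (en {1..n} (- k) * p))"
      "ct {1..<n} (sl n q) = (\<Sum>k\<in>{- int N..int N}. ct {1..n} (en {1..n} (- k) * q))"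
      using MM' by auto
    then show "ct {1..<n} (sl n (p + q)) = (\<Sum>k\<in>{- int N..int N}. ct {1..n} (en {1..n} (- k) * (p + q)))"
      by (simp only: msub_add ct_add ring_distribs sum.distrib)
  qed
qed auto

definition yl :: lpoly where "yl = mon (Poly_Mapping.single 0 1)"

lemma yl_supp: "0 \<notin> A \<Longrightarrow> supp_in (zero_on A) (scal c * yl)"
  unfolding yl_def
  by (intro supp_in_scal_mult supp_in_mon) (auto simp: zero_on_def lookup_one when_def intro!: gr0I)

lemma sl_xv: "i \<in> {1..n} \<Longrightarrow> sl n (xv i) = mon (xsub n i)"
  by (simp add: xv_def msub_mon slphi_single)

lemma sl_rt: "i \<in> {1..n} \<Longrightarrow> j \<in> {1..n} \<Longrightarrow> sl n (rt i j) = mon (xsub n i - xsub n j)"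
  by (simp add: rt_def msub_mon slphi_diff slphi_single)

lemma sl_yl: "sl n yl = yl"
  by (simp add: yl_def msub_mon slphi_free zero_on_def lookup_one)

text \<open>The function F of the theorem at z = q^K and a numerical s, with \<open>f\<close> in
  place of the power sum.\<close>

definition F1num :: "nat \<Rightarrow> nat \<Rightarrow> complex \<Rightarrow> lpoly \<Rightarrow> lpoly" where
  "F1num n K s f = (\<Prod>(i, j)\<in>offd {1..n}. fin_qpoch (mon (xsub n i - xsub n j)) (s ^ 2) K) * f *
     (\<Prod>i\<in>{1..n}. fin_qpoch (scal s * yl * mon (xsub n i)) (s ^ 2) K)"

lemma F1num_sl:
  "F1num n K s (sl n f) = sl n (Delta {1..n} (s ^ 2) K * f * wt {1..n} (scal s * yl) (s ^ 2) K)"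
proof -
  note c = mchar_slphi[of n]
  have "sl n (Delta {1..n} (s ^ 2) K) = (\<Prod>x\<in>offd {1..n}. sl n (case x of (i, j) \<Rightarrow> fin_qpoch (rt i j) (s ^ 2) K))"
    by (simp add: Delta_def msub_prod[OF c])
  also have "\<dots> = (\<Prod>(i, j)\<in>offd {1..n}. fin_qpoch (mon (xsub n i - xsub n j)) (s ^ 2) K)"
    by (rule prod.cong) (auto simp: offd_def msub_fin_qpoch[OF c] sl_rt)
  finally have 1: "sl n (Delta {1..n} (s ^ 2) K) = \<dots>" .
  have "sl n (wt {1..n} (scal s * yl) (s ^ 2) K) = (\<Prod>i\<in>{1..n}. fin_qpoch (scal s * yl * mon (xsub n i)) (s ^ 2) K)"
    unfolding wt_def msub_prod[OF c]
    by (rule prod.cong) (auto simp: msub_fin_qpoch[OF c] msub_mult[OF c] c sl_xv sl_yl)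
  with 1 show ?thesis by (simp add: F1num_def msub_mult[OF c])
qed

text \<open>The vanishing for k < 0 and k > K replaces the range of unspecified length from
  \<open>ct_sl\<close> by 0, ..., K.\<close>

lemma ct_F1num:
  assumes n: "n \<ge> 1"
    and neg: "\<And>k. k < 0 \<Longrightarrow> bracket {1..n} (s ^ 2) K K (scal s * yl) k f = 0"
    and big: "\<And>k. k > K \<Longrightarrow> bracket {1..n} (s ^ 2) K K (scal s * yl) (int k) f = 0"
  shows "ct {1..<n} (F1num n K s (sl n f)) = (\<Sum>k\<le>K. bracket {1..n} (s ^ 2) K K (scal s * yl) (int k) f)"
proof -
  let ?b = "\<lambda>k. bracket {1..n} (s ^ 2) K K (scal s * yl) k f"
  obtain M where M: "\<forall>N\<ge>M. ct {1..<n} (F1num n K s (sl n f)) = (\<Sum>k\<in>{- int N..int N}. ?b k)"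
    using ct_sl[OF n, of "Delta {1..n} (s ^ 2) K * f * wt {1..n} (scal s * yl) (s ^ 2) K"]
    unfolding F1num_sl bracket_def by (auto simp: mult_ac)
  define N where "N = max M K"
  have "ct {1..<n} (F1num n K s (sl n f)) = (\<Sum>k\<in>{- int N..int N}. ?b k)"
    using M by (simp add: N_def)
  also have "\<dots> = (\<Sum>k\<in>int ` {..K}. ?b k)"
  proof (rule sum.mono_neutral_right)
    show "\<forall>k\<in>{- int N..int N} - int ` {..K}. ?b k = 0"
    proof
      fix k assume k: "k \<in> {- int N..int N} - int ` {..K}"
      show "?b k = 0"
      proof (cases "k < 0")
        case False
        then obtain m where m: "k = int m" using zero_le_imp_eq_int by force
        with k have "m > K" by (metis DiffD2 atMost_iff imageI not_le)
        then show ?thesis unfolding m by (rule big)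
      qed (rule neg)
    qed
  qed (auto simp: N_def)
  also have "\<dots> = (\<Sum>k\<le>K. ?b (int k))"
    by (simp add: sum.reindex)
  finally show ?thesis .
qed

lemma ct_F1num_cases:
  assumes q: "nonroot (s ^ 2)" and s: "s \<noteq> 0" and K: "K \<ge> 1" and n: "n \<ge> 2"
  shows "ct {1..<n} (F1num n K s (of_nat n)) = of_nat n * (\<Sum>k\<le>K. bracket {1..n} (s ^ 2) K K (scal s * yl) (int k) 1)"
    and "ct {1..<n} (F1num n K s (\<Sum>i\<in>{1..n}. mon (xsub n i))) =
      (\<Sum>k\<le>K. bracket {1..n} (s ^ 2) K K (scal s * yl) (int k) (\<Sum>i\<in>{1..n}. xv i))"
proof -
  let ?A = "{1..n}" and ?u = "scal s * yl"
  have A: "finite ?A" "?A \<noteq> {}" "card ?A = n" using n by auto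
  have u: "supp_in (zero_on ?A) ?u" by (rule yl_supp) simp
  have u0: "?u \<noteq> 0" using s by (simp add: yl_def)
  have e1: "(\<Sum>i\<in>?A. xv i) = coeff (vpoly xv ?A) (n - 1)"
    using coeff_vpoly_pred[OF A(1,2), of xv] by (simp add: A(3))
  have big: "bracket ?A (s ^ 2) K K ?u (int k) (coeff (vpoly xv ?A) p) = 0" if "k > K" "1 \<le> p" "p \<le> n" for k p
  proof -
    have "k = Suc (K + (k - Suc K))" using that by simp
    then show ?thesis using bracket_big[OF q K A(1,2) u, of p "k - Suc K"] that A(3) by simp
  qed
  have "ct {1..<n} (F1num n K s (sl n 1)) = (\<Sum>k\<le>K. bracket ?A (s ^ 2) K K ?u (int k) 1)"
  proof (rule ct_F1num)
    show "bracket ?A (s ^ 2) K K ?u k 1 = 0" if "k < 0" for k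
      by (rule bracket_neg_1[OF q K A(1,2) u u0 that])
    show "bracket ?A (s ^ 2) K K ?u (int k) 1 = 0" if "k > K" for k
      using big[OF that, of n] n bracket_top[OF A(1), of "s ^ 2" K K ?u "int k"] by (simp add: A(3))
  qed (use n in auto)
  moreover have "F1num n K s (of_nat n) = of_nat n * F1num n K s (sl n 1)"
    using mchar_slphi[of n] by (simp add: F1num_def mult_ac)
  ultimately show "ct {1..<n} (F1num n K s (of_nat n)) = of_nat n * (\<Sum>k\<le>K. bracket ?A (s ^ 2) K K ?u (int k) 1)"
    by (simp only: ct_of_nat_mult)
  have "ct {1..<n} (F1num n K s (sl n (\<Sum>i\<in>?A. xv i))) = (\<Sum>k\<le>K. bracket ?A (s ^ 2) K K ?u (int k) (\<Sum>i\<in>?A. xv i))"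
  proof (rule ct_F1num)
    show "bracket ?A (s ^ 2) K K ?u k (\<Sum>i\<in>?A. xv i) = 0" if "k < 0" for k
      unfolding e1 using bracket_neg[OF q K A(1,2) u u0, of "n - 1" "nat (- k)"] that n A(3) by simp
    show "bracket ?A (s ^ 2) K K ?u (int k) (\<Sum>i\<in>?A. xv i) = 0" if "k > K" for k
      unfolding e1 by (rule big[OF that]) (use n in auto)
  qed (use n in auto)
  moreover have "sl n (\<Sum>i\<in>?A. xv i) = (\<Sum>i\<in>?A. mon (xsub n i))"
    by (simp add: msub_sum sl_xv)
  ultimately show "ct {1..<n} (F1num n K s (\<Sum>i\<in>?A. mon (xsub n i))) =
      (\<Sum>k\<le>K. bracket ?A (s ^ 2) K K ?u (int k) (\<Sum>i\<in>?A. xv i))"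
    by simp
qed

section \<open>Specialising z to a power of q\<close>

text \<open>The substitution \<open>z = s^c\<close>; since \<open>s = q^(1/2)\<close>, the case \<open>c = 2K\<close> is \<open>z = q^K\<close>.\<close>

definition spec :: "nat \<Rightarrow> ser \<Rightarrow> lpoly fps" where
  "spec c F = Abs_fps (\<lambda>N. \<Sum>(a, b)\<in>{(a, b). a + c * b = N}. fps_nth (fps_nth F a) b)"

lemma finite_spec_index: "c > 0 \<Longrightarrow> finite {(a, b). a + c * b = (N::nat)}"
proof (rule finite_subset)
  assume c: "c > 0"
  show "{(a, b). a + c * b = N} \<subseteq> {..N} \<times> {..N}"
  proof clarify
    fix a b
    have "b \<le> c * b" using c by (cases c) auto
    then show "a \<in> {..a + c * b} \<and> b \<in> {..a + c * b}" by (simp add: trans_le_add2)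
  qed
qed auto

lemma spec_nth: "fps_nth (spec c F) N = (\<Sum>(a, b)\<in>{(a, b). a + c * b = N}. fps_nth (fps_nth F a) b)"
  by (simp add: spec_def)

lemma spec_add: "spec c (F + G) = spec c F + spec c G"
  by (rule fps_ext) (simp add: spec_nth case_prod_unfold sum.distrib)

lemma spec_uminus: "spec c (- F) = - spec c F"
  by (rule fps_ext) (simp add: spec_nth case_prod_unfold sum_negf)

lemma spec_diff: "spec c (F - G) = spec c F - spec c G"
  using spec_add[of c F "- G"] by (simp add: spec_uminus)

lemma spec_sum: "spec c (sum f A) = (\<Sum>i\<in>A. spec c (f i))"
proof (induction A rule: infinite_finite_induct)
  case empty
  show ?case by (rule fps_ext) (simp add: spec_nth)
next
  case (infinite A)
  then show ?case by (intro fps_ext) (simp add: spec_nth)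
qed (simp add: spec_add)

lemma spec_mult:
  assumes c: "c > 0"
  shows "spec c (F * G) = spec c F * spec c G"
proof (rule fps_ext)
  fix N
  let ?I = "\<lambda>N. {(a, b). a + c * b = N}"
  note fin = finite_spec_index[OF c]
  let ?f = "\<lambda>a b. fps_nth (fps_nth F a) b" and ?g = "\<lambda>a b. fps_nth (fps_nth G a) b"
  have "fps_nth (spec c (F * G)) N = (\<Sum>(a, b)\<in>?I N. \<Sum>i=0..a. \<Sum>j=0..b. ?f i j * ?g (a - i) (b - j))"
    by (simp add: spec_nth fps_mult_nth fps_sum_nth)
  also have "\<dots> = (\<Sum>p\<in>?I N. \<Sum>r\<in>{0..fst p} \<times> {0..snd p}. ?f (fst r) (snd r) * ?g (fst p - fst r) (snd p - snd r))"
    by (simp add: case_prod_unfold sum.cartesian_product)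
  also have "\<dots> = (\<Sum>(p, r)\<in>(SIGMA p:?I N. {0..fst p} \<times> {0..snd p}). ?f (fst r) (snd r) * ?g (fst p - fst r) (snd p - snd r))"
    by (rule sum.Sigma) (use fin in auto)
  \<comment> \<open>An index p of the product together with a smaller index r of the first factor is
    regrouped by the total degree m of r; the complement p - r then has degree N - m.\<close>
  also have "\<dots> = (\<Sum>(m, x)\<in>(SIGMA m:{0..N}. ?I m \<times> ?I (N - m)). ?f (fst (fst x)) (snd (fst x)) * ?g (fst (snd x)) (snd (snd x)))"
  proof (rule sum.reindex_bij_witness[where
        i = "\<lambda>(m, x). ((fst (fst x) + fst (snd x), snd (fst x) + snd (snd x)), fst x)" and
        j = "\<lambda>(p, r). (fst r + c * snd r, (r, (fst p - fst r, snd p - snd r)))"], goal_cases)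
    case (2 y)
    then obtain i j a' b' where y: "y = ((i + a', j + b'), (i, j))" "N = (i + a') + c * (j + b')"
      by (auto simp: le_iff_add)
    have "N - (i + c * j) = a' + c * b'" using y by (simp add: distrib_left)
    then show ?case using y by (simp add: distrib_left)
  qed (auto simp: algebra_simps)
  also have "\<dots> = (\<Sum>m=0..N. \<Sum>x\<in>?I m \<times> ?I (N - m). ?f (fst (fst x)) (snd (fst x)) * ?g (fst (snd x)) (snd (snd x)))"
    by (rule sum.Sigma[symmetric]) (use fin in auto)
  also have "\<dots> = (\<Sum>m=0..N. (\<Sum>p\<in>?I m. ?f (fst p) (snd p)) * (\<Sum>r\<in>?I (N - m). ?g (fst r) (snd r)))"
    by (simp add: sum_product sum.cartesian_product case_prod_unfold)
  also have "\<dots> = fps_nth (spec c F * spec c G) N"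
    by (simp add: fps_mult_nth spec_nth case_prod_unfold)
  finally show "fps_nth (spec c (F * G)) N = fps_nth (spec c F * spec c G) N" .
qed

lemma spec_const:
  assumes c: "c > 0"
  shows "spec c (fps_const (fps_const p)) = fps_const p"
proof (rule fps_ext)
  fix N
  show "fps_nth (spec c (fps_const (fps_const p))) N = fps_nth (fps_const p) N"
  proof (cases "N = 0")
    case True
    have "{(a, b). a + c * b = (0::nat)} = {(0, 0)}" using c by auto
    then show ?thesis using True by (simp add: spec_nth)
  next
    case False
    then have "fps_nth (fps_nth (fps_const (fps_const p)) a) b = 0" if "a + c * b = N" for a b
      using that by (cases "a = 0"; cases "b = 0") auto
    then show ?thesis using False by (auto simp: spec_nth intro!: sum.neutral)
  qed
qed

lemma spec_1: "c > 0 \<Longrightarrow> spec c 1 = 1"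
  using spec_const[of c 1] by simp

lemma spec_prod: "c > 0 \<Longrightarrow> spec c (prod f A) = (\<Prod>i\<in>A. spec c (f i))"
  by (induction A rule: infinite_finite_induct) (simp_all add: spec_mult spec_1)

lemma spec_power: "c > 0 \<Longrightarrow> spec c (F ^ n) = spec c F ^ n"
  by (induction n) (simp_all add: spec_mult spec_1)

lemma spec_cst: "c > 0 \<Longrightarrow> spec c (cst p) = fps_const p"
  by (simp add: cst_def spec_const)

lemma spec_of_nat: "c > 0 \<Longrightarrow> spec c (of_nat n) = of_nat n"
  by (induction n) (simp_all add: spec_add spec_1, metis spec_const fps_const_0_eq_0)

lemma spec_sS:
  assumes c: "c > 0"
  shows "spec c sS = fps_X"
proof (rule fps_ext)
  fix N
  show "fps_nth (spec c sS) N = fps_nth fps_X N"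
  proof (cases "N = 1")
    case True
    have "fps_nth (fps_nth (fps_X :: ser) (fst x)) (snd x) = 0" if "x \<in> {(a, b). a + c * b = 1} - {(1, 0)}" for x
      using that c by (cases "fst x = 1"; cases x) auto
    then have "(\<Sum>x\<in>{(a, b). a + c * b = 1}. fps_nth (fps_nth (fps_X :: ser) (fst x)) (snd x))
        = (\<Sum>x\<in>{(1, 0)}. fps_nth (fps_nth (fps_X :: ser) (fst x)) (snd x))"
      using finite_spec_index[OF c] by (intro sum.mono_neutral_right ballI) auto
    then show ?thesis using True by (simp add: spec_nth sS_def case_prod_unfold)
  next
    case False
    then have "fps_nth (fps_nth (fps_X :: ser) a) b = 0" if "a + c * b = N" for a b
      using that by (cases "a = 1"; cases "b = 0") auto
    then show ?thesis using False by (auto simp: spec_nth sS_def intro!: sum.neutral)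
  qed
qed

lemma spec_zS:
  assumes c: "c > 0"
  shows "spec c zS = fps_X ^ c"
proof (rule fps_ext)
  fix N
  show "fps_nth (spec c zS) N = fps_nth (fps_X ^ c) N"
  proof (cases "N = c")
    case True
    have "fps_nth (fps_nth zS (fst x)) (snd x) = 0" if "x \<in> {(a, b). a + c * b = c} - {(0, 1)}" for x
      using that c by (cases "fst x = 0"; cases "snd x = 1"; cases x) (auto simp: zS_def)
    then have "(\<Sum>x\<in>{(a, b). a + c * b = c}. fps_nth (fps_nth zS (fst x)) (snd x))
        = (\<Sum>x\<in>{(0, 1)}. fps_nth (fps_nth zS (fst x)) (snd x))"
      using finite_spec_index[OF c] by (intro sum.mono_neutral_right ballI) auto
    then show ?thesis using True by (simp add: spec_nth zS_def case_prod_unfold)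
  next
    case False
    then have "fps_nth (fps_nth zS a) b = 0" if "a + c * b = N" for a b
      using that by (cases "a = 0"; cases "b = 1") (auto simp: zS_def)
    then show ?thesis using False by (auto simp: spec_nth intro!: sum.neutral)
  qed
qed

lemma spec_qS: "c > 0 \<Longrightarrow> spec c qS = fps_X ^ 2"
  by (simp add: qS_def spec_power spec_sS)

text \<open>The quotient is read off the recursion \<open>F a (b + 1) = G a b - G (a - c) (b + 1)\<close>;
  the vanishing of \<open>F\<close> at \<open>z = s^c\<close> is its consistency for the coefficients of \<open>z^0\<close>.\<close>

lemma spec_eq_0_imp_dvd:
  assumes c: "c > 0" and F: "spec c F = 0"
  shows "\<exists>G. F = (zS - sS ^ c) * G"
proof -
  \<comment> \<open>Unfolding the recursion for the quotient along a, a - c, a - 2c, ... leaves a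
    finite sum.\<close>
  define g where "g = (\<lambda>a b. \<Sum>j | c * j \<le> a. fps_nth (fps_nth F (a - c * j)) (b + 1 + j))"
  define G :: ser where "G = Abs_fps (\<lambda>a. Abs_fps (\<lambda>b. g a b))"
  have fin: "finite {j. c * j \<le> a}" for a
  proof (rule finite_subset)
    show "{j. c * j \<le> a} \<subseteq> {..a}"
    proof
      fix j assume "j \<in> {j. c * j \<le> a}"
      then have j: "c * j \<le> a" by simp
      have "j \<le> c * j" using c by (cases c) auto
      from order.trans[OF this j] show "j \<in> {..a}" by simp
    qed
  qed auto
  have rec: "g a b = fps_nth (fps_nth F a) (b + 1) + (if c \<le> a then g (a - c) (b + 1) else 0)" for a b
  proof -
    have "{j. c * j \<le> a} = insert 0 {j. c * j \<le> a \<and> j > 0}" by auto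
    then have "g a b = fps_nth (fps_nth F a) (b + 1) + (\<Sum>j | c * j \<le> a \<and> j > 0. fps_nth (fps_nth F (a - c * j)) (b + 1 + j))"
      unfolding g_def using fin[of a] by simp
    also have "(\<Sum>j | c * j \<le> a \<and> j > 0. fps_nth (fps_nth F (a - c * j)) (b + 1 + j)) = (if c \<le> a then g (a - c) (b + 1) else 0)"
    proof (cases "c \<le> a")
      case True
      have "(\<Sum>j | c * j \<le> a \<and> j > 0. fps_nth (fps_nth F (a - c * j)) (b + 1 + j)) = g (a - c) (b + 1)"
        unfolding g_def
      proof (rule sum.reindex_bij_witness[where i = Suc and j = "\<lambda>j. j - 1"])
        fix j assume "j \<in> {j. c * j \<le> a \<and> j > 0}"
        then show "j - 1 \<in> {j. c * j \<le> a - c}"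
          by (cases j) auto
      qed (use True in \<open>auto simp: gr0_conv_Suc\<close>)
      then show ?thesis using True by simp
    next
      case False
      have "{j. c * j \<le> a \<and> j > 0} = {}"
        using False by (auto simp: gr0_conv_Suc)
      with False show ?thesis by (simp only: sum.empty if_False)
    qed
    finally show ?thesis .
  qed
  \<comment> \<open>For z^0 there is no coefficient of the quotient left to choose: the sum that
    must vanish is the coefficient of s^a in F at z = s^c.\<close>
  have 0: "fps_nth (fps_nth F a) 0 + (if c \<le> a then g (a - c) 0 else 0) = 0" for a
  proof -
    have "fps_nth (fps_nth F a) 0 + (if c \<le> a then g (a - c) 0 else 0) = (\<Sum>j | c * j \<le> a. fps_nth (fps_nth F (a - c * j)) j)"
    proof -
      have "{j. c * j \<le> a} = insert 0 {j. c * j \<le> a \<and> j > 0}" by auto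
      then have "(\<Sum>j | c * j \<le> a. fps_nth (fps_nth F (a - c * j)) j) = fps_nth (fps_nth F a) 0 + (\<Sum>j | c * j \<le> a \<and> j > 0. fps_nth (fps_nth F (a - c * j)) j)"
        using fin[of a] by simp
      moreover have "(\<Sum>j | c * j \<le> a \<and> j > 0. fps_nth (fps_nth F (a - c * j)) j) = (if c \<le> a then g (a - c) 0 else 0)"
      proof (cases "c \<le> a")
        case True
        have "(\<Sum>j | c * j \<le> a \<and> j > 0. fps_nth (fps_nth F (a - c * j)) j) = g (a - c) 0"
          unfolding g_def
        proof (rule sum.reindex_bij_witness[where i = Suc and j = "\<lambda>j. j - 1"])
          fix j assume "j \<in> {j. c * j \<le> a \<and> j > 0}"
          then show "j - 1 \<in> {j. c * j \<le> a - c}"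
            by (cases j) auto
        qed (use True in \<open>auto simp: gr0_conv_Suc\<close>)
        then show ?thesis using True by simp
      next
        case False
        have "{j. c * j \<le> a \<and> j > 0} = {}"
          using False by (auto simp: gr0_conv_Suc)
        with False show ?thesis by (simp only: sum.empty if_False)
      qed
      ultimately show ?thesis by simp
    qed
    also have "\<dots> = (\<Sum>x\<in>{(i, j). i + c * j = a}. fps_nth (fps_nth F (fst x)) (snd x))"
      by (rule sum.reindex_bij_witness[where i = snd and j = "\<lambda>j. (a - c * j, j)"]) auto
    also have "\<dots> = fps_nth (spec c F) a" by (simp add: spec_nth case_prod_unfold)
    finally show ?thesis using F by simp
  qed
  have "F = zS * G - sS ^ c * G"
  proof (rule fps_ext, rule fps_ext)
    fix a b
    have "fps_nth (fps_nth (zS * G) a) b = (if b = 0 then 0 else g a (b - 1))"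
      by (cases b) (simp_all add: zS_def G_def)
    moreover have "fps_nth (fps_nth (sS ^ c * G) a) b = (if c \<le> a then g (a - c) b else 0)"
      by (simp add: sS_def G_def fps_X_power_mult_nth)
    ultimately show "fps_nth (fps_nth F a) b = fps_nth (fps_nth (zS * G - sS ^ c * G) a) b"
      using 0[of a] rec[of a "b - 1"] by (cases "b = 0") (auto simp: eq_neg_iff_add_eq_0 split: if_splits)
  qed
  then show ?thesis by (auto simp: algebra_simps)
qed

text \<open>Splitting off factors \<open>z - s^c\<close> one after the other makes the order in \<open>z\<close> of \<open>F\<close> at
  \<open>s = 0\<close> arbitrarily large.\<close>

lemma spec_all_0_aux:
  assumes "infinite S" "\<And>c. c \<in> S \<Longrightarrow> c > 0 \<and> spec c F = 0"
  shows "fps_nth (fps_nth F 0) b = 0"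
  using assms
proof (induction b arbitrary: F S rule: less_induct)
  case (less b)
  obtain c where c: "c \<in> S" using less.prems(1) by (metis finite.emptyI ex_in_conv)
  then have c0: "c > 0" and Fc: "spec c F = 0" using less.prems(2) by auto
  obtain G where G: "F = (zS - sS ^ c) * G" using spec_eq_0_imp_dvd[OF c0 Fc] by blast
  \<comment> \<open>At another point d of \<open>S\<close> the factor z - s^c becomes s^d - s^c
    \<noteq> 0, so G inherits the zero.\<close>
  have Gc: "spec d G = 0" if "d \<in> S - {c}" for d
  proof -
    have d: "d > 0" "spec d F = 0" "d \<noteq> c" using that less.prems(2) by auto
    have "(fps_X ^ d - fps_X ^ c) * spec d G = (0 :: lpoly fps)"
      using d unfolding G by (simp add: spec_mult spec_diff spec_zS spec_sS spec_power)
    moreover have "fps_X ^ d \<noteq> (fps_X ^ c :: lpoly fps)"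
    proof
      assume "fps_X ^ d = (fps_X ^ c :: lpoly fps)"
      then have "fps_nth (fps_X ^ d :: lpoly fps) d = fps_nth (fps_X ^ c) d" by simp
      then show False using d by simp
    qed
    ultimately show ?thesis by simp
  qed
  \<comment> \<open>Since c > 0, the factor z - s^c is just z at s = 0, and b drops by one.\<close>
  have "fps_nth (fps_nth F 0) b = (if b = 0 then 0 else fps_nth (fps_nth G 0) (b - 1))"
    using c0 unfolding G by (cases b) (simp_all add: fps_mult_nth_0 zS_def sS_def left_diff_distrib)
  moreover have "fps_nth (fps_nth G 0) (b - 1) = 0" if "b \<noteq> 0"
    by (rule less.IH[of "b - 1" "S - {c}"]) (use that less.prems Gc in auto)
  ultimately show ?case by simp
qed

text \<open>Once the coefficient of s^0 is known to vanish, s can be split off; it stays nonzero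
  under every specialisation, so the remaining factor has the same zeros.\<close>

theorem spec_all_0:
  assumes "infinite S" "\<And>c. c \<in> S \<Longrightarrow> c > 0 \<and> spec c F = 0"
  shows "F = 0"
proof -
  have "fps_nth F a = 0" for a
    using assms(2)
  proof (induction a arbitrary: F)
    case 0
    then show ?case using spec_all_0_aux[OF assms(1), of F] by (intro fps_ext) auto
  next
    case (Suc a)
    have F0: "fps_nth F 0 = 0"
      using spec_all_0_aux[OF assms(1), of F] Suc.prems by (intro fps_ext) auto
    define G where "G = fps_shift 1 F"
    have G: "F = sS * G"
      unfolding G_def sS_def by (rule fps_ext) (use F0 in \<open>auto simp: fps_X_mult_nth\<close>)
    have "c > 0 \<and> spec c G = 0" if "c \<in> S" for c
      using Suc.prems[OF that] unfolding G by (auto simp: spec_mult spec_sS)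
    then have "fps_nth G a = 0" by (rule Suc.IH)
    then show ?case by (simp add: G_def)
  qed
  then show ?thesis by (intro fps_ext) simp
qed

section \<open>Limits and quotients under the specialisation\<close>

lemma fps_LIMSEQ_stable:
  fixes f :: "nat \<Rightarrow> 'a::comm_ring_1 fps"
  assumes "\<And>m N. m < N \<Longrightarrow> fps_nth (f N) m = fps_nth L m"
  shows "f \<longlonglongrightarrow> L"
proof (rule tendsto_fpsI)
  fix m
  show "eventually (\<lambda>N. fps_nth (f N) m = fps_nth L m) sequentially"
    using eventually_gt_at_top[of m] by eventually_elim (rule assms)
qed

text \<open>The factor with index k affects only the coefficients of s^(2k) and beyond.\<close>

lemma qpoch_partial_stable:
  assumes "m < N" "N \<le> N'"
  shows "fps_nth (\<Prod>k<N'. 1 - a * qS ^ k) m = fps_nth (\<Prod>k<N. 1 - a * qS ^ k) m"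
  using assms(2)
proof (induction N' rule: dec_induct)
  case (step N')
  define P where "P = (\<Prod>k<N'. 1 - a * qS ^ k)"
  have "fps_nth (P * a * qS ^ N') m = 0"
    using assms(1) step(1) by (simp add: qS_def sS_def fps_X_power_mult_right_nth flip: power_mult)
  then show ?case using step by (simp add: P_def algebra_simps)
qed simp

lemma qpoch_inf_nth:
  assumes "m < N"
  shows "fps_nth (qpoch_inf a) m = fps_nth (\<Prod>k<N. 1 - a * qS ^ k) m"
proof -
  define L where "L = Abs_fps (\<lambda>m. fps_nth (\<Prod>k<Suc m. 1 - a * qS ^ k) m)"
  have L: "fps_nth (\<Prod>k<N. 1 - a * qS ^ k) m = fps_nth L m" if "m < N" for m N
    unfolding L_def fps_nth_Abs_fps by (rule qpoch_partial_stable) (use that in auto)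
  then have "(\<lambda>N. \<Prod>k<N. 1 - a * qS ^ k) \<longlonglongrightarrow> L"
    by (rule fps_LIMSEQ_stable)
  then have "qpoch_inf a = L" unfolding qpoch_inf_def by (rule limI)
  then show ?thesis using L[OF assms] by simp
qed

lemma fps_mult_nth_cong:
  assumes "\<And>m. m \<le> N \<Longrightarrow> fps_nth F m = fps_nth F' m" "\<And>m. m \<le> N \<Longrightarrow> fps_nth G m = fps_nth G' m"
  shows "fps_nth (F * G) N = fps_nth (F' * G') N"
  unfolding fps_mult_nth by (rule sum.cong) (auto simp: assms)

lemma qpoch_inf_split: "qpoch_inf a = (\<Prod>k<K. 1 - a * qS ^ k) * qpoch_inf (a * qS ^ K)"
proof (rule fps_ext)
  fix m
  have "fps_nth ((\<Prod>k<K. 1 - a * qS ^ k) * qpoch_inf (a * qS ^ K)) m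
     = fps_nth ((\<Prod>k<K. 1 - a * qS ^ k) * (\<Prod>k<Suc m. 1 - a * qS ^ K * qS ^ k)) m"
    by (rule fps_mult_nth_cong, rule refl, rule qpoch_inf_nth) simp
  also have "(\<Prod>k<K. 1 - a * qS ^ k) * (\<Prod>k<M. 1 - a * qS ^ K * qS ^ k) = (\<Prod>k<K + M. 1 - a * qS ^ k)" for M
    by (induction M) (simp_all add: power_add mult_ac)
  also have "fps_nth (\<Prod>k<K + Suc m. 1 - a * qS ^ k) m = fps_nth (qpoch_inf a) m"
    by (rule qpoch_inf_nth[symmetric]) simp
  finally show "fps_nth (qpoch_inf a) m = fps_nth ((\<Prod>k<K. 1 - a * qS ^ k) * qpoch_inf (a * qS ^ K)) m" ..
qed

lemma spec_nth_cong:
  assumes "\<And>a. a \<le> N \<Longrightarrow> fps_nth F a = fps_nth G a"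
  shows "fps_nth (spec c F) N = fps_nth (spec c G) N"
  unfolding spec_nth by (rule sum.cong) (use assms in auto)

text \<open>Up to s^m only finitely many factors matter, so the specialisation commutes with the
  infinite product and sees only the specialised argument.\<close>

lemma spec_qpoch_inf_cong:
  assumes c: "c > 0" and "spec c a = spec c b"
  shows "spec c (qpoch_inf a) = spec c (qpoch_inf b)"
proof (rule fps_ext)
  fix m
  have "fps_nth (spec c (qpoch_inf d)) m = fps_nth (\<Prod>k<Suc m. 1 - spec c d * (fps_X ^ 2) ^ k) m" for d
  proof -
    have "fps_nth (spec c (qpoch_inf d)) m = fps_nth (spec c (\<Prod>k<Suc m. 1 - d * qS ^ k)) m"
      by (rule spec_nth_cong, rule qpoch_inf_nth) simp
    then show ?thesis
      by (simp only: spec_prod[OF c] spec_diff spec_1[OF c] spec_mult[OF c] spec_power[OF c] spec_qS[OF c])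
  qed
  then show "fps_nth (spec c (qpoch_inf a)) m = fps_nth (spec c (qpoch_inf b)) m"
    by (simp only: assms(2))
qed

text \<open>Series with constant term 1 are units, so that \<open>sdiv\<close> by them is not a junk value.\<close>

definition c00 :: "ser \<Rightarrow> lpoly" where
  "c00 F = fps_nth (fps_nth F 0) 0"

lemma c00_simps [simp]:
  "c00 1 = 1" "c00 zS = 0" "c00 sS = 0" "c00 qS = 0"
  "c00 (F * G) = c00 F * c00 G" "c00 (F - G) = c00 F - c00 G"
  by (simp_all add: c00_def zS_def sS_def qS_def fps_mult_nth_0)

lemma c00_power [simp]: "c00 (F ^ n) = c00 F ^ n"
  by (induction n) simp_all

lemma c00_prod [simp]: "c00 (prod f A) = (\<Prod>i\<in>A. c00 (f i))"
  by (induction A rule: infinite_finite_induct) simp_all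

lemma c00_qpoch_inf [simp]: "c00 (qpoch_inf a) = 1 - c00 a"
  using qpoch_inf_nth[of 0 1 a] by (simp add: c00_def)

lemma c00_unit:
  assumes "c00 F = 1"
  obtains G where "F * G = 1"
proof -
  have "fps_nth F 0 * fps_right_inverse (fps_nth F 0) 1 = 1"
    by (rule fps_right_inverse) (use assms in \<open>simp add: c00_def\<close>)
  then have "F * fps_right_inverse F (fps_right_inverse (fps_nth F 0) 1) = 1"
    by (rule fps_right_inverse)
  then show ?thesis using that by blast
qed

lemma sdiv_eqI: "b \<noteq> 0 \<Longrightarrow> a = b * c \<Longrightarrow> sdiv a b = c"
  unfolding sdiv_def by (rule the_equality) auto

lemma mult_sdiv:
  assumes "c00 b = 1"
  shows "b * sdiv a b = a"
proof -
  obtain g where g: "b * g = 1" using assms by (rule c00_unit)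
  then have "sdiv a b = a * g"
    by (intro sdiv_eqI) (auto simp: mult_ac)
  then show ?thesis using g by (simp add: mult_ac)
qed

lemma c00_neq_0: "c00 b = 1 \<Longrightarrow> b \<noteq> 0"
  by (auto simp: c00_def)

lemma sdiv_mult_left: "c00 b = 1 \<Longrightarrow> sdiv (d * a) b = d * sdiv a b"
  by (intro sdiv_eqI c00_neq_0) (simp_all add: mult_sdiv mult.left_commute)

lemma sdiv_cancel: "c00 b = 1 \<Longrightarrow> d \<noteq> 0 \<Longrightarrow> sdiv (d * a) (d * b) = sdiv a b"
  by (rule sdiv_eqI) (auto simp: mult_sdiv c00_neq_0 mult.assoc)

lemma spec_unit:
  assumes c: "c > 0" and "c00 F = 1"
  shows "spec c F \<noteq> 0"
proof
  assume "spec c F = 0"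
  obtain G where "F * G = 1" using assms(2) by (rule c00_unit)
  then have "spec c F * spec c G = 1" using spec_mult[OF c, of F G] spec_1[OF c] by simp
  then show False using \<open>spec c F = 0\<close> by simp
qed

lemma spec_sdiv: "c > 0 \<Longrightarrow> c00 b = 1 \<Longrightarrow> spec c b * spec c (sdiv a b) = spec c a"
  by (simp add: mult_sdiv flip: spec_mult)

text \<open>(az; q)_\<infinity> and (a q^K; q)_\<infinity> agree at z = q^K, so the quotient is the
  finite product (a; q)_K.\<close>

lemma spec_qpoch_ratio:
  assumes K: "K \<ge> 1"
  shows "spec (2 * K) (sdiv (qpoch_inf a) (qpoch_inf (a * zS))) = (\<Prod>k<K. 1 - spec (2 * K) a * fps_X ^ (2 * k))"
proof -
  let ?c = "2 * K"
  have c: "?c > 0" using K by simp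
  have "spec ?c (a * zS) = spec ?c (a * qS ^ K)"
    by (simp add: spec_mult[OF c] spec_zS[OF c] spec_power[OF c] spec_qS[OF c] power_mult)
  then have e: "spec ?c (qpoch_inf (a * zS)) = spec ?c (qpoch_inf (a * qS ^ K))"
    by (rule spec_qpoch_inf_cong[OF c])
  have u: "c00 (qpoch_inf (a * zS)) = 1" by simp
  have "spec ?c (qpoch_inf (a * zS)) * spec ?c (sdiv (qpoch_inf a) (qpoch_inf (a * zS))) = spec ?c (qpoch_inf a)"
    by (rule spec_sdiv[OF c u])
  also have "\<dots> = spec ?c ((\<Prod>k<K. 1 - a * qS ^ k) * qpoch_inf (a * qS ^ K))"
    by (simp flip: qpoch_inf_split)
  also have "\<dots> = spec ?c (qpoch_inf (a * zS)) * (\<Prod>k<K. 1 - spec ?c a * fps_X ^ (2 * k))"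
  proof -
    have "spec ?c (1 - a * qS ^ k) = 1 - spec ?c a * fps_X ^ (2 * k)" for k
      by (simp only: spec_mult[OF c] spec_diff spec_1[OF c] spec_power[OF c] spec_qS[OF c] power_mult)
    then show ?thesis
      unfolding e spec_mult[OF c] spec_prod[OF c] by (simp only: mult.commute)
  qed
  finally show ?thesis using spec_unit[OF c u] by simp
qed

text \<open>Divisibility of \<open>f k\<close> by s^k makes the series converge s-adically and lets
  it be specialised term by term.\<close>

lemma spec_suminf:
  assumes c: "c > 0" and f: "\<And>k m. m < k \<Longrightarrow> fps_nth (f k) m = 0"
    and 0: "\<And>k. k > K \<Longrightarrow> spec c (f k) = 0"
  shows "spec c (suminf f) = (\<Sum>k\<le>K. spec c (f k))"
proof -
  define S where "S = Abs_fps (\<lambda>m. fps_nth (\<Sum>k<Suc m. f k) m)"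
  have S: "fps_nth (\<Sum>k<N. f k) m = fps_nth S m" if "m < N" for m N
  proof -
    have "(\<Sum>k<N. fps_nth (f k) m) = (\<Sum>k<Suc m. fps_nth (f k) m)"
      by (rule sum.mono_neutral_right) (use that f in auto)
    then show ?thesis by (simp add: S_def fps_sum_nth)
  qed
  then have "(\<lambda>N. \<Sum>k<N. f k) \<longlonglongrightarrow> S" by (rule fps_LIMSEQ_stable)
  then have "suminf f = S" using sums_unique[of f S] by (simp add: sums_def)
  have "spec c S = (\<Sum>k\<le>K. spec c (f k))"
  proof (rule fps_ext)
    fix N
    define M where "M = Suc (max N K)"
    have "fps_nth (spec c S) N = fps_nth (spec c (\<Sum>k<M. f k)) N"
      by (rule spec_nth_cong, rule S[symmetric]) (simp add: M_def)
    also have "spec c (\<Sum>k<M. f k) = (\<Sum>k<M. spec c (f k))" by (rule spec_sum)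
    also have "\<dots> = (\<Sum>k\<le>K. spec c (f k))"
      by (rule sum.mono_neutral_right) (auto simp: M_def 0)
    finally show "fps_nth (spec c S) N = fps_nth (\<Sum>k\<le>K. spec c (f k)) N" .
  qed
  then show ?thesis using \<open>suminf f = S\<close> by simp
qed

definition fct :: "nat set \<Rightarrow> lpoly fps \<Rightarrow> lpoly fps" where
  "fct A F = Abs_fps (\<lambda>N. ct A (fps_nth F N))"

lemma spec_ct_ser: "spec c (ct_ser n F) = fct {1..<n} (spec c F)"
  by (rule fps_ext) (simp add: spec_nth fct_def ct_ser_def ct_x_eq_ct ct_sum case_prod_unfold)

section \<open>From numbers to polynomials in \<open>s\<close>\<close>

text \<open>A nonzero polynomial over the domain of Laurent polynomials has only finitely many
  roots, and \<open>scal\<close> is injective. This is the passage from numerical q to formal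
  s.\<close>

lemma lpoly_poly_eqI:
  fixes P Q :: "lpoly poly"
  assumes "\<And>s::real. 0 < s \<Longrightarrow> s < 1 \<Longrightarrow> poly P (scal (of_real s)) = poly Q (scal (of_real s))"
  shows "P = Q"
proof (rule ccontr)
  assume "P \<noteq> Q"
  then have "finite {x. poly (P - Q) x = 0}" by (intro poly_roots_finite) simp
  moreover have "(\<lambda>s. scal (of_real s)) ` {0<..<1::real} \<subseteq> {x. poly (P - Q) x = 0}"
    using assms by auto
  ultimately have "finite ((\<lambda>s. scal (of_real s)) ` {0<..<1::real})" by (rule finite_subset[rotated])
  then have "finite {0<..<1::real}" by (rule finite_imageD) (auto simp: inj_on_def)
  then show False using infinite_Ioo[of 0 "1::real"] by simp
qed

lemma nonroot_real:
  assumes "0 < s" "s < (1::real)"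
  shows "nonroot ((of_real s) ^ 2)"
  unfolding nonroot_def
proof (intro conjI allI impI notI)
  fix m :: nat assume "m \<ge> 1" "(of_real s ^ 2) ^ m = (1::complex)"
  then have "of_real (s ^ (2 * m)) = (1::complex)" by (simp add: power_mult)
  then have "s ^ (2 * m) = 1" by (simp only: of_real_eq_1_iff)
  moreover have "s ^ (2 * m) < 1" using assms \<open>m \<ge> 1\<close> by (simp add: power_less_one_iff)
  ultimately show False by simp
qed (use assms in auto)

definition ctP :: "nat set \<Rightarrow> lpoly poly \<Rightarrow> lpoly poly" where
  "ctP A = map_poly (ct A)"

lemma poly_ctP: "poly (ctP A P) (scal s) = ct A (poly P (scal s))"
  by (induction P) (simp_all add: ctP_def map_poly_pCons ct_add ct_scal_mult)

lemma fct_fps_of_poly: "fct A (fps_of_poly P) = fps_of_poly (ctP A P)"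
  by (rule fps_ext) (simp add: fct_def ctP_def coeff_map_poly)

text \<open>The symbol (s^d a; q)_K with q = s^2 as a polynomial in s: d = 0 for a = x_i/x_j, d = 1
  for a = y x_i.\<close>

definition qpP :: "lpoly \<Rightarrow> nat \<Rightarrow> nat \<Rightarrow> lpoly poly" where
  "qpP a d K = (\<Prod>k<K. 1 - monom a (2 * k + d))"

lemma poly_qpP: "poly (qpP a d K) (scal s) = fin_qpoch (scal (s ^ d) * a) (s ^ 2) K"
proof -
  have "a * scal s ^ (2 * k + d) = scal ((s ^ 2) ^ k) * (scal (s ^ d) * a)" for k
  proof -
    have "scal s ^ (2 * k + d) = scal ((s ^ 2) ^ k) * scal (s ^ d)"
      by (simp only: scal_power power_add power_mult)
    then show ?thesis by (simp only: mult_ac)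
  qed
  then show ?thesis
    by (simp only: qpP_def fin_qpoch_def poly_prod poly_diff poly_1 poly_monom)
qed

lemma fps_of_poly_qpP: "fps_of_poly (qpP a d K) = (\<Prod>k<K. 1 - fps_const a * fps_X ^ (2 * k + d))"
  by (simp add: qpP_def fps_of_poly_prod fps_of_poly_diff fps_of_poly_monom)

text \<open>\<open>r\<close> and \<open>e\<close> stand for x_i/x_j and x_i, either with n free
  variables or on the hyperplane, so that both kinds of constant term have the same shape.\<close>

definition wP :: "nat \<Rightarrow> nat \<Rightarrow> (nat \<Rightarrow> nat \<Rightarrow> lpoly) \<Rightarrow> (nat \<Rightarrow> lpoly) \<Rightarrow> lpoly \<Rightarrow> lpoly poly" where
  "wP n K r e f = (\<Prod>(i, j)\<in>offd {1..n}. qpP (r i j) 0 K) * (\<Prod>i\<in>{1..n}. qpP (yl * e i) 1 K) * [:f:]"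

lemma poly_wP: "poly (wP n K r e f) (scal s) =
    (\<Prod>(i, j)\<in>offd {1..n}. fin_qpoch (r i j) (s ^ 2) K) * (\<Prod>i\<in>{1..n}. fin_qpoch (scal s * yl * e i) (s ^ 2) K) * f"
  by (simp add: wP_def poly_prod poly_qpP case_prod_unfold mult.assoc)

definition bP :: "nat \<Rightarrow> nat \<Rightarrow> int \<Rightarrow> lpoly \<Rightarrow> lpoly poly" where
  "bP n K k f = ctP {1..n} (wP n K rt xv (en {1..n} (- k) * f))"

lemma poly_bP: "poly (bP n K k f) (scal s) = bracket {1..n} (s ^ 2) K K (scal s * yl) k f"
  unfolding bP_def poly_ctP poly_wP bracket_def Delta_def wt_def by (simp only: mult_ac)

definition F1P :: "nat \<Rightarrow> nat \<Rightarrow> lpoly \<Rightarrow> lpoly poly" where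
  "F1P n K f = wP n K (\<lambda>i j. mon (xsub n i - xsub n j)) (\<lambda>i. mon (xsub n i)) f"

lemma poly_F1P: "poly (F1P n K f) (scal s) = F1num n K s f"
  unfolding F1P_def poly_wP F1num_def by (simp only: mult_ac)

lemma poly_of_nat_scal: "poly (of_nat m) (scal s) = (of_nat m :: lpoly)"
  by (induction m) simp_all

lemma ctP_F1P:
  assumes K: "K \<ge> 1" and n: "n \<ge> 2"
  shows "ctP {1..<n} (F1P n K (of_nat n)) = of_nat n * (\<Sum>k\<le>K. bP n K (int k) 1)"
    and "ctP {1..<n} (F1P n K (\<Sum>i\<in>{1..n}. mon (xsub n i))) = (\<Sum>k\<le>K. bP n K (int k) (\<Sum>i\<in>{1..n}. xv i))"
proof -
  show "ctP {1..<n} (F1P n K (of_nat n)) = of_nat n * (\<Sum>k\<le>K. bP n K (int k) 1)"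
    by (rule lpoly_poly_eqI)
      (simp only: poly_ctP poly_F1P poly_mult poly_sum poly_bP poly_of_nat_scal
        ct_F1num_cases(1)[OF nonroot_real _ K n] of_real_eq_0_iff less_imp_neq not_sym)
  show "ctP {1..<n} (F1P n K (\<Sum>i\<in>{1..n}. mon (xsub n i))) = (\<Sum>k\<le>K. bP n K (int k) (\<Sum>i\<in>{1..n}. xv i))"
  proof (rule lpoly_poly_eqI)
    fix s :: real assume s: "0 < s" "s < 1"
    then have "complex_of_real s \<noteq> 0" by simp
    from ct_F1num_cases(2)[OF nonroot_real[OF s] this K n]
    show "poly (ctP {1..<n} (F1P n K (\<Sum>i\<in>{1..n}. mon (xsub n i)))) (scal (of_real s)) =
      poly (\<Sum>k\<le>K. bP n K (int k) (\<Sum>i\<in>{1..n}. xv i)) (scal (of_real s))"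
      by (simp only: poly_ctP poly_F1P poly_sum poly_bP)
  qed
qed

lemma poly_monom_scal: "poly (monom 1 m) (scal s) = scal (s ^ m)"
  by (simp add: poly_monom scal_power)

text \<open>At q = s^2 and z = s^(2K) these are the factors 1 - q^t z^(r-1) of the theorem, and
  those of \<open>numP\<close> the factors z^r - q^(t-1); both indices are shifted to start at
  0.\<close>

definition denP :: "nat \<Rightarrow> nat \<Rightarrow> nat \<Rightarrow> lpoly poly" where
  "denP n K k = (\<Prod>t<k. \<Prod>p<n. 1 - monom 1 (2 * Suc t + 2 * K * p))"

definition numP :: "nat \<Rightarrow> nat \<Rightarrow> nat \<Rightarrow> lpoly poly" where
  "numP n K k = (\<Prod>t<k. \<Prod>p<n. monom 1 (2 * K * Suc p) - monom 1 (2 * t))"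

lemma poly_denP: "poly (denP n K k) (scal s) = scal (\<Prod>t<k. \<Prod>p<n. 1 - (s ^ 2) ^ Suc t * ((s ^ 2) ^ K) ^ p)"
  by (simp only: denP_def poly_prod poly_diff poly_1 poly_monom_scal scal_prod scal_diff scal_1 power_add power_mult)

lemma poly_numP: "poly (numP n K k) (scal s) = scal (\<Prod>t<k. \<Prod>p<n. (s ^ 2) ^ K * ((s ^ 2) ^ K) ^ p - (s ^ 2) ^ t)"
proof -
  have "(s ^ 2) ^ K * ((s ^ 2) ^ K) ^ p = s ^ (2 * K * Suc p)" for p
    by (simp add: power_mult power_add)
  then show ?thesis
    by (simp only: numP_def poly_prod poly_diff poly_monom_scal scal_prod scal_diff power_mult)
qed

lemma bP_ratio:
  assumes K: "K \<ge> 1"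
  shows "denP n K k * bP n K (int k) 1 = numP n K k * monom (yl ^ (n * k)) (n * k) * bP n K 0 1"
proof (rule lpoly_poly_eqI)
  fix s :: real assume s: "0 < s" "s < 1"
  have "supp_in (zero_on {1..n}) (scal (of_real s) * yl)" by (rule yl_supp) simp
  from bracket_iter[OF nonroot_real[OF s] K _ this, of k K]
  show "poly (denP n K k * bP n K (int k) 1) (scal (of_real s)) =
    poly (numP n K k * monom (yl ^ (n * k)) (n * k) * bP n K 0 1) (scal (of_real s))"
    by (simp only: poly_mult poly_denP poly_numP poly_bP poly_monom finite_atLeastAtMost card_atLeastAtMost
        diff_Suc_1 Suc_eq_plus1[symmetric] power_mult_distrib mult_ac simp_thms)
qed

text \<open>The recursion for p = n - 1 alone relates e_1 to 1 and is the origin of the additional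
  factors in the second formula. Taken at k + 1, it contains q^k instead of q^(k-1) and is
  polynomial also for k = 0.\<close>

lemma bP_e1:
  assumes K: "K \<ge> 1" and n: "n \<ge> 1"
  shows "(1 - monom 1 (2 * K * n)) * (1 - monom 1 (2 * Suc k)) * bP n K (int (Suc k)) 1 =
    (1 - monom 1 (2 * K)) * (monom 1 (2 * K * n) - monom 1 (2 * k)) * monom yl 1 *
      bP n K (int (Suc k)) (\<Sum>i\<in>{1..n}. xv i)"
proof (rule lpoly_poly_eqI)
  fix s :: real assume s: "0 < s" "s < 1"
  let ?s = "complex_of_real s" let ?A = "{1..n}"
  have A: "finite ?A" "?A \<noteq> {}" "card ?A = n" using n by auto
  have u: "supp_in (zero_on {1..n}) (scal ?s * yl)" by (rule yl_supp) simp
  have e1: "coeff (vpoly xv ?A) (n - 1) = (\<Sum>i\<in>?A. xv i)"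
    using coeff_vpoly_pred[OF A(1,2), of xv] by (simp add: A(3))
  have q0: "?s ^ 2 \<noteq> 0" using s by simp
  have pw: "(?s ^ 2) powi (int (Suc k)) = (?s ^ 2) ^ Suc k" "(?s ^ 2) powi (int (Suc k) - 1) = (?s ^ 2) ^ k"
    using power_int_of_nat[of "?s ^ 2" "Suc k"] power_int_of_nat[of "?s ^ 2" k] by simp_all
  have n1: "n - 1 < card ?A" "Suc (n - 1) = n" "n - n = 0" "n - (n - 1) = 1" using n by auto
  define q where "q = ?s ^ 2"
  have "scal ((1 - (q ^ K) ^ n) * (1 - q ^ Suc k * (q ^ K) ^ 0)) * bracket ?A q K K (scal ?s * yl) (int (Suc k)) 1
      = scal ((1 - (q ^ K) ^ 1) * (q ^ K * (q ^ K) ^ (n - 1) - q ^ k)) *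
        (scal ?s * yl * bracket ?A q K K (scal ?s * yl) (int (Suc k)) (\<Sum>i\<in>?A. xv i))"
    using bracket_recursion[OF q0 A(1) u n1(1), of K "int (Suc k)" K] bracket_top[OF A(1), of q K K "scal ?s * yl" "int (Suc k)"]
    unfolding n1 A(3) e1 pw q_def by simp
  moreover have "q ^ K * (q ^ K) ^ (n - 1) = (q ^ K) ^ n"
    using n by (metis n1(2) power_Suc)
  ultimately have E: "scal ((1 - (q ^ K) ^ n) * (1 - q ^ Suc k)) * bracket ?A q K K (scal ?s * yl) (int (Suc k)) 1
      = scal ((1 - q ^ K) * ((q ^ K) ^ n - q ^ k)) *
        (scal ?s * yl * bracket ?A q K K (scal ?s * yl) (int (Suc k)) (\<Sum>i\<in>?A. xv i))"
    by (simp only: power_0 power_one_right mult_1_right)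
  show "poly ((1 - monom 1 (2 * K * n)) * (1 - monom 1 (2 * Suc k)) * bP n K (int (Suc k)) 1) (scal ?s) =
    poly ((1 - monom 1 (2 * K)) * (monom 1 (2 * K * n) - monom 1 (2 * k)) * monom yl 1 *
      bP n K (int (Suc k)) (\<Sum>i\<in>{1..n}. xv i)) (scal ?s)"
    using E unfolding poly_mult poly_diff poly_monom_scal poly_1 poly_bP poly_monom[of yl] power_mult q_def[symmetric]
    by (simp only: scal_mult scal_diff scal_1 power_one_right mult_ac)
qed

text \<open>At k = 0 the factor 1 - q^k of the recursion is zero; this is why the second series of
  the theorem starts with k = 1.\<close>

lemma bP_0_e1:
  assumes K: "K \<ge> 1" and n: "n \<ge> 1"
  shows "bP n K 0 (\<Sum>i\<in>{1..n}. xv i) = 0"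
proof (rule lpoly_poly_eqI)
  fix s :: real assume s: "0 < s" "s < 1"
  let ?s = "complex_of_real s" let ?A = "{1..n}"
  have A: "finite ?A" "?A \<noteq> {}" "card ?A = n" using n by auto
  have u: "supp_in (zero_on {1..n}) (scal ?s * yl)" by (rule yl_supp) simp
  have u0: "scal ?s * yl \<noteq> 0" using s by (simp add: yl_def)
  have e1: "(\<Sum>i\<in>?A. xv i) = coeff (vpoly xv ?A) (n - 1)"
    using coeff_vpoly_pred[OF A(1,2), of xv] by (simp add: A(3))
  have "bracket ?A (?s ^ 2) K K (scal ?s * yl) (- int 0) (coeff (vpoly xv ?A) (n - 1)) = 0"
    by (rule bracket_neg[OF nonroot_real[OF s] K A(1,2) u u0]) (use n A in auto)
  then show "poly (bP n K 0 (\<Sum>i\<in>{1..n}. xv i)) (scal ?s) = poly 0 (scal ?s)"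
    unfolding e1 poly_bP by simp
qed

definition qfP :: "nat \<Rightarrow> lpoly poly" where
  "qfP m = (\<Prod>t<m. 1 - monom 1 (2 * Suc t))"

lemma poly_qfP: "poly (qfP m) (scal s) = scal (qfac (s ^ 2) m)"
  by (simp only: qfP_def qfac_def poly_prod poly_diff poly_1 poly_monom_scal scal_prod scal_diff scal_1 power_mult)

lemma bP_0:
  assumes K: "K \<ge> 1"
  shows "(\<Prod>p<n. 1 - monom 1 (2 * K * Suc p)) * qfP K ^ n * bP n K 0 1
    = of_nat (fact n) * (1 - monom 1 (2 * K)) ^ n * qfP (K * n)"
proof (rule lpoly_poly_eqI)
  fix s :: real assume s: "0 < s" "s < 1"
  let ?A = "{1..n}" 
  define q where "q = complex_of_real s ^ 2"
  define D where "D = (\<Prod>p<n. 1 - (q ^ K) ^ Suc p)"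
  have q: "nonroot q" unfolding q_def by (rule nonroot_real[OF s])
  have u: "supp_in (zero_on {1..n}) (scal (complex_of_real s) * yl)" by (rule yl_supp) simp
  have D: "D \<noteq> 0"
    unfolding D_def using nonroot_pow_pow[OF q K] by (subst prod_zero_iff) (auto simp del: power_Suc)
  have "bracket ?A q K K (scal (complex_of_real s) * yl) 0 1 = scal (fact n * (1 - q ^ K) ^ n * qfac q (K * n) / (D * qfac q K ^ n))"
    using bracket_0[OF _ u, of q K K] ct_Delta[OF q K, of ?A] by (simp add: D_def)
  then have "scal (D * qfac q K ^ n) * bracket ?A q K K (scal (complex_of_real s) * yl) 0 1 = scal (fact n * (1 - q ^ K) ^ n * qfac q (K * n))"
    using D qfac_neq_0[OF q] by (simp flip: scal_mult)
  moreover have "scal (fact n) = of_nat (fact n)"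
    using scal_of_nat[of "fact n"] by simp
  ultimately show "poly ((\<Prod>p<n. 1 - monom 1 (2 * K * Suc p)) * qfP K ^ n * bP n K 0 1) (scal (complex_of_real s))
    = poly (of_nat (fact n) * (1 - monom 1 (2 * K)) ^ n * qfP (K * n)) (scal (complex_of_real s))"
    unfolding poly_mult poly_diff poly_prod poly_power poly_monom_scal poly_1 poly_bP poly_qfP poly_of_nat_scal
      power_mult q_def[symmetric] D_def
    by (simp only: scal_mult scal_diff scal_1 scal_prod scal_power power_mult)
qed

section \<open>The two constant terms\<close>

lemma fps_const_sum: "fps_const (sum f A) = (\<Sum>i\<in>A. fps_const (f i :: 'a::comm_ring_1))"
  by (induction A rule: infinite_finite_induct) (simp_all flip: fps_const_add)

lemma fps_const_prod_power: "fps_const (a ^ m) = fps_const (a :: 'a::comm_ring_1) ^ m"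
  by (induction m) (simp_all flip: fps_const_mult)

lemma fps_of_poly_of_nat: "fps_of_poly (of_nat m) = of_nat m"
  by (induction m) (simp_all add: fps_of_poly_add)

lemma ser_eqI:
  assumes "\<And>K. K \<ge> 1 \<Longrightarrow> spec (2 * K) F = spec (2 * K) G"
  shows "F = G"
proof -
  have "infinite ((\<lambda>K. 2 * K) ` {1::nat..})"
    by (simp add: finite_image_iff inj_on_def infinite_Ici)
  moreover have "c > 0 \<and> spec c (F - G) = 0" if "c \<in> (\<lambda>K. 2 * K) ` {1::nat..}" for c
    using that assms by (auto simp: spec_diff)
  ultimately have "F - G = 0" by (rule spec_all_0)
  then show ?thesis by simp
qed

lemma yS_eq: "yS = cst yl"
  by (simp add: yS_def yl_def)

lemma spec_F1:
  assumes K: "K \<ge> 1"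
  shows "spec (2 * K) (F1 m n (xsub n)) = fps_of_poly (F1P n K (\<Sum>i\<in>{1..n}. mon_pow (xsub n i) m))"
proof -
  have c: "2 * K > 0" using K by simp
  note s = spec_mult[OF c] spec_prod[OF c] spec_cst[OF c] spec_sS[OF c] spec_sum spec_qpoch_ratio[OF K]
  have 1: "spec (2 * K) (\<Prod>(i, j)\<in>offd {1..n}. sdiv (qpoch_inf (cst (mon (xsub n i - xsub n j))))
       (qpoch_inf (cst (mon (xsub n i - xsub n j)) * zS))) =
     fps_of_poly (\<Prod>(i, j)\<in>offd {1..n}. qpP (mon (xsub n i - xsub n j)) 0 K)"
    by (simp add: s case_prod_unfold fps_of_poly_prod fps_of_poly_qpP)
  have 2: "spec (2 * K) (\<Prod>i\<in>{1..n}. sdiv (qpoch_inf (sS * cst (mon (xsub n i)) * yS))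
       (qpoch_inf (sS * cst (mon (xsub n i)) * yS * zS))) =
     fps_of_poly (\<Prod>i\<in>{1..n}. qpP (yl * mon (xsub n i)) 1 K)"
  proof -
    have "fps_X * fps_const a * fps_const b * fps_X ^ (2 * k) = fps_const (b * a) * fps_X ^ (2 * k + 1)"
      for a b :: lpoly and k
      by (simp only: fps_const_mult[symmetric] power_add power_one_right mult_ac)
    then show ?thesis
      by (simp only: s yS_eq fps_of_poly_prod fps_of_poly_qpP)
  qed
  have 3: "spec (2 * K) (\<Sum>i\<in>{1..n}. cst (mon_pow (xsub n i) m)) = fps_of_poly [:\<Sum>i\<in>{1..n}. mon_pow (xsub n i) m:]"
    by (simp add: s fps_of_poly_const fps_const_sum)
  have "{(i, j). i \<in> {1..n} \<and> j \<in> {1..n} \<and> i \<noteq> j} = offd {1..n}"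
    by (simp add: offd_def)
  then show ?thesis
    unfolding F1_def F1P_def wP_def fps_of_poly_mult 1[symmetric] 2[symmetric] 3[symmetric]
    by (simp only: spec_mult[OF c])
qed

lemma spec_C1:
  assumes K: "K \<ge> 1" and n: "n \<ge> 2"
  shows "spec (2 * K) (C1 0 n) = of_nat n * (\<Sum>k\<le>K. fps_of_poly (bP n K (int k) 1))"
    and "spec (2 * K) (C1 1 n) = (\<Sum>k<K. fps_of_poly (bP n K (int (Suc k)) (\<Sum>i\<in>{1..n}. xv i)))"
proof -
  have "spec (2 * K) (C1 m n) = fps_of_poly (ctP {1..<n} (F1P n K (\<Sum>i\<in>{1..n}. mon_pow (xsub n i) m)))" for m
    by (simp only: C1_def spec_ct_ser spec_F1[OF K] fct_fps_of_poly)
  note E = this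
  have m0: "(\<Sum>i\<in>{1..n}. mon_pow (xsub n i) 0) = of_nat n" 
    and m1: "(\<Sum>i\<in>{1..n}. mon_pow (xsub n i) 1) = (\<Sum>i\<in>{1..n}. mon (xsub n i))"
    by (simp_all add: mon_pow_def)
  show "spec (2 * K) (C1 0 n) = of_nat n * (\<Sum>k\<le>K. fps_of_poly (bP n K (int k) 1))"
    unfolding E m0 ctP_F1P(1)[OF K n] fps_of_poly_mult fps_of_poly_sum fps_of_poly_of_nat ..
  have "spec (2 * K) (C1 1 n) = (\<Sum>k\<le>K. fps_of_poly (bP n K (int k) (\<Sum>i\<in>{1..n}. xv i)))"
    unfolding E m1 ctP_F1P(2)[OF K n] fps_of_poly_sum ..
  also have "{..K} = insert 0 (Suc ` {..<K})"
    by (auto simp: image_iff) (metis Suc_pred lessThan_iff not_gr0 Suc_le_eq)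
  also have "(\<Sum>k\<in>insert 0 (Suc ` {..<K}). fps_of_poly (bP n K (int k) (\<Sum>i\<in>{1..n}. xv i)))
    = fps_of_poly (bP n K 0 (\<Sum>i\<in>{1..n}. xv i)) + (\<Sum>k<K. fps_of_poly (bP n K (int (Suc k)) (\<Sum>i\<in>{1..n}. xv i)))"
    by (subst sum.insert) (auto simp: sum.reindex)
  also have "bP n K 0 (\<Sum>i\<in>{1..n}. xv i) = 0"
    by (rule bP_0_e1[OF K]) (use n in auto)
  finally show "spec (2 * K) (C1 1 n) = (\<Sum>k<K. fps_of_poly (bP n K (int (Suc k)) (\<Sum>i\<in>{1..n}. xv i)))"
    by simp
qed

section \<open>The right-hand sides at z = q^K\<close>

definition denS :: "nat \<Rightarrow> nat \<Rightarrow> ser" where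
  "denS n k = (\<Prod>t<k. \<Prod>p<n. 1 - qS ^ Suc t * zS ^ p)"

definition numS :: "nat \<Rightarrow> nat \<Rightarrow> ser" where
  "numS n k = (\<Prod>t<k. \<Prod>p<n. zS ^ Suc p - qS ^ t)"

lemma spec_zS_power: "K \<ge> 1 \<Longrightarrow> spec (2 * K) (zS ^ p) = fps_X ^ (2 * K * p)"
  by (simp add: spec_power spec_zS power_mult)

lemma spec_qS_power: "K \<ge> 1 \<Longrightarrow> spec (2 * K) (qS ^ t) = fps_X ^ (2 * t)"
  by (simp add: spec_power spec_qS power_mult)

lemma spec_yS: "K \<ge> 1 \<Longrightarrow> spec (2 * K) yS = fps_const yl"
  by (simp add: yS_eq spec_cst)

lemma spec_denS:
  assumes K: "K \<ge> 1"
  shows "spec (2 * K) (denS n k) = fps_of_poly (denP n K k)"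
proof -
  have c: "2 * K > 0" using K by simp
  show ?thesis
    by (simp only: denS_def denP_def spec_prod[OF c] spec_diff spec_1[OF c] spec_mult[OF c]
      spec_zS_power[OF K] spec_qS_power[OF K] fps_of_poly_prod fps_of_poly_diff fps_of_poly_1 fps_of_poly_monom' power_add)
qed

lemma spec_numS:
  assumes K: "K \<ge> 1"
  shows "spec (2 * K) (numS n k) = fps_of_poly (numP n K k)"
proof -
  have c: "2 * K > 0" using K by simp
  show ?thesis
    by (simp only: numS_def numP_def spec_prod[OF c] spec_diff
      spec_zS_power[OF K] spec_qS_power[OF K] fps_of_poly_prod fps_of_poly_diff fps_of_poly_monom')
qed

lemma c00_denS [simp]: "c00 (denS n k) = 1"
  by (simp add: denS_def)

lemma spec_numS_factor_0:
  assumes K: "K \<ge> 1"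
  shows "spec (2 * K) (zS ^ Suc 0 - qS ^ K) = 0"
  by (simp only: spec_diff spec_zS_power[OF K] spec_qS_power[OF K]) simp

text \<open>For k > K the product contains z - q^K, so the series ends at the same index as the sum
  of brackets.\<close>

lemma spec_numS_0:
  assumes K: "K \<ge> 1" and k: "k > K" and n: "n \<ge> 1"
  shows "spec (2 * K) (numS n k) = 0"
proof -
  have c: "2 * K > 0" using K by simp
  have F: "(\<Prod>p<n. spec (2 * K) (zS ^ Suc p - qS ^ K)) = 0"
    using spec_numS_factor_0[OF K] n by (intro prod_zero bexI[of _ 0]) auto
  show ?thesis
    unfolding numS_def spec_prod[OF c]
    by (rule prod_zero, simp, rule bexI[of _ K], rule F) (simp add: k)
qed

lemma yS_sS_power_nth: "m < N \<Longrightarrow> fps_nth ((yS * sS) ^ N * R) m = 0"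
proof -
  assume "m < N"
  have e: "(yS * sS) ^ N * R = fps_X ^ N * (yS ^ N * R)"
    by (simp only: sS_def power_mult_distrib mult_ac)
  show ?thesis unfolding e using \<open>m < N\<close> by (simp add: fps_X_power_mult_nth)
qed

text \<open>(q; q)_\<infinity> = (q; q)_(m-1) (q^m; q)_\<infinity>. With m = K and m = Kn this
  connects it to (z; q)_\<infinity> and (z^n; q)_\<infinity>.\<close>

lemma spec_qpoch_inf_qS:
  assumes K: "K \<ge> 1" and m: "m \<ge> 1" and b: "spec (2 * K) b = fps_X ^ (2 * m)"
  shows "spec (2 * K) (qpoch_inf qS) = fps_of_poly (qfP (m - 1)) * spec (2 * K) (qpoch_inf b)"
proof -
  have c: "2 * K > 0" using K by simp
  have "qS * qS ^ (m - 1) = qS ^ m" using m by (cases m) auto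
  then have "spec (2 * K) (qpoch_inf (qS * qS ^ (m - 1))) = spec (2 * K) (qpoch_inf b)"
    using b by (intro spec_qpoch_inf_cong[OF c]) (simp only: spec_qS_power[OF K])
  moreover have "spec (2 * K) (\<Prod>k<m - 1. 1 - qS * qS ^ k) = fps_of_poly (qfP (m - 1))"
    by (simp only: qfP_def spec_prod[OF c] spec_diff spec_1[OF c] power_Suc[symmetric] spec_qS_power[OF K]
       fps_of_poly_prod fps_of_poly_diff fps_of_poly_1 fps_of_poly_monom')
  ultimately show ?thesis
    using qpoch_inf_split[of qS "m - 1"] by (metis spec_mult[OF c])
qed

lemma qfP_pred: "m \<ge> 1 \<Longrightarrow> qfP m = qfP (m - 1) * (1 - monom 1 (2 * m))"
  by (cases m) (simp_all add: qfP_def)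

lemma one_minus_fps_X_neq_0: "m > 0 \<Longrightarrow> 1 - fps_X ^ m \<noteq> (0 :: lpoly fps)"
proof
  assume "m > 0" and e: "1 - fps_X ^ m = (0 :: lpoly fps)"
  then have "fps_nth (1 - fps_X ^ m :: lpoly fps) 0 = 1" by simp
  then show False unfolding e by simp
qed

text \<open>The infinite products of the theorem arise from (q; q)_K and (q; q)_(Kn) in the constant
  term of \<Delta>: at z = q^K the quotients of (q; q)_\<infinity> by (z; q)_\<infinity> and (z^n;
  q)_\<infinity> are (q; q)_(K-1) and (q; q)_(Kn-1), and the missing factors 1 - z and 1 - z^n
  cancel in \<open>bP_0\<close>.\<close>

lemma spec_prefactor:
  assumes K: "K \<ge> 1" and n: "n \<ge> 1"
  shows "spec (2 * K) (qpoch_inf qS ^ (n - 1) * qpoch_inf (zS ^ n) * qpoch zS zS (n - 1)) * fps_of_poly (bP n K 0 1)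
    = of_nat (fact n) * spec (2 * K) (qpoch_inf zS ^ n)"
proof -
  have c: "2 * K > 0" using K by simp
  define Qi where "Qi = spec (2 * K) (qpoch_inf qS)"
  define ZI where "ZI = spec (2 * K) (qpoch_inf zS)"
  define ZN where "ZN = spec (2 * K) (qpoch_inf (zS ^ n))"
  define PP :: "lpoly fps" where "PP = (\<Prod>p<n - 1. 1 - fps_X ^ (2 * K * Suc p))"
  define a where "a = fps_of_poly (qfP (K - 1))"
  define d where "d = fps_of_poly (qfP (K * n - 1))"
  define w :: "lpoly fps" where "w = 1 - fps_X ^ (2 * K)"
  define v :: "lpoly fps" where "v = 1 - fps_X ^ (2 * K * n)"
  define f :: "lpoly fps" where "f = of_nat (fact n)"
  define B where "B = fps_of_poly (bP n K 0 1)"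
  have Kn: "K * n \<ge> 1" using K n by simp
  have Qa: "Qi = a * ZI"
    unfolding Qi_def a_def ZI_def by (rule spec_qpoch_inf_qS[OF K K spec_zS[OF c]])
  have Qd: "Qi = d * ZN"
    unfolding Qi_def d_def ZN_def
    by (rule spec_qpoch_inf_qS[OF K Kn]) (simp only: spec_zS_power[OF K] mult.assoc)
  have "(\<Prod>p<n. 1 - fps_X ^ (2 * K * Suc p)) = PP * v"
    using n by (cases n) (simp_all add: PP_def v_def)
  then have "(PP * v) * (a * w) ^ n * B = f * w ^ n * (d * v)"
    using arg_cong[OF bP_0[OF K, of n], of fps_of_poly]
    unfolding qfP_pred[OF K] qfP_pred[OF Kn] mult.assoc[of 2 K n, symmetric] a_def d_def w_def v_def f_def B_def
    by (simp only: fps_of_poly_mult fps_of_poly_power fps_of_poly_prod fps_of_poly_diff fps_of_poly_1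
        fps_of_poly_monom' fps_of_poly_of_nat)
  then have "(v * w ^ n) * (PP * a ^ n * B) = (v * w ^ n) * (f * d)"
    by (simp add: power_mult_distrib mult_ac)
  moreover have "v \<noteq> 0" "w \<noteq> 0"
    unfolding v_def w_def using K n by (intro one_minus_fps_X_neq_0, simp)+
  ultimately have e: "PP * a ^ n * B = f * d" by simp
  \<comment> \<open>A further factor \<open>Qi\<close> completes the power to n, matching the n
    factors (q; q)_K of \<open>bP_0\<close>; being nonzero, it cancels at the end.\<close>
  have "Qi * (Qi ^ (n - 1) * ZN * PP * B) = Qi ^ n * ZN * PP * B"
    using n by (cases n) (simp_all add: mult_ac)
  also have "\<dots> = (PP * a ^ n * B) * (ZI ^ n * ZN)"
    unfolding Qa by (simp add: power_mult_distrib mult_ac)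
  also have "\<dots> = Qi * (f * ZI ^ n)"
    unfolding e Qd by (simp add: mult_ac)
  finally have "Qi ^ (n - 1) * ZN * PP * B = f * ZI ^ n"
    using spec_unit[OF c, of "qpoch_inf qS"] by (simp add: Qi_def)
  moreover have "spec (2 * K) (qpoch zS zS (n - 1)) = PP"
    by (simp only: qpoch_def PP_def spec_prod[OF c] spec_diff spec_1[OF c] power_Suc[symmetric] spec_zS_power[OF K])
  ultimately show ?thesis
    by (simp only: spec_mult[OF c] spec_power[OF c] Qi_def ZN_def ZI_def f_def B_def)
qed

lemma denP_neq_0: "fps_of_poly (denP n K k) \<noteq> 0"
proof
  assume "fps_of_poly (denP n K k) = 0"
  then have "denP n K k = 0" using fps_of_poly_eq_iff[of "denP n K k" 0] by simp
  moreover have "poly (denP n K k) 0 = 1"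
    by (simp add: denP_def poly_prod poly_monom)
  ultimately show False by simp
qed

lemma fps_of_poly_bP_ratio:
  assumes K: "K \<ge> 1"
  shows "fps_of_poly (denP n K k) * fps_of_poly (bP n K (int k) 1) =
    fps_of_poly (numP n K k) * (fps_const yl * fps_X) ^ (n * k) * fps_of_poly (bP n K 0 1)"
  using arg_cong[OF bP_ratio[OF K, of n k], of fps_of_poly]
  by (simp only: fps_of_poly_mult fps_of_poly_monom fps_const_prod_power power_mult_distrib)

lemma C1_0_spec:
  assumes K: "K \<ge> 1" and n: "n \<ge> 2"
  defines "f \<equiv> \<lambda>k. (yS * sS) ^ (n * k) *
         (\<Prod>t\<in>{1..k}. \<Prod>r\<in>{1..n}. sdiv (zS ^ r - qS ^ (t - 1)) (1 - qS ^ t * zS ^ (r - 1)))"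
  shows "spec (2 * K) (C1 0 n) = spec (2 * K)
      (sdiv (of_nat (n * fact n) * qpoch_inf zS ^ n)
           (qpoch_inf qS ^ (n - 1) * qpoch_inf (zS ^ n) * qpoch zS zS (n - 1)) * suminf f)"
proof -
  have c: "2 * K > 0" using K by simp
  have f: "f k = (yS * sS) ^ (n * k) * (\<Prod>t<k. \<Prod>p<n. sdiv (zS ^ Suc p - qS ^ t) (1 - qS ^ Suc t * zS ^ p))" for k
    by (simp add: f_def prod.atLeast1_atMost_eq)
  have T: "fps_of_poly (denP n K k) * spec (2 * K) (f k) = fps_of_poly (numP n K k) * (fps_const yl * fps_X) ^ (n * k)" for k
  proof -
    define R where "R = (\<Prod>t<k. \<Prod>p<n. sdiv (zS ^ Suc p - qS ^ t) (1 - qS ^ Suc t * zS ^ p))"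
    have "denS n k * R = numS n k"
      unfolding R_def denS_def numS_def prod.distrib[symmetric] by (intro prod.cong refl mult_sdiv) simp
    moreover have "denS n k * f k = (denS n k * R) * (yS * sS) ^ (n * k)"
      unfolding f R_def[symmetric] by (simp only: mult_ac)
    ultimately have "spec (2 * K) (denS n k * f k) = spec (2 * K) (numS n k * (yS * sS) ^ (n * k))"
      by simp
    then show ?thesis
      by (simp only: spec_mult[OF c] spec_power[OF c] spec_denS[OF K] spec_numS[OF K] spec_yS[OF K] spec_sS[OF c])
  qed
  have bT: "fps_of_poly (bP n K (int k) 1) = spec (2 * K) (f k) * fps_of_poly (bP n K 0 1)" for k
  proof -
    have "fps_of_poly (denP n K k) * fps_of_poly (bP n K (int k) 1)
       = fps_of_poly (denP n K k) * (spec (2 * K) (f k) * fps_of_poly (bP n K 0 1))"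
      unfolding fps_of_poly_bP_ratio[OF K] mult.assoc[symmetric] T ..
    then show ?thesis using denP_neq_0 by simp
  qed
  have f0: "spec (2 * K) (f k) = 0" if "k > K" for k
    using T[of k] spec_numS_0[OF K that, of n] n denP_neq_0[of n K k] by (simp add: spec_numS[OF K])
  have S: "spec (2 * K) (suminf f) = (\<Sum>k\<le>K. spec (2 * K) (f k))"
  proof (rule spec_suminf[OF c _ f0])
    fix k m :: nat assume "m < k"
    moreover have "k \<le> n * k" using n by simp
    ultimately have "m < n * k" by (rule order.strict_trans2)
    then show "fps_nth (f k) m = 0"
      unfolding f by (rule yS_sS_power_nth)
  qed
  define den where "den = qpoch_inf qS ^ (n - 1) * qpoch_inf (zS ^ n) * qpoch zS zS (n - 1)"
  have den: "c00 den = 1" using n by (simp add: den_def qpoch_def power_0_left)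
  have "spec (2 * K) den * spec (2 * K) (sdiv (of_nat (n * fact n) * qpoch_inf zS ^ n) den)
     = of_nat n * (of_nat (fact n) * spec (2 * K) (qpoch_inf zS ^ n))"
    unfolding spec_sdiv[OF c den] by (simp only: of_nat_mult spec_mult[OF c] spec_of_nat[OF c] mult.assoc)
  also have "\<dots> = spec (2 * K) den * (of_nat n * fps_of_poly (bP n K 0 1))"
    using spec_prefactor[OF K, of n] n by (simp add: den_def)
  finally have G: "spec (2 * K) (sdiv (of_nat (n * fact n) * qpoch_inf zS ^ n) den) = of_nat n * fps_of_poly (bP n K 0 1)"
    using spec_unit[OF c den] by simp
  show ?thesis
    unfolding spec_C1(1)[OF K n] spec_mult[OF c] den_def[symmetric] G S bT
    by (simp add: sum_distrib_left sum_distrib_right mult_ac)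
qed

text \<open>For k > 1 the factor z^n - q^(k-1) is not invertible as a power series; the quotient
  exists because the factor also occurs in the product, for t = k and r = n. Therefore numerator and
  denominator are kept in one \<open>sdiv\<close>.\<close>

lemma C1_1_spec:
  assumes K: "K \<ge> 1" and n: "n \<ge> 2"
  defines "f \<equiv> \<lambda>k'. let k = Suc k' in
         sdiv ((yS * sS) ^ (n * k - 1) * (1 - qS ^ k) *
                 (\<Prod>t\<in>{1..k}. \<Prod>r\<in>{1..n}. zS ^ r - qS ^ (t - 1)))
              ((zS ^ n - qS ^ (k - 1)) *
                 (\<Prod>t\<in>{1..k}. \<Prod>r\<in>{1..n}. 1 - qS ^ t * zS ^ (r - 1)))"
  shows "spec (2 * K) (C1 1 n) = spec (2 * K)
      (sdiv (of_nat (fact n) * (1 - zS ^ n) * qpoch_inf zS ^ n)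
           (qpoch_inf qS ^ (n - 1) * (1 - zS) * qpoch_inf (zS ^ n) * qpoch zS zS (n - 1)) * suminf f)"
proof -
  have c: "2 * K > 0" using K by simp
  \<comment> \<open>The numerator product up to index k + 1 without its factor z^n - q^k.\<close>
  define num1 where "num1 = (\<lambda>k. numS n k * (\<Prod>p<n - 1. zS ^ Suc p - qS ^ k))"
  define W where "W = (\<lambda>k. zS ^ n - qS ^ k)"
  have num1: "numS n (Suc k) = W k * num1 k" for k
  proof -
    have "Suc (n - 1) = n" using n by simp
    then have "(\<Prod>p<n. zS ^ Suc p - qS ^ k) = (\<Prod>p<n - 1. zS ^ Suc p - qS ^ k) * (zS ^ n - qS ^ k)"
      using prod.lessThan_Suc[of "\<lambda>p. zS ^ Suc p - qS ^ k" "n - 1"] by (simp only:)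
    then show ?thesis
      by (simp only: numS_def num1_def W_def prod.lessThan_Suc mult_ac)
  qed
  \<comment> \<open>The coefficient of z^n s^0 is 1, also for k = 0, where n > 0 separates z^n from
    q^0.\<close>
  have W0: "W k \<noteq> 0" for k
  proof
    assume "W k = 0"
    then have "fps_nth (fps_nth (W k) 0) n = 0" by simp
    moreover have "fps_nth (fps_nth (zS ^ n) 0) n = 1"
      by (simp add: zS_def flip: fps_const_prod_power)
    moreover have "fps_nth (fps_nth (qS ^ k) 0) n = 0"
      using n by (cases "k = 0") (auto simp: qS_def sS_def simp flip: power_mult)
    ultimately show False by (simp add: W_def)
  qed
  have f: "f k = (yS * sS) ^ (n * Suc k - 1) * sdiv ((1 - qS ^ Suc k) * num1 k) (denS n (Suc k))" for k
  proof -
    have P: "(\<Prod>t\<in>{1..m}. g t) = (\<Prod>t<m. g (Suc t))" for m and g :: "nat \<Rightarrow> ser"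
      by (simp add: prod.atLeast1_atMost_eq)
    have "f k = sdiv ((yS * sS) ^ (n * Suc k - 1) * (1 - qS ^ Suc k) * numS n (Suc k)) (W k * denS n (Suc k))"
      by (simp only: f_def Let_def P numS_def denS_def W_def diff_Suc_1)
    also have "(yS * sS) ^ (n * Suc k - 1) * (1 - qS ^ Suc k) * numS n (Suc k) =
        W k * ((yS * sS) ^ (n * Suc k - 1) * ((1 - qS ^ Suc k) * num1 k))"
      unfolding num1 by (simp only: mult_ac)
    finally show ?thesis by (simp only: sdiv_cancel[OF c00_denS W0] sdiv_mult_left[OF c00_denS])
  qed
  have T: "fps_of_poly (denP n K (Suc k)) * spec (2 * K) (f k) =
     (fps_const yl * fps_X) ^ (n * Suc k - 1) * (1 - fps_X ^ (2 * Suc k)) * spec (2 * K) (num1 k)" for k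
  proof -
    have "denS n (Suc k) * f k = (yS * sS) ^ (n * Suc k - 1) *
        (denS n (Suc k) * sdiv ((1 - qS ^ Suc k) * num1 k) (denS n (Suc k)))"
      unfolding f by (simp only: mult_ac)
    also have "\<dots> = (yS * sS) ^ (n * Suc k - 1) * (1 - qS ^ Suc k) * num1 k"
      unfolding mult_sdiv[OF c00_denS] by (simp only: mult_ac)
    finally have "spec (2 * K) (denS n (Suc k) * f k) =
        spec (2 * K) ((yS * sS) ^ (n * Suc k - 1) * (1 - qS ^ Suc k) * num1 k)"
      by simp
    then show ?thesis
      by (simp only: spec_denS[OF K] spec_mult[OF c] spec_power[OF c] spec_diff spec_1[OF c]
         spec_yS[OF K] spec_sS[OF c] spec_qS[OF c] power_mult)
  qed
  \<comment> \<open>The index k stands for k + 1 of the theorem, so the terms vanish from k = K on.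
    At k = K the vanishing factor z - q^K survives in \<open>num1\<close> because n \<ge> 2.\<close>
  have f0: "spec (2 * K) (f k) = 0" if k: "k \<ge> K" for k
  proof -
    have "spec (2 * K) (num1 k) = 0"
    proof (cases "k = K")
      case True
      have "(\<Prod>p<n - 1. spec (2 * K) (zS ^ Suc p - qS ^ K)) = 0"
        using spec_numS_factor_0[OF K] n by (intro prod_zero bexI[of _ 0]) auto
      then show ?thesis using True by (simp add: num1_def spec_mult[OF c] spec_prod[OF c])
    next
      case False
      then show ?thesis using spec_numS_0[OF K, of k n] k n by (simp add: num1_def spec_mult[OF c])
    qed
    then show ?thesis using T[of k] denP_neq_0[of n K "Suc k"] by simp
  qed
  have "spec (2 * K) (suminf f) = (\<Sum>k\<le>K. spec (2 * K) (f k))"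
  proof (rule spec_suminf[OF c])
    fix k m :: nat assume "m < k"
    moreover have "k \<le> n * Suc k - 1"
    proof -
      have "2 * Suc k \<le> n * Suc k" using n by (rule mult_le_mono1)
      then show ?thesis by simp
    qed
    ultimately show "fps_nth (f k) m = 0"
      unfolding f by (intro yS_sS_power_nth) simp
  qed (use f0 in auto)
  also have "\<dots> = (\<Sum>k<K. spec (2 * K) (f k))"
    using f0[of K] by (simp add: lessThan_Suc_atMost[symmetric])
  finally have S: "spec (2 * K) (suminf f) = \<dots>" .
  define den where "den = qpoch_inf qS ^ (n - 1) * (1 - zS) * qpoch_inf (zS ^ n) * qpoch zS zS (n - 1)"
  define den' where "den' = qpoch_inf qS ^ (n - 1) * qpoch_inf (zS ^ n) * qpoch zS zS (n - 1)"
  define G where "G = spec (2 * K) (sdiv (of_nat (fact n) * (1 - zS ^ n) * qpoch_inf zS ^ n) den)"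
  define w :: "lpoly fps" where "w = 1 - fps_X ^ (2 * K)"
  define v :: "lpoly fps" where "v = 1 - fps_X ^ (2 * K * n)"
  define B where "B = fps_of_poly (bP n K 0 1)"
  have den: "c00 den = 1" "c00 den' = 1" using n by (simp_all add: den_def den'_def qpoch_def power_0_left)
  have dd: "spec (2 * K) den = w * spec (2 * K) den'"
  proof -
    have "den = (1 - zS) * den'" by (simp only: den_def den'_def mult_ac)
    then show ?thesis by (simp only: w_def spec_mult[OF c] spec_diff spec_1[OF c] spec_zS[OF c])
  qed
  have "spec (2 * K) den' * (w * G) = spec (2 * K) den * G"
    unfolding dd by (simp only: mult_ac)
  also have "\<dots> = v * (of_nat (fact n) * spec (2 * K) (qpoch_inf zS ^ n))"
    unfolding G_def spec_sdiv[OF c den(1)]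
    unfolding v_def spec_mult[OF c] spec_of_nat[OF c] spec_diff spec_1[OF c] spec_zS_power[OF K]
    by (simp only: mult_ac)
  also have "\<dots> = spec (2 * K) den' * (v * B)"
    using spec_prefactor[OF K, of n] n by (simp add: den'_def B_def)
  finally have G: "w * G = v * B"
    using spec_unit[OF c den(2)] by simp
  have w0: "w \<noteq> 0"
    unfolding w_def using K by (intro one_minus_fps_X_neq_0) simp
  have bT: "fps_of_poly (bP n K (int (Suc k)) (\<Sum>i\<in>{1..n}. xv i)) = G * spec (2 * K) (f k)" if k: "k < K" for k
  proof -
    define b0 where "b0 = fps_of_poly (bP n K (int (Suc k)) 1)"
    define b1 where "b1 = fps_of_poly (bP n K (int (Suc k)) (\<Sum>i\<in>{1..n}. xv i))"
    define d where "d = fps_of_poly (denP n K (Suc k))"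
    define Y where "Y = fps_const yl * fps_X"
    define Wk :: "lpoly fps" where "Wk = fps_X ^ (2 * K * n) - fps_X ^ (2 * k)"
    define e :: "lpoly fps" where "e = 1 - fps_X ^ (2 * Suc k)"
    define N where "N = spec (2 * K) (num1 k)"
    have E1: "v * e * b0 = w * Wk * Y * b1"
      using arg_cong[OF bP_e1[OF K, of n k], of fps_of_poly] n
      unfolding v_def e_def b0_def w_def Wk_def Y_def b1_def
      by (simp only: fps_of_poly_mult fps_of_poly_diff fps_of_poly_1 fps_of_poly_monom' fps_of_poly_monom[of yl]
         power_one_right)
    have "fps_of_poly (numP n K (Suc k)) = Wk * N"
      unfolding spec_numS[OF K, symmetric] num1 N_def W_def Wk_def
      by (simp only: spec_mult[OF c] spec_diff spec_zS_power[OF K] spec_qS_power[OF K])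
    then have E2: "d * b0 = Wk * N * Y ^ (n * Suc k) * B"
      using fps_of_poly_bP_ratio[OF K, of n "Suc k"] by (simp only: d_def b0_def Y_def B_def)
    have YY: "Y ^ (n * Suc k) = Y * Y ^ (n * Suc k - 1)"
      using n by (simp flip: power_Suc)
    have "(w * Wk * Y * d) * b1 = d * (v * e * b0)"
      unfolding E1 by (simp only: mult_ac)
    also have "\<dots> = (v * B) * (Y ^ (n * Suc k - 1) * e * N) * (Wk * Y)"
    proof -
      have "d * (v * e * b0) = v * e * (d * b0)" by (simp only: mult_ac)
      then show ?thesis unfolding E2 YY by (simp only: mult_ac)
    qed
    also have "\<dots> = (w * G) * (d * spec (2 * K) (f k)) * (Wk * Y)"
      unfolding G d_def T Y_def e_def N_def ..
    also have "\<dots> = (w * Wk * Y * d) * (G * spec (2 * K) (f k))"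
      by (simp only: mult_ac)
    finally have "(w * Wk * Y * d) * b1 = (w * Wk * Y * d) * (G * spec (2 * K) (f k))" .
    \<comment> \<open>k < K \<le> Kn keeps the two powers of s apart, so that the factor can be
      cancelled.\<close>
    moreover have "Wk \<noteq> 0"
    proof
      assume "Wk = 0"
      then have "fps_nth Wk (2 * k) = 0" by simp
      moreover have "2 * K * n \<noteq> 2 * k"
      proof -
        have "K * 1 \<le> K * n" using n by (intro mult_le_mono2) simp
        then have "k < K * n" using k by linarith
        then show ?thesis by simp
      qed
      ultimately show False by (simp add: Wk_def)
    qed
    moreover have "Y \<noteq> 0"
      by (simp add: Y_def yl_def)
    moreover have "d \<noteq> 0" unfolding d_def by (rule denP_neq_0)
    ultimately show ?thesis using w0 by (simp add: b1_def)
  qed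
  show ?thesis
    unfolding spec_C1(2)[OF K n] spec_mult[OF c] den_def[symmetric] S G_def[symmetric]
      sum_distrib_left
    by (intro sum.cong refl bT) simp
qed

theorem theorem3p6:
  fixes n :: nat
  assumes "n \<ge> 2"
  shows
   "C1 0 n =
      sdiv (of_nat (n * fact n) * qpoch_inf zS ^ n)
           (qpoch_inf qS ^ (n - 1) * qpoch_inf (zS ^ n) * qpoch zS zS (n - 1))
    * suminf (\<lambda>k. (yS * sS) ^ (n * k) *
         (\<Prod>t\<in>{1..k}. \<Prod>r\<in>{1..n}.
            sdiv (zS ^ r - qS ^ (t - 1)) (1 - qS ^ t * zS ^ (r - 1))))
   \<and>
   C1 1 n =
      sdiv (of_nat (fact n) * (1 - zS ^ n) * qpoch_inf zS ^ n)
           (qpoch_inf qS ^ (n - 1) * (1 - zS) * qpoch_inf (zS ^ n) * qpoch zS zS (n - 1))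
    * suminf (\<lambda>k'. let k = Suc k' in
         sdiv ((yS * sS) ^ (n * k - 1) * (1 - qS ^ k) *
                 (\<Prod>t\<in>{1..k}. \<Prod>r\<in>{1..n}. zS ^ r - qS ^ (t - 1)))
              ((zS ^ n - qS ^ (k - 1)) *
                 (\<Prod>t\<in>{1..k}. \<Prod>r\<in>{1..n}. 1 - qS ^ t * zS ^ (r - 1))))"
  by (intro conjI ser_eqI C1_0_spec C1_1_spec assms)

end
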